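(* Let $\Sigma\to\Pi$ be an inclusion of complete pasting diagrams such that both $\Sigma$ and $\Pi$ contain all the interior faces of the underlying graph and are closed under taking subdivisions. Then the inclusion $$\mathrm N(\Sigma)\to\mathrm N(\Pi)$$ is mid anodyne.
   Context: **Globular graphs.** Graphs are finite directed graphs (multiple edges allowed). Paths are directed and may be trivial (a single vertex); $p\cdot q$ is concatenation. A source of a graph is a vertex with a directed path to every other vertex; a target is a source of the opposite graph. An $st$-graph is a plane graph with a unique source $s$ and a unique target $t$, both incident with the exterior face. A face $\phi$ is globular if its clockwise oriented boundary is $p\cdot q^{op}$ for nontrivial directed paths $p,q$. For an interior face, $\operatorname{dom}\phi=p$, $\operatorname{cod}\phi=q$; for the exterior face the opposite convention is used, $\operatorname{dom}=q$, $\operatorname{cod}=p$ (so $\operatorname{dom}G\cdot(\operatorname{cod}G)^{op}$ runs clockwise around $G$). A globular graph is an $st$-graph all of whose faces are globular; the single-vertex graph is also allowed (trivial globular graph). $\operatorname{dom}G,\operatorname{cod}G,\partial G$ are those of the exterior face. Subgraphs carry the induced embedding. An interior face $\phi$ of $G$ is also regarded as the subgraph $\operatorname{dom}\phi\cup\operatorname{cod}\phi$ of $G$. **Nerve of $G$.** A glob is a globular subgraph $\gamma$ each of whose edges is incident with the exterior face of $\gamma$. On the set $PG$ of directed paths from $s(G)$ to $t(G)$, $p\le q$ iff there are a glob $\gamma\subseteq G$ and possibly trivial paths $a,b$ with $p=a\cdot\operatorname{dom}\gamma\cdot b$, $q=a\cdot\operatorname{cod}\gamma\cdot b$; $\gamma$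 is then a witness for $p\le q$. $\mathrm N(G)$ is the nerve of the poset $(PG,\le)$. **Pasting diagrams.** If $H_1,H_2\subseteq G$ are globular subgraphs with $t(H_1)=s(H_2)$, their join is $H_1\vee H_2=H_1\cup H_2$. A pasting diagram $\Sigma=(G,S)$ is a globular graph $G$ with a set $S$ of globular subgraphs of $G$ containing all paths and closed under taking globular subgraphs. It is complete if $S$ is closed under joins (whenever defined). A globular subgraph $K\subseteq G$ is a subdivision of a globular subgraph $H\subseteq G$ if $H\subseteq K$ and $\partial H=\partial K$; $\Sigma$ is closed under taking subdivisions if every subdivision of a member of $S$ is in $S$. An inclusion $\Sigma\to\Pi$ of pasting diagrams $\Sigma=(G,S)$, $\Pi=(G,T)$ on the same graph means $S\subseteq T$. The nerve $\mathrm N(\Sigma)\subseteq\mathrm N(G)$ consists of the simplices $(p_0\le\dots\le p_n)$ for which there is $A\in S$ such that all relations $p_{i-1}\le p_i$ have witnesses $\gamma_i\subseteq A$. A mid fibration (= inner fibration) is a map of simplicial sets with the right lifting property against all inner horn inclusions $\Lambda^n_i\to\Delta^n$, $0<i<n$; a map is mid anodyne (= inner anodyne) if it has the left lifting property against all mid fibrations. *)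

theory Defs
  imports "HOL-Complex_Analysis.Complex_Analysis" "Graph_Theory.Digraph_Component"
begin

section \<open>Plane directed graphs\<close>

text \<open>
  A graph is drawn in the complex plane by a point for every vertex and a curve for every arc.
  The drawing is kept apart from the graph, so that a subgraph with its induced embedding is
  simply a subgraph together with the same drawing.
\<close>

record ('v, 'e) drawing =
  point :: "'v \<Rightarrow> complex"
  curve :: "'e \<Rightarrow> real \<Rightarrow> complex"

definition plane_graph :: "('v, 'e) drawing \<Rightarrow> ('v, 'e) pre_digraph \<Rightarrow> bool" where
  "plane_graph E G \<longleftrightarrow>
     fin_digraph G \<and>
     inj_on (point E) (verts G) \<and>
     (\<forall>e\<in>arcs G. simple_path (curve E e) \<and>
        pathstart (curve E e) = point E (tail G e) \<and>
        pathfinish (curve E e) = point E (head G e) \<and>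
        curve E e ` {0<..<1} \<inter> point E ` verts G = {}) \<and>
     (\<forall>e\<in>arcs G. \<forall>f\<in>arcs G. e \<noteq> f \<longrightarrow> curve E e ` {0<..<1} \<inter> curve E f ` {0<..<1} = {})"

definition support :: "('v, 'e) drawing \<Rightarrow> ('v, 'e) pre_digraph \<Rightarrow> complex set" where
  "support E G = point E ` verts G \<union> (\<Union>e\<in>arcs G. path_image (curve E e))"

definition faces :: "('v, 'e) drawing \<Rightarrow> ('v, 'e) pre_digraph \<Rightarrow> complex set set" where
  "faces E G = components (- support E G)"

text \<open>The support of a finite plane graph is compact, so its outside is the unbounded face.\<close>

definition exterior_face :: "('v, 'e) drawing \<Rightarrow> ('v, 'e) pre_digraph \<Rightarrow> complex set" where
  "exterior_face E G = outside (support E G)"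

definition interior_faces :: "('v, 'e) drawing \<Rightarrow> ('v, 'e) pre_digraph \<Rightarrow> complex set set" where
  "interior_faces E G = faces E G - {exterior_face E G}"

definition vertex_incident :: "('v, 'e) drawing \<Rightarrow> ('v, 'e) pre_digraph \<Rightarrow> 'v \<Rightarrow> complex set \<Rightarrow> bool" where
  "vertex_incident E G v \<phi> \<longleftrightarrow> v \<in> verts G \<and> \<phi> \<in> faces E G \<and> point E v \<in> frontier \<phi>"

definition arc_incident :: "('v, 'e) drawing \<Rightarrow> ('v, 'e) pre_digraph \<Rightarrow> 'e \<Rightarrow> complex set \<Rightarrow> bool" where
  "arc_incident E G e \<phi> \<longleftrightarrow> e \<in> arcs G \<and> \<phi> \<in> faces E G \<and> path_image (curve E e) \<subseteq> frontier \<phi>"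

section \<open>Globular graphs\<close>

definition opposite :: "('v, 'e) pre_digraph \<Rightarrow> ('v, 'e) pre_digraph" where
  "opposite G = G\<lparr>tail := head G, head := tail G\<rparr>"

definition is_source :: "('v, 'e) pre_digraph \<Rightarrow> 'v \<Rightarrow> bool" where
  "is_source G s \<longleftrightarrow> s \<in> verts G \<and> (\<forall>v\<in>verts G. \<exists>p. pre_digraph.apath G s p v)"

definition is_target :: "('v, 'e) pre_digraph \<Rightarrow> 'v \<Rightarrow> bool" where
  "is_target G t \<longleftrightarrow> is_source (opposite G) t"

definition source_of :: "('v, 'e) pre_digraph \<Rightarrow> 'v" where
  "source_of G = (THE s. is_source G s)"

definition target_of :: "('v, 'e) pre_digraph \<Rightarrow> 'v" where
  "target_of G = (THE t. is_target G t)"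

definition st_graph :: "('v, 'e) drawing \<Rightarrow> ('v, 'e) pre_digraph \<Rightarrow> bool" where
  "st_graph E G \<longleftrightarrow>
     plane_graph E G \<and> (\<exists>!s. is_source G s) \<and> (\<exists>!t. is_target G t) \<and>
     vertex_incident E G (source_of G) (exterior_face E G) \<and>
     vertex_incident E G (target_of G) (exterior_face E G)"

text \<open>The curve traced by a nontrivial walk, given by its list of arcs.\<close>

fun walk_curve :: "('v, 'e) drawing \<Rightarrow> 'e list \<Rightarrow> real \<Rightarrow> complex" where
  "walk_curve E [e] = curve E e"
| "walk_curve E (e # f # es) = curve E e +++ walk_curve E (f # es)"

text \<open>
  \<open>clockwise_boundary E G \<phi> p q\<close>: the clockwise oriented boundary of the face \<open>\<phi>\<close> is
  \<open>p \<cdot> q\<^sup>o\<^sup>p\<close> for nontrivial directed paths \<open>p\<close> and \<open>q\<close>. The closed walk has to trace out the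
  frontier of \<open>\<phi>\<close> with \<open>\<phi>\<close> on its right-hand side. The latter is the condition on winding numbers:
  these drop by one on crossing a curve from its left to its right. Hence for an interior face
  the winding number is \<open>-1\<close> on \<open>\<phi>\<close> and \<open>0\<close> on all other faces, whereas for the exterior face it is
  \<open>0\<close> on \<open>\<phi>\<close> and \<open>1\<close> on all other faces, that is, the walk runs counterclockwise around the graph.
  An arc with \<open>\<phi>\<close> on both of its sides occurs both in \<open>p\<close> and in \<open>q\<close>.
\<close>

definition clockwise_boundary ::
    "('v, 'e) drawing \<Rightarrow> ('v, 'e) pre_digraph \<Rightarrow> complex set \<Rightarrow> 'e list \<Rightarrow> 'e list \<Rightarrow> bool" where
  "clockwise_boundary E G \<phi> p q \<longleftrightarrow>
     p \<noteq> [] \<and> q \<noteq> [] \<and>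
     (\<exists>u v. pre_digraph.apath G u p v \<and> pre_digraph.apath G u q v) \<and>
     (let \<gamma> = walk_curve E p +++ reversepath (walk_curve E q)
      in path_image \<gamma> = frontier \<phi> \<and>
         (\<forall>z\<in>\<phi>. \<forall>w\<in>- (support E G \<union> \<phi>). winding_number \<gamma> z = winding_number \<gamma> w - 1))"

definition globular_face :: "('v, 'e) drawing \<Rightarrow> ('v, 'e) pre_digraph \<Rightarrow> complex set \<Rightarrow> bool" where
  "globular_face E G \<phi> \<longleftrightarrow> \<phi> \<in> faces E G \<and> (\<exists>p q. clockwise_boundary E G \<phi> p q)"

text \<open>\<open>dom \<phi> = p\<close> and \<open>cod \<phi> = q\<close>, with the opposite convention for the exterior face.\<close>

definition face_dom_cod ::
    "('v, 'e) drawing \<Rightarrow> ('v, 'e) pre_digraph \<Rightarrow> complex set \<Rightarrow> 'e list \<Rightarrow> 'e list \<Rightarrow> bool" where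
  "face_dom_cod E G \<phi> p q \<longleftrightarrow>
     \<phi> \<in> faces E G \<and>
     (if \<phi> = exterior_face E G then clockwise_boundary E G \<phi> q p else clockwise_boundary E G \<phi> p q)"

definition trivial_graph :: "('v, 'e) pre_digraph \<Rightarrow> bool" where
  "trivial_graph G \<longleftrightarrow> (\<exists>v. verts G = {v}) \<and> arcs G = {}"

definition globular :: "('v, 'e) drawing \<Rightarrow> ('v, 'e) pre_digraph \<Rightarrow> bool" where
  "globular E G \<longleftrightarrow>
     plane_graph E G \<and>
     (trivial_graph G \<or> st_graph E G \<and> (\<forall>\<phi>\<in>faces E G. globular_face E G \<phi>))"

text \<open>\<open>dom G = p\<close> and \<open>cod G = q\<close>.\<close>

definition dom_cod ::
    "('v, 'e) drawing \<Rightarrow> ('v, 'e) pre_digraph \<Rightarrow> 'e list \<Rightarrow> 'e list \<Rightarrow> bool" where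
  "dom_cod E G p q \<longleftrightarrow>
     trivial_graph G \<and> p = [] \<and> q = [] \<or> face_dom_cod E G (exterior_face E G) p q"

definition same_boundary ::
    "('v, 'e) drawing \<Rightarrow> ('v, 'e) pre_digraph \<Rightarrow> ('v, 'e) pre_digraph \<Rightarrow> bool" where
  "same_boundary E H K \<longleftrightarrow>
     source_of H = source_of K \<and> target_of H = target_of K \<and>
     (\<exists>p q. dom_cod E H p q \<and> dom_cod E K p q)"

definition globular_subgraph ::
    "('v, 'e) drawing \<Rightarrow> ('v, 'e) pre_digraph \<Rightarrow> ('v, 'e) pre_digraph \<Rightarrow> bool" where
  "globular_subgraph E H G \<longleftrightarrow> subgraph H G \<and> globular E H"

definition path_graph :: "('v, 'e) pre_digraph \<Rightarrow> 'v \<Rightarrow> 'e list \<Rightarrow> ('v, 'e) pre_digraph" where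
  "path_graph G u p =
     \<lparr>verts = set (pre_digraph.awalk_verts G u p), arcs = set p, tail = tail G, head = head G\<rparr>"

definition face_graphs :: "('v, 'e) drawing \<Rightarrow> ('v, 'e) pre_digraph \<Rightarrow> complex set \<Rightarrow> ('v, 'e) pre_digraph set" where
  "face_graphs E G \<phi> =
     {Digraph_Component.union (path_graph G u p) (path_graph G u q) | u v p q.
        face_dom_cod E G \<phi> p q \<and> pre_digraph.apath G u p v \<and> pre_digraph.apath G u q v}"

section \<open>Pasting diagrams\<close>

definition pasting_diagram ::
    "('v, 'e) drawing \<Rightarrow> ('v, 'e) pre_digraph \<Rightarrow> ('v, 'e) pre_digraph set \<Rightarrow> bool" where
  "pasting_diagram E G S \<longleftrightarrow>
     globular E G \<and>
     (\<forall>H\<in>S. globular_subgraph E H G) \<and>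
     (\<forall>u p v. pre_digraph.apath G u p v \<longrightarrow> path_graph G u p \<in> S) \<and>
     (\<forall>H\<in>S. \<forall>K. globular_subgraph E K H \<longrightarrow> K \<in> S)"

definition complete_pasting_diagram ::
    "('v, 'e) drawing \<Rightarrow> ('v, 'e) pre_digraph \<Rightarrow> ('v, 'e) pre_digraph set \<Rightarrow> bool" where
  "complete_pasting_diagram E G S \<longleftrightarrow>
     pasting_diagram E G S \<and>
     (\<forall>H1\<in>S. \<forall>H2\<in>S. target_of H1 = source_of H2 \<longrightarrow> Digraph_Component.union H1 H2 \<in> S)"

definition subdivision_of ::
    "('v, 'e) drawing \<Rightarrow> ('v, 'e) pre_digraph \<Rightarrow> ('v, 'e) pre_digraph \<Rightarrow> ('v, 'e) pre_digraph \<Rightarrow> bool" where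
  "subdivision_of E G K H \<longleftrightarrow>
     globular_subgraph E K G \<and> globular_subgraph E H G \<and> subgraph H K \<and> same_boundary E H K"

definition closed_under_subdivisions ::
    "('v, 'e) drawing \<Rightarrow> ('v, 'e) pre_digraph \<Rightarrow> ('v, 'e) pre_digraph set \<Rightarrow> bool" where
  "closed_under_subdivisions E G S \<longleftrightarrow> (\<forall>H\<in>S. \<forall>K. subdivision_of E G K H \<longrightarrow> K \<in> S)"

definition contains_interior_faces ::
    "('v, 'e) drawing \<Rightarrow> ('v, 'e) pre_digraph \<Rightarrow> ('v, 'e) pre_digraph set \<Rightarrow> bool" where
  "contains_interior_faces E G S \<longleftrightarrow> (\<forall>\<phi>\<in>interior_faces E G. face_graphs E G \<phi> \<subseteq> S)"

section \<open>Simplicial sets\<close>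

text \<open>
  The monotone map \<open>\<theta> : [m] \<rightarrow> [n]\<close> is represented by the list \<open>[\<theta> 0, \<dots>, \<theta> m]\<close>.
\<close>

definition operators :: "nat \<Rightarrow> nat \<Rightarrow> nat list set" where
  "operators m n = {\<theta>. length \<theta> = Suc m \<and> set \<theta> \<subseteq> {..n} \<and> sorted \<theta>}"

text \<open>\<open>act X n \<theta> : X\<^sub>n \<rightarrow> X\<^sub>m\<close> is the map induced by \<open>\<theta> : [m] \<rightarrow> [n]\<close>.\<close>

record 'x sset =
  simplices :: "nat \<Rightarrow> 'x set"
  act :: "nat \<Rightarrow> nat list \<Rightarrow> 'x \<Rightarrow> 'x"

definition simplicial_set :: "'x sset \<Rightarrow> bool" where
  "simplicial_set X \<longleftrightarrow>
     (\<forall>m n. \<forall>\<theta>\<in>operators m n. \<forall>x\<in>simplices X n. act X n \<theta> x \<in> simplices X m) \<and>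
     (\<forall>n. \<forall>x\<in>simplices X n. act X n [0..<Suc n] x = x) \<and>
     (\<forall>k m n. \<forall>\<eta>\<in>operators k m. \<forall>\<theta>\<in>operators m n. \<forall>x\<in>simplices X n.
        act X m \<eta> (act X n \<theta> x) = act X n (map ((!) \<theta>) \<eta>) x)"

definition simplicial_map :: "'x sset \<Rightarrow> 'y sset \<Rightarrow> (nat \<Rightarrow> 'x \<Rightarrow> 'y) \<Rightarrow> bool" where
  "simplicial_map X Y f \<longleftrightarrow>
     simplicial_set X \<and> simplicial_set Y \<and>
     (\<forall>n. \<forall>x\<in>simplices X n. f n x \<in> simplices Y n) \<and>
     (\<forall>m n. \<forall>\<theta>\<in>operators m n. \<forall>x\<in>simplices X n. f m (act X n \<theta> x) = act Y n \<theta> (f n x))"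

text \<open>The map \<open>i : A \<rightarrow> B\<close> has the left lifting property against \<open>p : X \<rightarrow> Y\<close>.\<close>

definition lifts_against ::
    "'a sset \<Rightarrow> 'b sset \<Rightarrow> (nat \<Rightarrow> 'a \<Rightarrow> 'b) \<Rightarrow> 'x sset \<Rightarrow> 'y sset \<Rightarrow> (nat \<Rightarrow> 'x \<Rightarrow> 'y) \<Rightarrow> bool" where
  "lifts_against A B i X Y p \<longleftrightarrow>
     (\<forall>u v. simplicial_map A X u \<and> simplicial_map B Y v \<and>
            (\<forall>n. \<forall>a\<in>simplices A n. p n (u n a) = v n (i n a)) \<longrightarrow>
        (\<exists>h. simplicial_map B X h \<and>
             (\<forall>n. \<forall>a\<in>simplices A n. h n (i n a) = u n a) \<and>
             (\<forall>n. \<forall>b\<in>simplices B n. p n (h n b) = v n b)))"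

text \<open>A chain \<open>p\<^sub>0 \<le> \<dots> \<le> p\<^sub>n\<close> in a poset is represented by the list \<open>[p\<^sub>0, \<dots>, p\<^sub>n]\<close>.\<close>

definition nerve :: "'a set \<Rightarrow> ('a \<Rightarrow> 'a \<Rightarrow> bool) \<Rightarrow> 'a list sset" where
  "nerve P le =
     \<lparr>simplices = (\<lambda>n. {xs. length xs = Suc n \<and> set xs \<subseteq> P \<and> sorted_wrt le xs}),
      act = (\<lambda>n \<theta> xs. map ((!) xs) \<theta>)\<rparr>"

definition standard_simplex :: "nat \<Rightarrow> nat list sset" where
  "standard_simplex n = nerve {..n} (\<le>)"

definition horn :: "nat \<Rightarrow> nat \<Rightarrow> nat list sset" where
  "horn n i = (standard_simplex n)
     \<lparr>simplices := (\<lambda>m. {xs \<in> simplices (standard_simplex n) m. \<exists>j\<le>n. j \<noteq> i \<and> j \<notin> set xs})\<rparr>"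

definition mid_fibration :: "'x sset \<Rightarrow> 'y sset \<Rightarrow> (nat \<Rightarrow> 'x \<Rightarrow> 'y) \<Rightarrow> bool" where
  "mid_fibration X Y p \<longleftrightarrow>
     simplicial_map X Y p \<and>
     (\<forall>n i. 0 < i \<and> i < n \<longrightarrow> lifts_against (horn n i) (standard_simplex n) (\<lambda>_ x. x) X Y p)"

text \<open>
  A HOL formula cannot quantify over all types of simplices, so the types of the simplices of
  domain and codomain of the mid fibrations are parameters. They are to be left as type
  variables when mid anodyne maps are asserted, and the assertion then covers all mid fibrations.
\<close>

definition mid_anodyne ::
    "'x itself \<Rightarrow> 'y itself \<Rightarrow> 'a sset \<Rightarrow> 'b sset \<Rightarrow> (nat \<Rightarrow> 'a \<Rightarrow> 'b) \<Rightarrow> bool" where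
  "mid_anodyne _ _ A B i \<longleftrightarrow>
     simplicial_map A B i \<and>
     (\<forall>(X :: 'x sset) (Y :: 'y sset) p. mid_fibration X Y p \<longrightarrow> lifts_against A B i X Y p)"

section \<open>Nerves of pasting diagrams\<close>

definition glob :: "('v, 'e) drawing \<Rightarrow> ('v, 'e) pre_digraph \<Rightarrow> bool" where
  "glob E \<gamma> \<longleftrightarrow> globular E \<gamma> \<and> (\<forall>e\<in>arcs \<gamma>. arc_incident E \<gamma> e (exterior_face E \<gamma>))"

definition st_paths :: "('v, 'e) pre_digraph \<Rightarrow> 'e list set" where
  "st_paths G = {p. pre_digraph.apath G (source_of G) p (target_of G)}"

definition witness ::
    "('v, 'e) drawing \<Rightarrow> ('v, 'e) pre_digraph \<Rightarrow> ('v, 'e) pre_digraph \<Rightarrow> 'e list \<Rightarrow> 'e list \<Rightarrow> bool" where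
  "witness E G \<gamma> p q \<longleftrightarrow>
     p \<in> st_paths G \<and> q \<in> st_paths G \<and> glob E \<gamma> \<and> subgraph \<gamma> G \<and>
     (\<exists>a b c d. pre_digraph.apath G (source_of G) a (source_of \<gamma>) \<and>
                pre_digraph.apath G (target_of \<gamma>) b (target_of G) \<and>
                dom_cod E \<gamma> c d \<and> p = a @ c @ b \<and> q = a @ d @ b)"

definition path_le ::
    "('v, 'e) drawing \<Rightarrow> ('v, 'e) pre_digraph \<Rightarrow> 'e list \<Rightarrow> 'e list \<Rightarrow> bool" where
  "path_le E G p q \<longleftrightarrow> (\<exists>\<gamma>. witness E G \<gamma> p q)"

definition graph_nerve :: "('v, 'e) drawing \<Rightarrow> ('v, 'e) pre_digraph \<Rightarrow> 'e list list sset" where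
  "graph_nerve E G = nerve (st_paths G) (path_le E G)"

definition diagram_nerve ::
    "('v, 'e) drawing \<Rightarrow> ('v, 'e) pre_digraph \<Rightarrow> ('v, 'e) pre_digraph set \<Rightarrow> 'e list list sset" where
  "diagram_nerve E G S = (graph_nerve E G)
     \<lparr>simplices := (\<lambda>n. {xs \<in> simplices (graph_nerve E G) n.
        \<exists>A\<in>S. \<forall>i<n. \<exists>\<gamma>. witness E G \<gamma> (xs ! i) (xs ! Suc i) \<and> subgraph \<gamma> A})\<rparr>"

end

theory Submission
  imports Defs
begin

text \<open>
  Let \<open>p\<close> and \<open>q\<close> be directed paths from the source to the target. The number \<open>wdiff p q z\<close> is the
  winding number at \<open>z\<close> of the closed curve that follows \<open>p\<close> and returns along \<open>q\<close>, and \<open>le p q\<close> says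
  that these numbers are at most \<open>0\<close> off the graph, that is, \<open>p\<close> runs to the left of \<open>q\<close>. In this form
  the relation is evidently transitive, and pushing a path across an interior face changes the
  numbers by \<open>1\<close> on that face and nowhere else.

  An innermost directed cycle would bound a face whose two sides are parallel directed paths in the
  cycle and hence equal. So there are no directed cycles (\<open>acyclic_walk\<close>), and two paths with the same
  ends decompose into common arcs and lenses, that is, pairs of paths that meet in their ends only
  and bound a Jordan domain (\<open>parallel_induct\<close>). The union of the two sides of a lens is globular,
  and so is everything that is drawn in its disc, a subdivision of the former
  (\<open>lens_cycle_globular\<close>, \<open>lens_disc_globular\<close>). Joins are globular because completeness makes them
  members of the pasting diagram.

  Write \<open>rel p q\<close> if \<open>le p q\<close> and all arcs in which \<open>p\<close> and \<open>q\<close> differ belong to one member of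
  the set \<open>S\<close>. Then the lenses between \<open>p\<close> and \<open>q\<close> are members of \<open>S\<close>, and closure under
  subdivisions followed by joins shows that \<open>S\<close> also contains a graph with all paths between \<open>p\<close>
  and \<open>q\<close>. Therefore \<open>rel\<close> is inherited by subintervals, and the nerve of \<open>(G, S)\<close> consists of the
  chains whose first and last elements are related by \<open>rel\<close> (\<open>diagram_nerve_eq\<close>).

  It remains to enlarge the relation of the smaller diagram to that of the larger one. Pairs are
  added one at a time, those with small intervals first. For a new pair \<open>(p, q)\<close> there is a path
  \<open>a\<close> with \<open>p < a < q\<close> such that every \<open>x\<close> between \<open>p\<close> and \<open>q\<close> other than \<open>q\<close> has a join
  \<open>x \<squnion> a \<noteq> q\<close> (\<open>exists_contracting_path\<close>). This is where the interior faces and completeness enter: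
  \<open>a\<close> arises from \<open>p\<close> by crossing a face. In a chain from \<open>p\<close> to \<open>q\<close>, take the largest element \<open>x\<close>
  that is not above \<open>a\<close>; inserting or deleting \<open>x \<squnion> a\<close> pairs off the new chains, and each pair is
  attached along an inner horn (\<open>lifts_add_interval\<close>).
\<close>

text \<open>Connectedness is meant in the sense of topology throughout.\<close>

hide_const (open) Digraph_Component.connected

section \<open>Plane topology\<close>

text \<open>This is Janiszewski's theorem, applied to \<open>z\<close> and a point far away.\<close>

lemma outside_Un_if_connected_Int:
  fixes X Y :: "complex set"
  assumes "compact X" "compact Y" "connected (X \<inter> Y)" "z \<in> outside X" "z \<in> outside Y"
  shows "z \<in> outside (X \<union> Y)"
proof -
  have "bounded (X \<union> Y)" using assms by (simp add: compact_imp_bounded)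
  then obtain B where B: "X \<union> Y \<subseteq> ball 0 B" "0 < B"
    using bounded_subset_ballD by blast
  define b where "b = complex_of_real (B + 1)"
  have b: "b \<notin> ball 0 B" using B(2) by (simp add: b_def del: of_real_add)
  have out: "b \<in> outside W" if "W \<subseteq> X \<union> Y" for W
  proof -
    have "W \<subseteq> ball 0 B" using that B by blast
    then have "- ball 0 B \<subseteq> outside W" using outside_subset_convex[OF convex_ball] by blast
    then show ?thesis using b by blast
  qed
  have cc: "connected_component (- W) z b" if "z \<in> outside W" "W \<subseteq> X \<union> Y" "compact W" for W
  proof -
    have "connected (outside W)"
      by (rule connected_outside) (use that compact_imp_bounded in auto)
    moreover have "outside W \<subseteq> - W" using outside_no_overlap by blast
    ultimately show ?thesis using that out[OF that(2)] unfolding connected_component_def by blast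
  qed
  have "connected_component (- (X \<union> Y)) z b"
    by (rule Janiszewski) (use assms cc compact_imp_closed in auto)
  then have "connected_component (- (X \<union> Y)) b z" by (rule connected_component_sym)
  then show ?thesis using outside_same_component out[of "X \<union> Y"] by blast
qed

text \<open>
  The inverse of \<open>g\<close> would map a ball in the image onto an interval. Deleting an inner point
  disconnects the interval, but not the ball.
\<close>

lemma interior_arc_image:
  fixes g :: "real \<Rightarrow> complex"
  assumes "arc g"
  shows "interior (path_image g) = {}"
proof (rule ccontr)
  assume "interior (path_image g) \<noteq> {}"
  then obtain x where "x \<in> interior (path_image g)" by blast
  then obtain e where e: "e > 0" "ball x e \<subseteq> path_image g" using mem_interior by blast
  have cg: "continuous_on {0..1} g" and ig: "inj_on g {0..1}"
    using assms by (auto simp: arc_def path_def)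
  obtain h where h: "homeomorphism {0..1} (path_image g) g h"
    using homeomorphism_compact[OF compact_Icc cg _ ig] by (auto simp: path_image_def)
  then have ch: "continuous_on (path_image g) h" and gh: "\<And>y. y \<in> path_image g \<Longrightarrow> g (h y) = y"
    by (auto simp: homeomorphism_def)
  have ih: "h y = h y' \<Longrightarrow> y = y'" if "y \<in> ball x e" "y' \<in> ball x e" for y y'
    using gh that e(2) by (metis subsetD)
  have con: "connected (h ` ball x e)"
    by (intro connected_continuous_image connected_ball continuous_on_subset[OF ch] e)
  have inner: False if y: "y1 \<in> ball x e" "y2 \<in> ball x e" "h y1 < h y2" for y1 y2
  proof -
    let ?t = "(h y1 + h y2) / 2"
    have "?t \<in> h ` ball x e"
      using connectedD_interval[OF con, of "h y1" "h y2" ?t] y by auto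
    then obtain y3 where y3: "y3 \<in> ball x e" "h y3 = ?t" by auto
    have "connected (h ` (ball x e - {y3}))"
      by (intro connected_continuous_image continuous_on_subset[OF ch] connected_open_delete)
        (use e in auto)
    moreover have "y1 \<noteq> y3" "y2 \<noteq> y3" using y y3 by auto
    ultimately have "?t \<in> h ` (ball x e - {y3})"
      using connectedD_interval[of "h ` (ball x e - {y3})" "h y1" "h y2" ?t] y by auto
    then obtain y4 where y4: "y4 \<in> ball x e - {y3}" "?t = h y4" by blast
    then have "y4 = y3" by (intro ih) (use y3 y4 in auto)
    then show False using y4 by blast
  qed
  let ?y = "x + of_real (e/2)"
  have "?y \<in> ball x e" "x \<in> ball x e" "?y \<noteq> x" using e by (auto simp: dist_norm)
  then have "h x < h ?y \<or> h ?y < h x" using ih[of x ?y] by fastforce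
  then show False using inner \<open>?y \<in> ball x e\<close> \<open>x \<in> ball x e\<close> by blast
qed

lemma connected_subset_outside:
  assumes "connected K" "K \<inter> X = {}" "x \<in> K" "x \<in> outside X"
  shows "K \<subseteq> outside X"
proof
  fix y assume "y \<in> K"
  then have "connected_component (- X) x y"
    using assms unfolding connected_component_def by blast
  then show "y \<in> outside X" using outside_same_component assms by blast
qed

lemma connected_unbounded_subset_outside:
  assumes "connected K" "K \<inter> X = {}" "\<not> bounded K"
  shows "K \<subseteq> outside X"
proof
  fix y assume y: "y \<in> K"
  have "K \<subseteq> connected_component_set (- X) y"
    by (rule connected_component_maximal) (use assms y in auto)
  then show "y \<in> outside X"
    using assms y bounded_subset by (auto simp: outside_def)
qed

section \<open>Traces of arc sets\<close>

definition trace :: "('v, 'e) drawing \<Rightarrow> 'e set \<Rightarrow> complex set" where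
  "trace E F = (\<Union>e\<in>F. path_image (curve E e))"

definition open_arc :: "('v, 'e) drawing \<Rightarrow> 'e \<Rightarrow> complex set" where
  "open_arc E e = curve E e ` {0<..<1}"

lemma trace_Un: "trace E (A \<union> B) = trace E A \<union> trace E B"
  and trace_insert: "trace E (insert e A) = path_image (curve E e) \<union> trace E A"
  and trace_empty[simp]: "trace E {} = {}"
  by (auto simp: trace_def)

lemma trace_mono: "A \<subseteq> B \<Longrightarrow> trace E A \<subseteq> trace E B"
  by (auto simp: trace_def)

locale plane_digraph = fin_digraph G for G :: "('v, 'e) pre_digraph" +
  fixes E :: "('v, 'e) drawing"
  assumes plane: "plane_graph E G"
begin

abbreviation "pt \<equiv> point E"
abbreviation "supp \<equiv> support E G"
abbreviation "tr \<equiv> trace E"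
abbreviation "ends F \<equiv> tail G ` F \<union> head G ` F"

lemma inj_pt: "u \<in> verts G \<Longrightarrow> v \<in> verts G \<Longrightarrow> pt u = pt v \<longleftrightarrow> u = v"
  using plane unfolding plane_graph_def by (auto dest: inj_onD)

lemma curve_simple: "e \<in> arcs G \<Longrightarrow> simple_path (curve E e)"
  and curve_start: "e \<in> arcs G \<Longrightarrow> pathstart (curve E e) = pt (tail G e)"
  and curve_finish: "e \<in> arcs G \<Longrightarrow> pathfinish (curve E e) = pt (head G e)"
  using plane unfolding plane_graph_def by auto

lemma open_arc_vert: "e \<in> arcs G \<Longrightarrow> w \<in> verts G \<Longrightarrow> pt w \<notin> open_arc E e"
  using plane unfolding plane_graph_def open_arc_def by blast

lemma open_arc_disjoint:
  "e \<in> arcs G \<Longrightarrow> f \<in> arcs G \<Longrightarrow> e \<noteq> f \<Longrightarrow> open_arc E e \<inter> open_arc E f = {}"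
  using plane unfolding plane_graph_def open_arc_def by blast

lemma curve_image:
  assumes "e \<in> arcs G"
  shows "path_image (curve E e) = open_arc E e \<union> {pt (tail G e), pt (head G e)}"
proof -
  have "{0..1::real} = {0<..<1} \<union> {0, 1}" by auto
  then have "path_image (curve E e) = open_arc E e \<union> {curve E e 0, curve E e 1}"
    by (auto simp: path_image_def open_arc_def)
  then show ?thesis using curve_start[OF assms] curve_finish[OF assms]
    by (simp add: pathstart_def pathfinish_def open_arc_def)
qed

lemma pt_in_curve:
  assumes "e \<in> arcs G" "w \<in> verts G"
  shows "pt w \<in> path_image (curve E e) \<longleftrightarrow> w = tail G e \<or> w = head G e"
  using assms curve_image[of e] open_arc_vert[of e w] inj_pt by auto

lemma pt_in_trace:
  assumes "F \<subseteq> arcs G" "w \<in> verts G"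
  shows "pt w \<in> tr F \<longleftrightarrow> w \<in> ends F"
  using assms pt_in_curve by (fastforce simp: trace_def)

lemma open_arc_in_trace:
  assumes "F \<subseteq> arcs G" "e \<in> arcs G" "z \<in> open_arc E e"
  shows "z \<in> tr F \<longleftrightarrow> e \<in> F"
proof
  assume "z \<in> tr F"
  then obtain f where f: "f \<in> F" "z \<in> path_image (curve E f)" by (auto simp: trace_def)
  then have fG: "f \<in> arcs G" using assms by blast
  have "z \<noteq> pt (tail G f)" "z \<noteq> pt (head G f)"
    using open_arc_vert[OF assms(2)] assms(3) fG by (metis tail_in_verts, metis head_in_verts)
  then have "z \<in> open_arc E f" using f(2) unfolding curve_image[OF fG] by simp
  then have "open_arc E e \<inter> open_arc E f \<noteq> {}" using assms(3) by (rule_tac notI) (metis IntI empty_iff)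
  then show "e \<in> F" using f(1) open_arc_disjoint[OF assms(2) fG] by metis
next
  assume "e \<in> F"
  then show "z \<in> tr F" using curve_image[OF assms(2)] assms(3) by (auto simp: trace_def)
qed

lemma trace_cases:
  assumes "F \<subseteq> arcs G" "z \<in> tr F"
  obtains e where "e \<in> F" "z \<in> open_arc E e" | w where "w \<in> ends F" "z = pt w"
  using assms curve_image unfolding trace_def by blast

lemma ends_verts: "F \<subseteq> arcs G \<Longrightarrow> ends F \<subseteq> verts G"
  by auto

lemma pt_ends_trace: "F \<subseteq> arcs G \<Longrightarrow> w \<in> ends F \<Longrightarrow> pt w \<in> tr F"
  using pt_in_trace[of F w] ends_verts[of F] subsetD[of "ends F" "verts G" w] by metis

text \<open>Different arcs meet in their ends only.\<close>

lemma trace_Int: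
  assumes "F \<subseteq> arcs G" "H \<subseteq> arcs G"
  shows "tr F \<inter> tr H \<subseteq> tr (F \<inter> H) \<union> pt ` (ends F \<inter> ends H)"
proof
  fix z assume z: "z \<in> tr F \<inter> tr H"
  then have "z \<in> tr F" by blast
  then show "z \<in> tr (F \<inter> H) \<union> pt ` (ends F \<inter> ends H)"
  proof (rule trace_cases[OF assms(1)])
    fix e assume arc: "e \<in> F" "z \<in> open_arc E e"
    then have "e \<in> H" using open_arc_in_trace[of H e z] z assms by blast
    then have "e \<in> F \<inter> H" using arc by blast
    then show ?thesis using open_arc_in_trace[of "F \<inter> H" e z] arc assms by blast
  next
    fix w assume vert: "w \<in> ends F" "z = pt w"
    then have "w \<in> ends H" using pt_in_trace[of H w] z assms ends_verts[of F] by blast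
    then show ?thesis using vert by blast
  qed
qed

lemma compact_trace: "F \<subseteq> arcs G \<Longrightarrow> compact (tr F)"
  unfolding trace_def
  by (intro compact_UN) (auto intro: finite_subset[OF _ finite_arcs] compact_simple_path_image curve_simple)

lemma supp_eq: "supp = pt ` verts G \<union> tr (arcs G)"
  by (simp add: support_def trace_def)

lemma compact_supp: "compact supp"
  unfolding supp_eq by (intro compact_Un compact_trace finite_imp_compact) auto

lemma trace_subset_supp: "F \<subseteq> arcs G \<Longrightarrow> tr F \<subseteq> supp"
  unfolding supp_eq using trace_mono by blast

lemma pt_in_supp: "w \<in> verts G \<Longrightarrow> pt w \<in> supp"
  unfolding supp_eq by blast

lemma open_arc_subset_curve: "e \<in> arcs G \<Longrightarrow> open_arc E e \<subseteq> path_image (curve E e)"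
  using curve_image by blast

lemma supp_cases:
  assumes "z \<in> supp"
  obtains w where "w \<in> verts G" "z = pt w" | e where "e \<in> arcs G" "z \<in> open_arc E e"
proof (cases "z \<in> tr (arcs G)")
  case True
  show ?thesis
  proof (rule trace_cases[OF order_refl True])
    fix e assume "e \<in> arcs G" "z \<in> open_arc E e"
    then show ?thesis by (rule that(2))
  next
    fix w assume "w \<in> ends (arcs G)" "z = pt w"
    then show ?thesis using that(1) ends_verts[OF order_refl] by blast
  qed
next
  case False
  then show ?thesis using assms that(1) unfolding supp_eq by blast
qed

lemma curve_continuous: "e \<in> arcs G \<Longrightarrow> continuous_on {0..1} (curve E e)"
  using curve_simple simple_path_imp_path path_def by blast

lemma open_arc_ne: "open_arc E e \<noteq> {}"
  unfolding open_arc_def by (metis empty_iff greaterThanLessThan_iff imageI zero_less_one dense)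

lemma connected_open_arc:
  assumes "e \<in> arcs G"
  shows "connected (open_arc E e)"
  unfolding open_arc_def
  by (intro connected_continuous_image continuous_on_subset[OF curve_continuous[OF assms]]) auto

lemma curve_subset_closure: "e \<in> arcs G \<Longrightarrow> path_image (curve E e) \<subseteq> closure (open_arc E e)"
  unfolding path_image_def open_arc_def
  using image_closure_subset[of "{0<..<1::real}" "curve E e" "closure (curve E e ` {0<..<1})"]
    curve_continuous by (simp add: closure_subset)

subsection \<open>Walks and their curves\<close>

lemma walk_curve_Cons: "p \<noteq> [] \<Longrightarrow> walk_curve E (e # p) = curve E e +++ walk_curve E p"
  by (cases p) auto

lemma walk_curve_props:
  assumes "awalk u p v" "p \<noteq> []"
  shows "path (walk_curve E p)" "pathstart (walk_curve E p) = pt u"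
    "pathfinish (walk_curve E p) = pt v" "path_image (walk_curve E p) = tr (set p)"
proof -
  have "path (walk_curve E p) \<and> pathstart (walk_curve E p) = pt u \<and>
    pathfinish (walk_curve E p) = pt v \<and> path_image (walk_curve E p) = tr (set p)"
    using assms
  proof (induction p arbitrary: u)
    case (Cons e p)
    have e: "e \<in> arcs G" "tail G e = u" and p: "awalk (head G e) p v"
      using Cons.prems by (auto simp: awalk_Cons_iff)
    show ?case
    proof (cases "p = []")
      case True
      then show ?thesis using e p curve_start curve_finish curve_simple
        by (auto simp: trace_def awalk_Nil_iff simple_path_imp_path)
    next
      case False
      then show ?thesis using Cons.IH[OF p] e curve_start curve_finish curve_simple
        by (auto simp: walk_curve_Cons trace_insert path_image_join simple_path_imp_path)
    qed
  qed simp
  then show "path (walk_curve E p)" "pathstart (walk_curve E p) = pt u"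
    "pathfinish (walk_curve E p) = pt v" "path_image (walk_curve E p) = tr (set p)" by auto
qed

lemma ends_subset_awalk_verts: "awalk u p v \<Longrightarrow> ends (set p) \<subseteq> set (awalk_verts u p)"
  using set_awalk_verts by fastforce

lemma awalk_arcs: "awalk u p v \<Longrightarrow> set p \<subseteq> arcs G"
  by auto

lemma curve_arc:
  assumes "e \<in> arcs G" "tail G e \<noteq> head G e"
  shows "Path_Connected.arc (curve E e)"
  using assms curve_simple curve_start curve_finish inj_pt by (auto simp: arc_simple_path)

lemma arc_walk_curve:
  assumes "apath u p v" "p \<noteq> []"
  shows "Path_Connected.arc (walk_curve E p)"
  using assms
proof (induction p arbitrary: u)
  case (Cons e p)
  have e: "e \<in> arcs G" "tail G e = u" and p: "apath (head G e) p v" and u: "u \<notin> set (awalk_verts (head G e) p)"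
    using Cons.prems by (auto simp: apath_Cons_iff)
  have aw: "awalk (head G e) p v" using p by (simp add: apath_def)
  have "head G e \<noteq> u" using u hd_in_awalk_verts(1)[OF aw] by auto
  then have ae: "Path_Connected.arc (curve E e)" using e curve_arc by auto
  show ?case
  proof (cases "p = []")
    case True then show ?thesis using ae by simp
  next
    case False
    note props = walk_curve_props[OF aw False]
    have sub: "ends (set p) \<subseteq> set (awalk_verts (head G e) p)" by (rule ends_subset_awalk_verts[OF aw])
    then have "u \<notin> ends (set p)" using u by blast
    then have "e \<notin> set p" using e by auto
    then have "{e} \<inter> set p = {}" by auto
    then have "path_image (curve E e) \<inter> tr (set p) \<subseteq> {pt (head G e)}"
      using trace_Int[of "{e}" "set p"] e awalk_arcs[OF aw] \<open>u \<notin> ends (set p)\<close>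
      by (auto simp: trace_insert)
    then show ?thesis unfolding walk_curve_Cons[OF False]
      by (intro arc_join ae Cons.IH[OF p False]) (use props e curve_finish in auto)
  qed
qed simp

subsection \<open>Winding numbers\<close>

text \<open>
  The winding number of a curve that is not closed is a complex number, additive under
  concatenation. The differences \<open>wdiff\<close> are therefore additive in both walks, empty ones
  included; for parallel walks they are the winding numbers of a closed curve (\<open>winding_loop\<close>).
\<close>

definition walk_winding :: "'e list \<Rightarrow> complex \<Rightarrow> complex" where
  "walk_winding p z = (\<Sum>e\<leftarrow>p. winding_number (curve E e) z)"

definition wdiff :: "'e list \<Rightarrow> 'e list \<Rightarrow> complex \<Rightarrow> real" where
  "wdiff p q z = Re (walk_winding p z - walk_winding q z)"

lemma walk_winding_append: "walk_winding (p @ q) z = walk_winding p z + walk_winding q z"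
  by (simp add: walk_winding_def)

lemma winding_walk_curve:
  assumes "awalk u p v" "p \<noteq> []" "z \<notin> tr (set p)"
  shows "winding_number (walk_curve E p) z = walk_winding p z"
  using assms
proof (induction p arbitrary: u)
  case (Cons e p)
  have e: "e \<in> arcs G" "tail G e = u" and p: "awalk (head G e) p v"
    using Cons.prems by (auto simp: awalk_Cons_iff)
  show ?case
  proof (cases "p = []")
    case True then show ?thesis by (simp add: walk_winding_def)
  next
    case False
    note props = walk_curve_props[OF p False]
    have "winding_number (walk_curve E (e # p)) z =
      winding_number (curve E e) z + winding_number (walk_curve E p) z"
      unfolding walk_curve_Cons[OF False]
      by (rule winding_number_join)
        (use Cons.prems props e curve_finish curve_simple in \<open>auto simp: trace_insert simple_path_imp_path\<close>)
    then show ?thesis using Cons.IH[OF p False] Cons.prems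
      by (simp add: walk_winding_def trace_insert)
  qed
qed simp

abbreviation "loop_of p q \<equiv> walk_curve E p +++ reversepath (walk_curve E q)"

lemma loop_props:
  assumes "awalk u p v" "awalk u q v" "p \<noteq> []" "q \<noteq> []"
  shows "path (loop_of p q)" "pathfinish (loop_of p q) = pathstart (loop_of p q)"
    "path_image (loop_of p q) = tr (set p \<union> set q)"
  using walk_curve_props[OF assms(1,3)] walk_curve_props[OF assms(2,4)]
  by (auto simp: path_image_join trace_Un)

lemma winding_loop_complex:
  assumes "awalk u p v" "awalk u q v" "p \<noteq> []" "q \<noteq> []" "z \<notin> tr (set p \<union> set q)"
  shows "winding_number (loop_of p q) z = walk_winding p z - walk_winding q z"
proof -
  note P = walk_curve_props[OF assms(1,3)] and Q = walk_curve_props[OF assms(2,4)]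
  have "winding_number (loop_of p q) z =
    winding_number (walk_curve E p) z + winding_number (reversepath (walk_curve E q)) z"
    by (rule winding_number_join) (use P Q assms(5) in \<open>auto simp: trace_Un\<close>)
  also have "winding_number (reversepath (walk_curve E q)) z = - winding_number (walk_curve E q) z"
    by (rule winding_number_reversepath) (use Q assms(5) in \<open>auto simp: trace_Un\<close>)
  finally show ?thesis
    using winding_walk_curve[OF assms(1,3)] winding_walk_curve[OF assms(2,4)] assms(5)
    by (simp add: trace_Un)
qed

lemma winding_loop:
  assumes "awalk u p v" "awalk u q v" "p \<noteq> []" "q \<noteq> []" "z \<notin> tr (set p \<union> set q)"
  shows "winding_number (loop_of p q) z = of_real (wdiff p q z)"
proof -
  have "winding_number (loop_of p q) z \<in> \<int>"
    by (rule integer_winding_number) (use loop_props[OF assms(1-4)] assms(5) in auto)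
  then show ?thesis unfolding winding_loop_complex[OF assms] wdiff_def
    by (metis Ints_cases Re_complex_of_real of_real_of_int_eq)
qed

lemma wdiff_int:
  assumes "awalk u p v" "awalk u q v" "p = [] \<longleftrightarrow> q = []" "z \<notin> tr (set p \<union> set q)"
  shows "wdiff p q z \<in> \<int>"
proof (cases "p = []")
  case True then show ?thesis using assms by (simp add: wdiff_def)
next
  case False
  then have "winding_number (loop_of p q) z \<in> \<int>"
    by (intro integer_winding_number) (use loop_props[OF assms(1,2)] assms in auto)
  then show ?thesis using winding_loop[OF assms(1,2)] assms False
    by (metis Ints_cases Ints_of_int of_real_eq_iff of_real_of_int_eq)
qed

lemma wdiff_constant:
  assumes "awalk u p v" "awalk u q v" "p = [] \<longleftrightarrow> q = []"
    and "connected K" "K \<inter> tr (set p \<union> set q) = {}" "z \<in> K" "w \<in> K"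
  shows "wdiff p q z = wdiff p q w"
proof (cases "p = []")
  case True then show ?thesis using assms by (simp add: wdiff_def walk_winding_def)
next
  case False
  then have q: "q \<noteq> []" using assms by simp
  note P = loop_props[OF assms(1,2) False q]
  have "winding_number (loop_of p q) constant_on K"
    by (rule winding_number_constant) (use P assms in auto)
  then have "winding_number (loop_of p q) z = winding_number (loop_of p q) w"
    using assms unfolding constant_on_def by metis
  moreover have "z \<notin> tr (set p \<union> set q)" "w \<notin> tr (set p \<union> set q)" using assms by auto
  ultimately show ?thesis using winding_loop[OF assms(1,2) False q] by (metis of_real_eq_iff)
qed

lemma wdiff_outside:
  assumes "awalk u p v" "awalk u q v" "p = [] \<longleftrightarrow> q = []" "z \<in> outside (tr (set p \<union> set q))"
  shows "wdiff p q z = 0"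
proof (cases "p = []")
  case True then show ?thesis using assms by (simp add: wdiff_def)
next
  case False
  then have q: "q \<noteq> []" using assms by simp
  note P = loop_props[OF assms(1,2) False q]
  have "winding_number (loop_of p q) z = 0"
    by (rule winding_number_zero_in_outside) (use P assms in auto)
  moreover have "z \<notin> tr (set p \<union> set q)" using assms(4) outside_no_overlap by blast
  ultimately show ?thesis using winding_loop[OF assms(1,2) False q] by auto
qed

lemma wdiff_trans: "wdiff p q z + wdiff q r z = wdiff p r z"
  by (simp add: wdiff_def)

lemma wdiff_self[simp]: "wdiff p p z = 0" by (simp add: wdiff_def)

lemma wdiff_append: "wdiff (p @ p') (q @ q') z = wdiff p q z + wdiff p' q' z"
  by (simp add: wdiff_def walk_winding_append)

lemma wdiff_sym: "wdiff p q z = - wdiff q p z"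
  by (simp add: wdiff_def)

subsection \<open>Jordan curves in a plane graph\<close>

definition jordan :: "'e set \<Rightarrow> bool" where
  "jordan F \<longleftrightarrow> F \<subseteq> arcs G \<and>
     (\<exists>g. simple_path g \<and> pathfinish g = pathstart g \<and> path_image g = tr F)"

abbreviation "disc F \<equiv> - outside (tr F)"

lemma jordanD:
  assumes "jordan F"
  shows "inside (tr F) \<noteq> {}" "open (inside (tr F))" "connected (inside (tr F))"
    "outside (tr F) \<noteq> {}" "open (outside (tr F))" "connected (outside (tr F))"
    "bounded (inside (tr F))" "\<not> bounded (outside (tr F))"
    "frontier (inside (tr F)) = tr F" "frontier (outside (tr F)) = tr F" "F \<subseteq> arcs G"
  using assms Jordan_inside_outside unfolding jordan_def by metis+

text \<open>The shape of a region between two paths: the two sides form a simple closed curve.\<close>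

definition lens :: "'v \<Rightarrow> 'e list \<Rightarrow> 'e list \<Rightarrow> 'v \<Rightarrow> bool" where
  "lens u c d v \<longleftrightarrow> apath u c v \<and> apath u d v \<and> c \<noteq> [] \<and> d \<noteq> [] \<and> set c \<inter> set d = {} \<and>
     set (awalk_verts u c) \<inter> set (awalk_verts u d) \<subseteq> {u, v}"

lemma lens_sym: "lens u c d v \<Longrightarrow> lens u d c v"
  unfolding lens_def by auto

lemma lens_awalk: "lens u c d v \<Longrightarrow> awalk u c v" "lens u c d v \<Longrightarrow> awalk u d v"
  unfolding lens_def apath_def by auto

lemma lens_ne: "lens u c d v \<Longrightarrow> c \<noteq> []" "lens u c d v \<Longrightarrow> d \<noteq> []"
  unfolding lens_def by auto

lemma lens_simple_loop:
  assumes "lens u c d v"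
  shows "simple_path (loop_of c d)"
proof -
  note A = lens_awalk[OF assms] and N = lens_ne[OF assms]
  note P = walk_curve_props[OF A(1) N(1)] and Q = walk_curve_props[OF A(2) N(2)]
  have "set c \<inter> set d = {}" and "ends (set c) \<inter> ends (set d) \<subseteq> {u, v}"
    using assms ends_subset_awalk_verts[OF A(1)] ends_subset_awalk_verts[OF A(2)]
    unfolding lens_def by blast+
  then have "tr (set c) \<inter> tr (set d) \<subseteq> {pt u, pt v}"
    using trace_Int[OF awalk_arcs[OF A(1)] awalk_arcs[OF A(2)]] by fastforce
  then show ?thesis
    by (intro simple_path_join_loop) (use assms arc_walk_curve P Q in \<open>auto simp: lens_def arc_reversepath\<close>)
qed

lemma lens_jordan:
  assumes "lens u c d v" shows "jordan (set c \<union> set d)"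
  unfolding jordan_def
  using lens_simple_loop[OF assms] loop_props[OF lens_awalk[OF assms] lens_ne[OF assms]]
    awalk_arcs lens_awalk[OF assms] by blast

lemma lens_wdiff_inside:
  assumes "lens u c d v"
  obtains \<epsilon> where "\<epsilon> = 1 \<or> \<epsilon> = -1" "\<And>z. z \<in> inside (tr (set c \<union> set d)) \<Longrightarrow> wdiff c d z = \<epsilon>"
proof -
  note A = lens_awalk[OF assms] and N = lens_ne[OF assms]
  note L = loop_props[OF A N]
  have *: "of_real (wdiff c d z) = winding_number (loop_of c d) z" if "z \<in> inside (tr (set c \<union> set d))" for z
    using winding_loop[OF A N, of z] inside_no_overlap that by fastforce
  show ?thesis
    using simple_closed_path_winding_number_inside[OF lens_simple_loop[OF assms]]
  proof cases
    case 1
    have "wdiff c d z = 1" if "z \<in> inside (tr (set c \<union> set d))" for z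
      using *[OF that] 1[unfolded L, OF that] by (metis of_real_1 of_real_eq_iff)
    then show ?thesis using that[of 1] by blast
  next
    case 2
    have "wdiff c d z = -1" if "z \<in> inside (tr (set c \<union> set d))" for z
      using *[OF that] 2[unfolded L, OF that] by (metis of_real_1 of_real_minus of_real_eq_iff)
    then show ?thesis using that[of "-1"] by blast
  qed
qed

lemma lens_wdiff_outside:
  "lens u c d v \<Longrightarrow> z \<in> outside (tr (set c \<union> set d)) \<Longrightarrow> wdiff c d z = 0"
  using wdiff_outside lens_awalk lens_ne by metis

lemma cycle_jordan:
  assumes "f \<in> arcs G" "apath (head G f) r (tail G f)"
  shows "jordan (insert f (set r))"
proof (cases "r = []")
  case True
  then have "head G f = tail G f" using assms by (simp add: apath_Nil_iff)
  then show ?thesis using True assms curve_simple[of f] curve_start[of f] curve_finish[of f]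
    unfolding jordan_def by (auto simp: trace_insert)
next
  case False
  have aw: "awalk (head G f) r (tail G f)" using assms by (simp add: apath_def)
  note P = walk_curve_props[OF aw False]
  have ne: "head G f \<noteq> tail G f" using assms False apath_nonempty_ends by blast
  have fr: "f \<notin> set r"
  proof
    assume "f \<in> set r"
    then obtain r1 r2 where r: "r = r1 @ f # r2" by (meson split_list)
    then have "apath (tail G f) (f # r2) (tail G f)"
      using assms(2) by (auto simp: apath_append_iff apath_Cons_iff)
    then show False using apath_nonempty_ends by blast
  qed
  then have "tr {f} \<inter> tr (set r) \<subseteq> {pt (tail G f), pt (head G f)}"
    using trace_Int[of "{f}" "set r"] assms(1) awalk_arcs[OF aw] by auto
  then have "simple_path (curve E f +++ walk_curve E r)"
    by (intro simple_path_join_loop curve_arc arc_walk_curve[OF assms(2) False])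
      (use P assms(1) curve_start curve_finish ne in \<open>auto simp: trace_insert\<close>)
  moreover have "path_image (curve E f +++ walk_curve E r) = tr (insert f (set r))"
    using P curve_finish assms by (simp add: path_image_join trace_insert)
  ultimately show ?thesis using P assms curve_start[of f] awalk_arcs[OF aw]
    unfolding jordan_def by (intro conjI exI[of _ "curve E f +++ walk_curve E r"]) auto
qed

text \<open>An open arc off the curve is connected and so stays on one side of it.\<close>

lemma arc_side:
  assumes "jordan F" "e \<in> arcs G" "e \<notin> F"
  shows "open_arc E e \<subseteq> inside (tr F) \<or> open_arc E e \<subseteq> outside (tr F)"
proof -
  have dis: "open_arc E e \<inter> tr F = {}"
    using open_arc_in_trace[OF jordanD(11)[OF assms(1)]] assms by blast
  have sub: "open_arc E e \<subseteq> inside (tr F) \<union> outside (tr F)" using dis by auto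
  show ?thesis
  proof (cases "\<exists>x\<in>open_arc E e. x \<in> outside (tr F)")
    case True
    then show ?thesis using connected_subset_outside[OF connected_open_arc dis] assms by blast
  next
    case False then show ?thesis using sub by blast
  qed
qed

lemma inside_outside_disjoint: "inside S \<inter> outside S = {}"
  by (auto simp: inside_def outside_def)

lemma closed_disc: "jordan F \<Longrightarrow> closed (disc F)"
  using jordanD(5) by (simp add: closed_Compl)

lemma disc_eq: "disc F = tr F \<union> inside (tr F)"
  by (simp add: union_with_inside)

lemma arc_in_disc_iff:
  assumes "jordan F" "e \<in> arcs G"
  shows "path_image (curve E e) \<subseteq> disc F \<longleftrightarrow> e \<in> F \<or> open_arc E e \<subseteq> inside (tr F)"
proof
  assume A: "path_image (curve E e) \<subseteq> disc F"
  have "open_arc E e \<noteq> {}" by (rule open_arc_ne)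
  moreover have "open_arc E e \<subseteq> disc F" using A open_arc_subset_curve[OF assms(2)] by (rule order_trans[rotated])
  ultimately have "\<not> open_arc E e \<subseteq> outside (tr F)" by (metis disjoint_eq_subset_Compl inf.absorb_iff2 inf.orderE)
  then show "e \<in> F \<or> open_arc E e \<subseteq> inside (tr F)" using arc_side[OF assms] by blast
next
  assume "e \<in> F \<or> open_arc E e \<subseteq> inside (tr F)"
  then show "path_image (curve E e) \<subseteq> disc F"
  proof
    assume "e \<in> F"
    then have "path_image (curve E e) \<subseteq> tr F" by (auto simp: trace_def)
    then show ?thesis unfolding disc_eq by blast
  next
    assume "open_arc E e \<subseteq> inside (tr F)"
    then have "open_arc E e \<subseteq> disc F" using disc_eq by blast
    then have "closure (open_arc E e) \<subseteq> disc F"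
      using closed_disc[OF assms(1)] by (simp add: closure_minimal)
    then show ?thesis using curve_subset_closure assms by blast
  qed
qed

text \<open>The outside of the curve of \<open>F\<close> is connected and unbounded and avoids the curve of \<open>H\<close>.\<close>

lemma disc_mono:
  assumes "jordan F" "jordan H" "tr H \<subseteq> disc F"
  shows "outside (tr F) \<subseteq> outside (tr H)"
  using connected_unbounded_subset_outside[OF jordanD(6)[OF assms(1)] _ jordanD(8)[OF assms(1)]] assms(3)
  by blast

lemma inside_mono_disc:
  assumes "jordan F" "jordan H" "tr H \<subseteq> disc F"
  shows "inside (tr H) \<subseteq> inside (tr F)"
proof -
  have "inside (tr H) \<inter> outside (tr F) = {}"
    using disc_mono[OF assms] inside_outside_disjoint by blast
  moreover have "inside (tr H) \<inter> tr F = {}"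
  proof (rule ccontr)
    assume "inside (tr H) \<inter> tr F \<noteq> {}"
    then have "inside (tr H) \<inter> closure (outside (tr F)) \<noteq> {}"
      using jordanD(10)[OF assms(1)] by (auto simp: frontier_def)
    then have "inside (tr H) \<inter> outside (tr F) \<noteq> {}"
      using open_Int_closure_eq_empty[OF jordanD(2)[OF assms(2)]] by blast
    then show False using calculation by blast
  qed
  ultimately show ?thesis using inside_Un_outside[of "tr F"] by blast
qed

text \<open>
  Such an arc would run inside the curve of \<open>H\<close>, hence inside the curve of \<open>F\<close>, of which it is a
  part.
\<close>

lemma arc_not_in_smaller_disc:
  assumes "jordan F" "jordan H" "tr H \<subseteq> disc F" "e \<in> F" "e \<notin> H"
  shows "\<not> path_image (curve E e) \<subseteq> disc H"
proof
  assume A: "path_image (curve E e) \<subseteq> disc H"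
  have e: "e \<in> arcs G" using assms jordanD(11) by blast
  have "open_arc E e \<subseteq> inside (tr H)" using arc_in_disc_iff[OF assms(2) e] A assms by blast
  then have "open_arc E e \<subseteq> inside (tr F)" using inside_mono_disc[OF assms(1-3)] by blast
  moreover have "open_arc E e \<subseteq> tr F" using open_arc_in_trace[OF jordanD(11)[OF assms(1)] e] assms by blast
  ultimately show False using open_arc_ne inside_no_overlap by blast
qed

definition disc_arcs :: "'e set \<Rightarrow> 'e set" where
  "disc_arcs F = {e \<in> arcs G. path_image (curve E e) \<subseteq> disc F}"

text \<open>The number of arcs in a disc is the measure by which innermost discs are chosen.\<close>

lemma card_disc_arcs_less:
  assumes "jordan F" "jordan H" "tr H \<subseteq> disc F" "e \<in> F" "e \<notin> H"
  shows "card (disc_arcs H) < card (disc_arcs F)"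
proof (rule psubset_card_mono)
  show "finite (disc_arcs F)" by (simp add: disc_arcs_def)
  have "disc_arcs H \<subseteq> disc_arcs F" using disc_mono[OF assms(1-3)] by (auto simp: disc_arcs_def)
  moreover have "e \<in> disc_arcs F"
    using assms(4) arc_in_disc_iff[OF assms(1)] jordanD(11)[OF assms(1)] by (auto simp: disc_arcs_def)
  moreover have "e \<notin> disc_arcs H" using arc_not_in_smaller_disc[OF assms] by (simp add: disc_arcs_def)
  ultimately show "disc_arcs H \<subset> disc_arcs F" by blast
qed

end

section \<open>Absence of directed cycles\<close>

text \<open>A larger connected set would meet the frontier of \<open>\<phi>\<close>.\<close>

lemma component_if_frontier_disjoint:
  fixes \<phi> A :: "complex set"
  assumes "\<phi> \<noteq> {}" "connected \<phi>" "\<phi> \<inter> A = {}" "frontier \<phi> \<subseteq> A"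
  shows "\<phi> \<in> components (- A)"
  unfolding in_components_maximal
proof (intro conjI allI impI)
  show "\<phi> \<subseteq> - A" using assms by auto
  fix d assume d: "d \<noteq> {} \<and> \<phi> \<subseteq> d \<and> d \<subseteq> - A \<and> connected d"
  show "d = \<phi>"
  proof (rule ccontr)
    assume "d \<noteq> \<phi>"
    then have "d - \<phi> \<noteq> {}" "d \<inter> \<phi> \<noteq> {}" using d assms(1) by auto
    then have "d \<inter> frontier \<phi> \<noteq> {}" using connected_Int_frontier d by blast
    then show False using d assms(4) by auto
  qed
qed (use assms in auto)

text \<open>
  A globular graph with source \<open>s\<close> and target \<open>t\<close>. The condition on the faces is void for a
  graph without arcs, so that the trivial globular graph is an instance.
\<close>

locale globular_digraph = plane_digraph G E for G :: "('v, 'e) pre_digraph" and E +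
  fixes s t :: 'v
  assumes s_vert: "s \<in> verts G" and t_vert: "t \<in> verts G"
    and from_s: "v \<in> verts G \<Longrightarrow> \<exists>p. awalk s p v"
    and to_t: "v \<in> verts G \<Longrightarrow> \<exists>p. awalk v p t"
    and s_ext: "pt s \<in> closure (outside supp)"
    and t_ext: "pt t \<in> closure (outside supp)"
    and faces_globular: "arcs G \<noteq> {} \<Longrightarrow> \<phi> \<in> faces E G \<Longrightarrow> globular_face E G \<phi>"
begin

lemma ext_not_inside:
  assumes "jordan F" "z \<in> closure (outside supp)"
  shows "z \<notin> inside (tr F)"
proof
  assume "z \<in> inside (tr F)"
  then have "inside (tr F) \<inter> outside supp \<noteq> {}"
    using open_Int_closure_eq_empty[OF jordanD(2)[OF assms(1)]] assms(2) by blast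
  moreover have "outside supp \<subseteq> outside (tr F)"
    by (rule outside_mono[OF trace_subset_supp[OF jordanD(11)[OF assms(1)]]])
  ultimately show False using inside_outside_disjoint by blast
qed

lemma arc_at_inside_vertex:
  assumes "jordan F" "e \<in> arcs G" "w = tail G e \<or> w = head G e" "pt w \<in> inside (tr F)"
  shows "e \<notin> F" "open_arc E e \<subseteq> inside (tr F)"
proof -
  have w: "pt w \<in> path_image (curve E e)" using curve_image[OF assms(2)] assms(3) by auto
  show eF: "e \<notin> F"
  proof
    assume "e \<in> F"
    then have "pt w \<in> tr F" using w by (auto simp: trace_def)
    then show False using assms(4) inside_no_overlap by blast
  qed
  have "pt w \<in> closure (open_arc E e)" using w curve_subset_closure[OF assms(2)] by blast
  then have "inside (tr F) \<inter> open_arc E e \<noteq> {}"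
    using open_Int_closure_eq_empty[OF jordanD(2)[OF assms(1)]] assms(4) by blast
  then show "open_arc E e \<subseteq> inside (tr F)"
    using arc_side[OF assms(1,2) eF] inside_outside_disjoint by blast
qed

lemma arc_at_inside_vertex_in_disc:
  assumes "jordan F" "e \<in> arcs G" "w = tail G e \<or> w = head G e" "pt w \<in> inside (tr F)"
  shows "path_image (curve E e) \<subseteq> disc F"
  using arc_in_disc_iff arc_at_inside_vertex assms by blast

lemma pt_ends_in_curve:
  "e \<in> arcs G \<Longrightarrow> pt (tail G e) \<in> path_image (curve E e)"
  "e \<in> arcs G \<Longrightarrow> pt (head G e) \<in> path_image (curve E e)"
  using curve_image by auto

text \<open>
  Go back along the walk from \<open>x\<close>. As long as the current vertex lies strictly inside the curve,
  the arc that enters it stays in the disc. As the walk does not start inside, it has to pass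
  through the curve.
\<close>

lemma disc_descent_walk:
  assumes "jordan F" "awalk a p x" "pt a \<notin> inside (tr F)" "pt x \<in> disc F"
  shows "\<exists>y r. y \<in> verts G \<and> pt y \<in> tr F \<and> awalk y r x \<and> tr (set r) \<subseteq> disc F"
  using assms(2,4)
proof (induction p arbitrary: x rule: rev_induct)
  case Nil
  then have "x = a" "x \<in> verts G" by (auto simp: awalk_Nil_iff)
  then show ?case using Nil assms(3) disc_eq[of F]
    by (intro exI[of _ x] exI[of _ "[]"]) (auto simp: awalk_Nil_iff)
next
  case (snoc e p)
  have e: "e \<in> arcs G" "head G e = x" and p: "awalk a p (tail G e)"
    using snoc.prems(1) by (auto simp: awalk_Cons_iff awalk_Nil_iff)
  show ?case
  proof (cases "pt x \<in> tr F")
    case True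
    then show ?thesis using e by (intro exI[of _ x] exI[of _ "[]"]) (auto simp: awalk_Nil_iff)
  next
    case False
    then have "pt x \<in> inside (tr F)" using snoc.prems(2) disc_eq[of F] by blast
    then have im: "path_image (curve E e) \<subseteq> disc F"
      using arc_at_inside_vertex_in_disc[OF assms(1) e(1)] e(2) by blast
    then have "pt (tail G e) \<in> disc F" using pt_ends_in_curve[OF e(1)] by blast
    from snoc.IH[OF p this] obtain y r
      where yr: "y \<in> verts G" "pt y \<in> tr F" "awalk y r (tail G e)" "tr (set r) \<subseteq> disc F" by blast
    have "awalk y (r @ [e]) x"
      by (rule awalk_appendI[OF yr(3)]) (use e in \<open>auto simp: awalk_Cons_iff awalk_Nil_iff\<close>)
    moreover have "tr (set (r @ [e])) \<subseteq> disc F" using yr(4) im by (simp add: trace_insert)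
    ultimately show ?thesis using yr by blast
  qed
qed

lemma disc_ascent_walk:
  assumes "jordan F" "awalk x p a" "pt a \<notin> inside (tr F)" "pt x \<in> disc F"
  shows "\<exists>y r. y \<in> verts G \<and> pt y \<in> tr F \<and> awalk x r y \<and> tr (set r) \<subseteq> disc F"
  using assms(2,4)
proof (induction p arbitrary: x)
  case Nil
  then have "x = a" "x \<in> verts G" by (auto simp: awalk_Nil_iff)
  then show ?case using Nil assms(3) disc_eq[of F]
    by (intro exI[of _ x] exI[of _ "[]"]) (auto simp: awalk_Nil_iff)
next
  case (Cons e p)
  have e: "e \<in> arcs G" "tail G e = x" and p: "awalk (head G e) p a"
    using Cons.prems(1) by (auto simp: awalk_Cons_iff)
  show ?case
  proof (cases "pt x \<in> tr F")
    case True
    then show ?thesis using e by (intro exI[of _ x] exI[of _ "[]"]) (auto simp: awalk_Nil_iff)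
  next
    case False
    then have "pt x \<in> inside (tr F)" using Cons.prems(2) disc_eq[of F] by blast
    then have im: "path_image (curve E e) \<subseteq> disc F"
      using arc_at_inside_vertex_in_disc[OF assms(1) e(1)] e(2) by blast
    then have "pt (head G e) \<in> disc F" using pt_ends_in_curve[OF e(1)] by blast
    from Cons.IH[OF p this] obtain y r
      where yr: "y \<in> verts G" "pt y \<in> tr F" "awalk (head G e) r y" "tr (set r) \<subseteq> disc F" by blast
    have "awalk x (e # r) y" using yr e by (auto simp: awalk_Cons_iff)
    moreover have "tr (set (e # r)) \<subseteq> disc F" using yr(4) im by (simp add: trace_insert)
    ultimately show ?thesis using yr by blast
  qed
qed

lemma disc_descent:
  assumes "jordan F" "x \<in> verts G" "pt x \<in> disc F"
  obtains y r where "y \<in> ends F" "awalk y r x" "tr (set r) \<subseteq> disc F"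
proof -
  obtain p where "awalk s p x" using from_s assms by blast
  then obtain y r where "y \<in> verts G" "pt y \<in> tr F" "awalk y r x" "tr (set r) \<subseteq> disc F"
    using disc_descent_walk[OF assms(1) _ ext_not_inside[OF assms(1) s_ext] assms(3)] by blast
  then show ?thesis using that[of y r] pt_in_trace[OF jordanD(11)[OF assms(1)], of y] by simp
qed

lemma disc_ascent:
  assumes "jordan F" "x \<in> verts G" "pt x \<in> disc F"
  obtains y r where "y \<in> ends F" "awalk x r y" "tr (set r) \<subseteq> disc F"
proof -
  obtain p where "awalk x p t" using to_t assms by blast
  then obtain y r where "y \<in> verts G" "pt y \<in> tr F" "awalk x r y" "tr (set r) \<subseteq> disc F"
    using disc_ascent_walk[OF assms(1) _ ext_not_inside[OF assms(1) t_ext] assms(3)] by blast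
  then show ?thesis using that[of y r] pt_in_trace[OF jordanD(11)[OF assms(1)], of y] by simp
qed

text \<open>
  A vertex inside the curve is reached from the curve by a walk in the disc, whose last arc then
  runs inside the curve.
\<close>

lemma empty_disc_face:
  assumes "jordan F" "\<And>g. g \<in> arcs G \<Longrightarrow> \<not> open_arc E g \<subseteq> inside (tr F)"
  shows "inside (tr F) \<inter> supp = {}" "inside (tr F) \<in> faces E G"
proof -
  show dis: "inside (tr F) \<inter> supp = {}"
  proof (rule ccontr)
    assume "inside (tr F) \<inter> supp \<noteq> {}"
    then obtain z where z: "z \<in> inside (tr F)" "z \<in> supp" by blast
    from z(2) show False
    proof (rule supp_cases)
      fix w assume w: "w \<in> verts G" "z = pt w"
      then have "pt w \<in> disc F" using z disc_eq[of F] by blast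
      then obtain y r where yr: "y \<in> ends F" "awalk y r w" "tr (set r) \<subseteq> disc F"
        using disc_descent[OF assms(1) w(1)] by blast
      have "pt y \<in> tr F" by (rule pt_ends_trace[OF jordanD(11)[OF assms(1)] yr(1)])
      then have "y \<noteq> w" using z w inside_no_overlap by blast
      then have "r \<noteq> []" using yr by (auto simp: awalk_Nil_iff)
      then obtain r' e where r: "r = r' @ [e]" by (metis rev_exhaust)
      then have e: "e \<in> arcs G" "head G e = w" using yr by (auto simp: awalk_Cons_iff awalk_Nil_iff)
      then show False using arc_at_inside_vertex[OF assms(1) e(1), of w] assms(2)[OF e(1)] z w by blast
    next
      fix e assume e: "e \<in> arcs G" "z \<in> open_arc E e"
      have "e \<notin> F"
        using open_arc_in_trace[OF jordanD(11)[OF assms(1)] e] z inside_no_overlap by blast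
      then show False using arc_side[OF assms(1) e(1)] assms(2)[OF e(1)] e z
          inside_outside_disjoint by blast
    qed
  qed
  show "inside (tr F) \<in> faces E G"
    unfolding faces_def
    by (rule component_if_frontier_disjoint)
      (use dis jordanD(1,3,9)[OF assms(1)] trace_subset_supp[OF jordanD(11)[OF assms(1)]] in auto)
qed

lemma outside_supp_ne: "outside supp \<noteq> {}"
  using outside_bounded_nonempty[OF compact_imp_bounded[OF compact_supp]] .

lemma unique_walk_if_inj_tail:
  assumes "inj_on (tail G) F" "set p \<subseteq> F" "set q \<subseteq> F" "apath u p v" "apath u q v"
  shows "p = q"
  using assms(2-)
proof (induction p arbitrary: u q)
  case Nil
  then have "u = v" by (simp add: apath_Nil_iff)
  then show ?case using Nil apath_nonempty_ends[of u q v] by metis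
next
  case (Cons e p)
  have "u \<noteq> v" using apath_nonempty_ends[OF Cons.prems(3)] by simp
  then obtain e' q' where q: "q = e' # q'"
    using Cons.prems(4) by (cases q) (auto simp: apath_Nil_iff)
  have "e \<in> F" "e' \<in> F" using Cons.prems q by auto
  moreover have "tail G e = tail G e'" using Cons.prems q by (auto simp: apath_Cons_iff)
  ultimately have "e = e'" using assms(1) by (simp add: inj_on_def)
  moreover have "p = q'" using Cons.IH[of q' "head G e"] Cons.prems q \<open>e = e'\<close> by (auto simp: apath_Cons_iff)
  ultimately show ?case using q by simp
qed

text \<open>
  Take a directed cycle with the least number of arcs in its disc. If some arc runs inside the
  cycle, continue it backwards and forwards until it hits the cycle, which is possible because
  every vertex is reached from \<open>s\<close> and reaches \<open>t\<close>, neither of which lies inside. Closing up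
  along the cycle yields a directed cycle with a smaller disc. If there is no such arc, then the
  inside is a face, whose boundary consists of two directed paths in the cycle with common ends.
  These are equal, so that the winding numbers of the boundary vanish and do not jump at the
  face.
\<close>

lemma no_cycle:
  assumes "f \<in> arcs G" "apath (head G f) r (tail G f)"
  shows False
  using assms
proof (induction "card (disc_arcs (insert f (set r)))" arbitrary: f r rule: less_induct)
  case less
  define F where "F = insert f (set r)"
  have J: "jordan F" unfolding F_def by (rule cycle_jordan[OF less.prems])
  note FG = jordanD(11)[OF J]
  have aw: "awalk (head G f) r (tail G f)" using less.prems by (simp add: apath_def)
  have endsF: "ends F \<subseteq> set (awalk_verts (head G f) r)"
    using ends_subset_awalk_verts[OF aw] hd_in_awalk_verts(1)[OF aw] awlast_of_awalk[OF aw]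
      last_in_set[of "awalk_verts (head G f) r"] unfolding F_def by auto
  show False
  proof (cases "\<exists>g\<in>arcs G. open_arc E g \<subseteq> inside (tr F)")
    case True
    then obtain g where g: "g \<in> arcs G" "open_arc E g \<subseteq> inside (tr F)" by blast
    have gF: "g \<notin> F"
    proof
      assume "g \<in> F"
      then have "open_arc E g \<subseteq> tr F" using open_arc_in_trace[OF FG g(1)] by blast
      then have "open_arc E g \<subseteq> inside (tr F) \<inter> tr F" using g(2) by (rule_tac Int_greatest)
      then show False using open_arc_ne[of g] inside_no_overlap[of "tr F"] by simp
    qed
    have gd: "path_image (curve E g) \<subseteq> disc F" using arc_in_disc_iff[OF J g(1)] g by blast
    have "pt (tail G g) \<in> disc F" "pt (head G g) \<in> disc F"
      using gd pt_ends_in_curve[OF g(1)] by blast+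
    note gdd = this
    obtain y1 r1 where y1: "y1 \<in> ends F" "awalk y1 r1 (tail G g)" "tr (set r1) \<subseteq> disc F"
      by (rule disc_descent[OF J tail_in_verts[OF g(1)] gdd(1)])
    obtain y2 r2 where y2: "y2 \<in> ends F" "awalk (head G g) r2 y2" "tr (set r2) \<subseteq> disc F"
      by (rule disc_ascent[OF J head_in_verts[OF g(1)] gdd(2)])
    have "y1 \<in> set (awalk_verts (head G f) r)" "y2 \<in> set (awalk_verts (head G f) r)"
      using y1 y2 endsF by blast+
    then obtain ra rb rc rd where r: "r = ra @ rb" "awalk (head G f) ra y1" "r = rc @ rd" "awalk y2 rd (tail G f)"
      using awalk_decomp[OF aw] by metis
    \<comment> \<open>from the head of \<open>g\<close> to the cycle, along the cycle through \<open>f\<close>, and back to the tail of \<open>g\<close>\<close>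
    define w where "w = r2 @ rd @ [f] @ ra @ r1"
    have "awalk (tail G f) [f] (head G f)" using less.prems(1) by (simp add: arc_implies_awalk)
    then have w: "awalk (head G g) w (tail G g)"
      unfolding w_def using y1 y2 r by (meson awalk_appendI)
    define h where "h = awalk_to_apath w"
    have h: "apath (head G g) h (tail G g)" unfolding h_def by (rule apath_awalk_to_apath[OF w])
    have hw: "set h \<subseteq> set w" unfolding h_def by (rule awalk_to_apath_subset[OF w])
    define H where "H = insert g (set h)"
    have JH: "jordan H" unfolding H_def by (rule cycle_jordan[OF g(1) h])
    have "set rd \<subseteq> set r" "set ra \<subseteq> set r" using arg_cong[OF r(1), of set] arg_cong[OF r(3), of set] by auto
    then have rF: "set rd \<subseteq> F" "f \<in> F" "set ra \<subseteq> F" unfolding F_def by auto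
    have trF: "tr F \<subseteq> disc F" using disc_eq[of F] by blast
    have "tr (set w) \<subseteq> disc F"
    proof -
      have "tr (set w) = tr (set r2) \<union> tr (set rd) \<union> tr {f} \<union> tr (set ra) \<union> tr (set r1)"
        unfolding w_def by (auto simp: trace_def)
      moreover have "tr A \<subseteq> disc F" if "A \<subseteq> F" for A by (rule order_trans[OF trace_mono[OF that] trF])
      ultimately show ?thesis using y1(3) y2(3) rF by simp
    qed
    then have trH: "tr H \<subseteq> disc F" unfolding H_def trace_insert using gd trace_mono[OF hw] by blast
    have "\<not> F \<subseteq> H"
    proof
      assume "F \<subseteq> H"
      then have "outside (tr H) \<subseteq> outside (tr F)" by (intro outside_mono trace_mono)
      then have "outside (tr H) = outside (tr F)" by (rule antisym[OF _ disc_mono[OF J JH trH]])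
      then have eq: "tr H = tr F" using jordanD(10)[OF J] jordanD(10)[OF JH] by simp
      have "open_arc E g \<subseteq> tr H"
        using open_arc_in_trace[OF jordanD(11)[OF JH] g(1)] unfolding H_def by blast
      then have "open_arc E g \<subseteq> inside (tr F) \<inter> tr F" unfolding eq using g(2) by (rule_tac Int_greatest)
      then show False using open_arc_ne[of g] inside_no_overlap[of "tr F"] by simp
    qed
    then obtain e where e: "e \<in> F" "e \<notin> H" by blast
    have "card (disc_arcs H) < card (disc_arcs F)" by (rule card_disc_arcs_less[OF J JH trH e])
    then show False using less.hyps[of g h] g(1) h unfolding F_def H_def by blast
  next
    case False
    have face: "inside (tr F) \<in> faces E G" and dis: "inside (tr F) \<inter> supp = {}"
      using empty_disc_face[OF J] False by blast+
    have "arcs G \<noteq> {}" using less.prems by blast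
    then obtain p q u v where pq: "p \<noteq> []" "q \<noteq> []" "apath u p v" "apath u q v"
      and pim: "path_image (loop_of p q) = frontier (inside (tr F))"
      and wn: "\<And>z w. z \<in> inside (tr F) \<Longrightarrow> w \<in> - (supp \<union> inside (tr F)) \<Longrightarrow>
        winding_number (loop_of p q) z = winding_number (loop_of p q) w - 1"
      using faces_globular[OF _ face] unfolding globular_face_def clockwise_boundary_def Let_def by metis
    have ap: "awalk u p v" "awalk u q v" using pq by (auto simp: apath_def)
    have tr: "tr (set p \<union> set q) = tr F"
      using pim loop_props(3)[OF ap pq(1,2)] jordanD(9)[OF J] by simp
    have sub: "set p \<union> set q \<subseteq> F"
    proof
      fix e assume e: "e \<in> set p \<union> set q"
      then have eG: "e \<in> arcs G" using ap by blast
      obtain z where z: "z \<in> open_arc E e" using open_arc_ne[of e] by blast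
      then have "z \<in> tr (set p \<union> set q)" using e open_arc_subset_curve[OF eG] by (auto simp: trace_def)
      then show "e \<in> F" using open_arc_in_trace[OF FG eG z] tr by simp
    qed
    have "inj_on (tail G) F"
    proof (cases "r = []")
      case True then show ?thesis by (simp add: F_def)
    next
      case False
      then have "awalk_verts (head G f) r = map (tail G) r @ [tail G f]"
        using awalk_verts_conv[of "head G f" r] awlast_of_awalk[OF aw] by simp
      then have "distinct (map (tail G) r @ [tail G f])" using less.prems(2) by (simp add: apath_def)
      then show ?thesis unfolding F_def by (auto simp: distinct_map)
    qed
    then have "p = q" by (rule unique_walk_if_inj_tail[OF _ _ _ pq(3,4)]) (use sub in auto)
    obtain z where z: "z \<in> inside (tr F)" using jordanD(1)[OF J] by blast
    obtain w where w: "w \<in> outside supp" using outside_supp_ne by blast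
    have "outside supp \<subseteq> outside (tr F)" by (rule outside_mono[OF trace_subset_supp[OF FG]])
    then have wF: "w \<in> outside (tr F)" using w by (rule subsetD)
    have "w \<notin> supp" using w outside_no_overlap[of supp] by (metis IntI empty_iff)
    moreover have "w \<notin> inside (tr F)" using wF inside_outside_disjoint[of "tr F"] by (metis IntI empty_iff)
    moreover have "w \<notin> tr (set p \<union> set q)" using wF outside_no_overlap[of "tr F"] tr by (metis IntI empty_iff)
    ultimately have w': "w \<in> - (supp \<union> inside (tr F))" "w \<notin> tr (set p \<union> set q)" by simp_all
    have "z \<notin> tr (set p \<union> set q)" using z tr inside_no_overlap[of "tr F"] by (metis IntI empty_iff)
    then have "winding_number (loop_of p q) z = 0" "winding_number (loop_of p q) w = 0"
      using winding_loop[OF ap pq(1,2)] w'(2) \<open>p = q\<close> by auto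
    then show False using wn[OF z w'(1)] by simp
  qed
qed

lemma acyclic_walk: "awalk u p u \<Longrightarrow> p = []"
proof (rule ccontr)
  assume p: "awalk u p u" "p \<noteq> []"
  then obtain f r where fr: "p = f # r" by (cases p) auto
  then have "f \<in> arcs G" "awalk (head G f) r (tail G f)" using p by (auto simp: awalk_Cons_iff)
  then show False using no_cycle apath_awalk_to_apath by blast
qed

lemma awalk_apath: "awalk u p v \<Longrightarrow> apath u p v"
proof (rule ccontr)
  assume p: "awalk u p v" "\<not> apath u p v"
  then have "\<not> distinct (awalk_verts u p)" by (simp add: apath_def)
  then obtain r w where "0 < length r" "awalk w r w"
    using awalk_not_distinct_decomp[OF p(1)] by blast
  then show False using acyclic_walk by blast
qed

lemma awalk_antisym: "awalk u p v \<Longrightarrow> awalk v q u \<Longrightarrow> u = v"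
proof -
  assume "awalk u p v" "awalk v q u"
  then have "awalk u (p @ q) u" by (rule awalk_appendI)
  then have "p = []" using acyclic_walk by blast
  then show "u = v" using \<open>awalk u p v\<close> by (simp add: awalk_Nil_iff)
qed

lemma no_loop: "e \<in> arcs G \<Longrightarrow> tail G e \<noteq> head G e"
  using acyclic_walk[of "head G e" "[e]"] by (metis arc_implies_awalk not_Cons_self2)

lemma awalk_distinct: "awalk u p v \<Longrightarrow> distinct p"
  using awalk_apath[of u p v] distinct_verts_imp_distinct[of u p v] unfolding apath_def by blast

lemma arc_curve: "e \<in> arcs G \<Longrightarrow> Path_Connected.arc (curve E e)"
  by (rule curve_arc[OF _ no_loop])

lemma awalk_Nil_both: "awalk u p v \<Longrightarrow> awalk u q v \<Longrightarrow> p = [] \<longleftrightarrow> q = []"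
  using acyclic_walk[of u p] acyclic_walk[of u q] by (metis awalk_Nil_iff)

lemma interior_trace: "F \<subseteq> arcs G \<Longrightarrow> interior (tr F) = {}"
proof -
  assume F: "F \<subseteq> arcs G"
  then have "finite F" using finite_subset finite_arcs by blast
  then show ?thesis using F
  proof (induction F)
    case (insert e F)
    have "interior (path_image (curve E e) \<union> tr F) = interior (path_image (curve E e))"
      by (rule interior_closed_Un_empty_interior)
        (use insert.prems insert.IH in \<open>simp_all add: curve_simple closed_simple_path_image\<close>)
    then show ?case using interior_arc_image[OF arc_curve[of e]] insert.prems by (simp add: trace_insert)
  qed simp
qed

lemma interior_supp: "interior supp = {}"
proof -
  have "interior (tr (arcs G) \<union> pt ` verts G) = interior (tr (arcs G))"
  proof (rule interior_closed_Un_empty_interior)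
    show "closed (tr (arcs G))" by (rule compact_imp_closed[OF compact_trace[OF order_refl]])
    show "interior (pt ` verts G) = {}" by (rule empty_interior_finite) simp
  qed
  then show ?thesis using interior_trace[OF order_refl] unfolding supp_eq by (simp add: Un_commute)
qed

text \<open>The graph has empty interior, so winding numbers only need to be compared off the graph.\<close>

lemma off_supp_dense:
  assumes "open U" "U \<noteq> {}"
  obtains z where "z \<in> U" "z \<notin> supp"
proof -
  have "\<not> U \<subseteq> supp" using interior_maximal[of U supp] assms interior_supp by blast
  then show ?thesis using that by blast
qed

end

section \<open>Discs bounded by two paths\<close>

lemma not_in_if_outside: "z \<in> outside S \<Longrightarrow> z \<notin> S"
  and not_in_if_inside: "z \<in> inside S \<Longrightarrow> z \<notin> S"
  and not_inside_if_outside: "z \<in> outside S \<Longrightarrow> z \<notin> inside S"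
  by (auto simp: inside_def outside_def)

lemma (in pre_digraph) cas_snoc: "cas v (q @ [e]) u \<longleftrightarrow> cas v q (tail G e) \<and> head G e = u"
  by (induction q arbitrary: v) auto

lemma opposite_sel:
  "tail (opposite H) = head H" "head (opposite H) = tail H"
  "verts (opposite H) = verts H" "arcs (opposite H) = arcs H"
  by (simp_all add: opposite_def)

lemma opposite_cas:
  "pre_digraph.cas (opposite H) u p v = pre_digraph.cas H v (rev p) u"
proof (induction p arbitrary: u)
  case Nil
  show ?case unfolding rev.simps pre_digraph.cas.simps by auto
next
  case (Cons e p)
  show ?case
    unfolding rev.simps pre_digraph.cas.simps pre_digraph.cas_snoc opposite_sel Cons by auto
qed

lemma opposite_awalk_verts:
  assumes "pre_digraph.cas (opposite H) u p v"
  shows "pre_digraph.awalk_verts (opposite H) u p = rev (pre_digraph.awalk_verts H v (rev p))"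
proof (cases "p = []")
  case True
  interpret H: pre_digraph H .
  interpret O: pre_digraph "opposite H" .
  show ?thesis using assms True by simp
next
  case False
  then show ?thesis
    using pre_digraph.awalk_verts_conv'[OF assms] pre_digraph.awalk_verts_conv[of H v "rev p"]
    by (simp add: opposite_def rev_map last_rev)
qed

lemma opposite_apath:
  assumes "wf_digraph H"
  shows "pre_digraph.apath (opposite H) u p v \<longleftrightarrow> pre_digraph.apath H v (rev p) u"
proof -
  interpret H: wf_digraph H by (rule assms)
  have "wf_digraph (opposite H)" unfolding opposite_def by unfold_locales auto
  then interpret O: wf_digraph "opposite H" .
  have a: "arcs (opposite H) = arcs H" "verts (opposite H) = verts H" by (auto simp: opposite_def)
  have "O.apath u p v \<longleftrightarrow> O.awalk u p v \<and> distinct (O.awalk_verts u p)" by (simp only: O.apath_def)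
  also have "\<dots> \<longleftrightarrow> H.awalk v (rev p) u \<and> distinct (H.awalk_verts v (rev p))"
  proof -
    have "O.awalk u p v \<longleftrightarrow> H.awalk v (rev p) u"
    proof
      assume "O.awalk u p v"
      then show "H.awalk v (rev p) u"
        using O.awalk_last_in_verts[of u p v] opposite_cas[of H u p v] a
        unfolding O.awalk_def H.awalk_def by auto
    next
      assume "H.awalk v (rev p) u"
      then show "O.awalk u p v"
        using H.awalk_last_in_verts[of v "rev p" u] opposite_cas[of H u p v] a
        unfolding O.awalk_def H.awalk_def by auto
    qed
    moreover have "O.awalk u p v \<Longrightarrow> O.awalk_verts u p = rev (H.awalk_verts v (rev p))"
      by (rule opposite_awalk_verts) (simp add: O.awalk_def)
    ultimately show ?thesis by auto
  qed
  finally show ?thesis by (simp add: H.apath_def)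
qed

context globular_digraph
begin

lemma sub_tail_head:
  assumes "subgraph H G" shows "tail H = tail G" "head H = head G"
    "verts H \<subseteq> verts G" "arcs H \<subseteq> arcs G" "wf_digraph H"
  using assms by (auto simp: subgraph_def compatible_def)

lemma sub_awalk_verts: "subgraph H G \<Longrightarrow> pre_digraph.awalk_verts H = awalk_verts"
  and sub_cas: "subgraph H G \<Longrightarrow> pre_digraph.cas H = cas"
  using compatible_awalk_verts[of G H] compatible_cas[of G H]
  unfolding subgraph_def by (metis, metis)

lemma sub_apath:
  assumes "subgraph H G"
  shows "pre_digraph.apath H u p v \<longleftrightarrow> u \<in> verts H \<and> set p \<subseteq> arcs H \<and> awalk u p v"
proof -
  have "pre_digraph.apath H u p v \<longleftrightarrow>
      (u \<in> verts H \<and> set p \<subseteq> arcs H \<and> cas u p v) \<and> distinct (awalk_verts u p)"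
    unfolding pre_digraph.apath_def pre_digraph.awalk_def sub_cas[OF assms] sub_awalk_verts[OF assms] ..
  also have "\<dots> \<longleftrightarrow> u \<in> verts H \<and> set p \<subseteq> arcs H \<and> awalk u p v"
    using awalk_apath[of u p v] sub_tail_head(3,4)[OF assms] unfolding awalk_def apath_def by blast
  finally show ?thesis .
qed

lemma sub_wf_finite: "subgraph H G \<Longrightarrow> fin_digraph H"
proof -
  assume H: "subgraph H G"
  have "finite (verts H)" "finite (arcs H)"
    by (rule finite_subset[OF sub_tail_head(3)[OF H] finite_verts])
      (rule finite_subset[OF sub_tail_head(4)[OF H] finite_arcs])
  then show "fin_digraph H" unfolding fin_digraph_def fin_digraph_axioms_def
    using sub_tail_head(5)[OF H] by simp
qed

lemma sub_plane: "subgraph H G \<Longrightarrow> plane_graph E H"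
proof -
  assume H: "subgraph H G"
  note S = sub_tail_head[OF H]
  have "inj_on pt (verts G)" using plane unfolding plane_graph_def by simp
  then have 1: "inj_on pt (verts H)" by (rule inj_on_subset[OF _ S(3)])
  have 2: "simple_path (curve E e) \<and> pathstart (curve E e) = pt (tail H e) \<and>
      pathfinish (curve E e) = pt (head H e) \<and> curve E e ` {0<..<1} \<inter> pt ` verts H = {}"
    if "e \<in> arcs H" for e
  proof -
    have "e \<in> arcs G" using that S(4) by blast
    then have "simple_path (curve E e) \<and> pathstart (curve E e) = pt (tail G e) \<and>
      pathfinish (curve E e) = pt (head G e) \<and> curve E e ` {0<..<1} \<inter> pt ` verts G = {}"
      using plane unfolding plane_graph_def by simp
    then show ?thesis using S(3) unfolding S(1,2) by blast
  qed
  have 3: "curve E e ` {0<..<1} \<inter> curve E f ` {0<..<1} = {}"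
    if "e \<in> arcs H" "f \<in> arcs H" "e \<noteq> f" for e f
    using open_arc_disjoint[of e f] that S(4) unfolding open_arc_def by auto
  show ?thesis unfolding plane_graph_def using sub_wf_finite[OF H] 1 2 3 by simp
qed

lemma sub_is_source:
  assumes "subgraph H G"
  shows "is_source H a \<longleftrightarrow> a \<in> verts H \<and> (\<forall>v\<in>verts H. \<exists>p. set p \<subseteq> arcs H \<and> awalk a p v)"
  unfolding is_source_def sub_apath[OF assms] by blast

lemma sub_is_target:
  assumes "subgraph H G"
  shows "is_target H a \<longleftrightarrow> a \<in> verts H \<and> (\<forall>v\<in>verts H. \<exists>p. set p \<subseteq> arcs H \<and> awalk v p a)"
proof -
  have "is_target H a \<longleftrightarrow> a \<in> verts H \<and> (\<forall>v\<in>verts H. \<exists>p. pre_digraph.apath (opposite H) a p v)"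
    unfolding is_target_def is_source_def by (simp add: opposite_def)
  also have "\<dots> \<longleftrightarrow> a \<in> verts H \<and> (\<forall>v\<in>verts H. \<exists>p. pre_digraph.apath H v (rev p) a)"
    unfolding opposite_apath[OF sub_tail_head(5)[OF assms]] ..
  also have "\<dots> \<longleftrightarrow> a \<in> verts H \<and> (\<forall>v\<in>verts H. \<exists>p. pre_digraph.apath H v p a)"
    by (metis rev_rev_ident)
  finally show ?thesis unfolding sub_apath[OF assms] by blast
qed

text \<open>Two sources reach each other, so they coincide in the absence of directed cycles.\<close>

lemma sub_source_of:
  assumes "subgraph H G" "is_source H a"
  shows "source_of H = a" "\<exists>!b. is_source H b"
proof -
  have un: "b = a" if "is_source H b" for b
    using that assms(2) awalk_antisym unfolding sub_is_source[OF assms(1)] by metis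
  then show "source_of H = a" unfolding source_of_def using assms(2) by (metis the_equality)
  show "\<exists>!b. is_source H b" using un assms(2) by blast
qed

lemma sub_target_of:
  assumes "subgraph H G" "is_target H a"
  shows "target_of H = a" "\<exists>!b. is_target H b"
proof -
  have un: "b = a" if "is_target H b" for b
    using that assms(2) awalk_antisym unfolding sub_is_target[OF assms(1)] by metis
  then show "target_of H = a" unfolding target_of_def using assms(2) by (metis the_equality)
  show "\<exists>!b. is_target H b" using un assms(2) by blast
qed

lemma supp_sub:
  assumes "subgraph H G"
  shows "support E H = pt ` verts H \<union> tr (arcs H)" "support E H \<subseteq> supp"
  using sub_tail_head[OF assms] by (auto simp: support_def trace_def)

lemma path_graph_sub:
  assumes "awalk u p v"
  shows "subgraph (path_graph G u p) G"
proof -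
  have w: "ends (set p) \<subseteq> set (awalk_verts u p)" by (rule ends_subset_awalk_verts[OF assms])
  have "wf_digraph (path_graph G u p)"
    by unfold_locales (use w in \<open>auto simp: path_graph_def\<close>)
  moreover have "wf_digraph G" by unfold_locales
  ultimately show ?thesis using assms
    unfolding subgraph_def by (auto simp: path_graph_def compatible_def)
qed

lemma union_sub:
  assumes "subgraph H G" "subgraph K G"
  shows "subgraph (Digraph_Component.union H K) G"
proof -
  interpret H: wf_digraph H by (rule sub_tail_head(5)[OF assms(1)])
  interpret K: wf_digraph K by (rule sub_tail_head(5)[OF assms(2)])
  have "wf_digraph (Digraph_Component.union H K)"
    by unfold_locales
      (use sub_tail_head[OF assms(1)] sub_tail_head[OF assms(2)] H.wellformed K.wellformed
        in \<open>auto simp: Digraph_Component.union_def\<close>)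
  then show ?thesis using assms unfolding subgraph_def
    by (auto simp: Digraph_Component.union_def compatible_def)
qed

abbreviation path_union :: "'v \<Rightarrow> 'e list \<Rightarrow> 'e list \<Rightarrow> ('v, 'e) pre_digraph" where
  "path_union u p q \<equiv> Digraph_Component.union (path_graph G u p) (path_graph G u q)"

lemma path_union_sel:
  "verts (path_union u p q) = set (awalk_verts u p) \<union> set (awalk_verts u q)"
  "arcs (path_union u p q) = set p \<union> set q"
  "tail (path_union u p q) = tail G" "head (path_union u p q) = head G"
  by (auto simp: Digraph_Component.union_def path_graph_def)

lemma path_union_sub: "awalk u p v \<Longrightarrow> awalk u q v \<Longrightarrow> subgraph (path_union u p q) G"
  using union_sub path_graph_sub by blast

lemma awalk_split_vertex:
  assumes "awalk u p v" "w \<in> set (awalk_verts u p)"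
  obtains q r where "p = q @ r" "awalk u q w" "awalk w r v"
  using awalk_decomp[OF assms] by blast

lemma path_union_source_target:
  assumes "awalk u p v" "awalk u q v"
  shows "is_source (path_union u p q) u" "is_target (path_union u p q) v"
proof -
  note S = path_union_sub[OF assms]
  have u: "u \<in> set (awalk_verts u p)" "v \<in> set (awalk_verts u p)"
    using hd_in_awalk_verts(1)[OF assms(1)] awlast_of_awalk[OF assms(1)]
    by (auto intro: last_in_set)
  have split: "\<exists>a. set a \<subseteq> set p \<union> set q \<and> awalk u a w"
    "\<exists>a. set a \<subseteq> set p \<union> set q \<and> awalk w a v"
    if w: "w \<in> set (awalk_verts u p) \<union> set (awalk_verts u q)" for w
  proof -
    obtain r a b where r: "r = p \<or> r = q" "r = a @ b" "awalk u a w" "awalk w b v"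
      using w awalk_split_vertex[OF assms(1)] awalk_split_vertex[OF assms(2)] by (metis Un_iff)
    then have "set a \<subseteq> set p \<union> set q" "set b \<subseteq> set p \<union> set q" by auto
    then show "\<exists>a. set a \<subseteq> set p \<union> set q \<and> awalk u a w"
      "\<exists>a. set a \<subseteq> set p \<union> set q \<and> awalk w a v" using r by blast+
  qed
  show "is_source (path_union u p q) u" "is_target (path_union u p q) v"
    unfolding sub_is_source[OF S] sub_is_target[OF S] path_union_sel using split u by blast+
qed

lemma path_union_source_of:
  assumes "awalk u p v" "awalk u q v"
  shows "source_of (path_union u p q) = u" "target_of (path_union u p q) = v"
  using sub_source_of sub_target_of path_union_sub[OF assms] path_union_source_target[OF assms]
  by blast+

lemma supp_path_union:
  assumes "awalk u p v" "awalk u q v" "p \<noteq> []" "q \<noteq> []"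
  shows "support E (path_union u p q) = tr (set p \<union> set q)"
proof -
  have sub: "set p \<union> set q \<subseteq> arcs G" using assms by blast
  have "set (awalk_verts u p) \<union> set (awalk_verts u q) = ends (set p \<union> set q)"
    using set_awalk_verts_not_Nil[OF assms(1,3)] set_awalk_verts_not_Nil[OF assms(2,4)] by auto
  then have "pt ` (set (awalk_verts u p) \<union> set (awalk_verts u q)) \<subseteq> tr (set p \<union> set q)"
    using pt_ends_trace[OF sub] by (metis image_subsetI)
  then show ?thesis
    unfolding supp_sub(1)[OF path_union_sub[OF assms(1,2)]] path_union_sel by blast
qed

text \<open>
  The common core of \<open>lens_cycle_globular\<close> and \<open>lens_disc_globular\<close>. As \<open>H\<close> lies in the disc and
  contains its boundary, the only face of \<open>H\<close> that is not inside the curve is the outside of the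
  curve, and its boundary is formed by \<open>c\<close> and \<open>d\<close>.
\<close>

lemma region_globular:
  assumes lens: "lens u c d v" and F: "F = set c \<union> set d"
    and H: "subgraph H G" "F \<subseteq> arcs H" "arcs H \<subseteq> disc_arcs F"
    and u: "u \<in> verts H" "v \<in> verts H"
    and V: "\<And>w. w \<in> verts H \<Longrightarrow> pt w \<in> disc F"
    and reach: "\<And>w. w \<in> verts H \<Longrightarrow> \<exists>p. set p \<subseteq> arcs H \<and> awalk u p w"
      "\<And>w. w \<in> verts H \<Longrightarrow> \<exists>p. set p \<subseteq> arcs H \<and> awalk w p v"
    and sign: "\<And>z. z \<in> inside (tr F) \<Longrightarrow> wdiff c d z = -1"
    and inner: "\<And>\<phi>. \<phi> \<in> faces E H \<Longrightarrow> \<phi> \<subseteq> inside (tr F) \<Longrightarrow> globular_face E H \<phi>"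
  shows "globular E H" "source_of H = u" "target_of H = v" "dom_cod E H c d"
    "exterior_face E H = outside (tr F)"
proof -
  have J: "jordan F" unfolding F by (rule lens_jordan[OF lens])
  note JD = jordanD[OF J]
  note A = lens_awalk[OF lens] and N = lens_ne[OF lens]
  have src: "is_source H u" "is_target H v"
    unfolding sub_is_source[OF H(1)] sub_is_target[OF H(1)] using u reach by blast+
  then show st: "source_of H = u" "target_of H = v"
    using sub_source_of[OF H(1)] sub_target_of[OF H(1)] by blast+
  have suppH: "support E H \<subseteq> disc F"
    unfolding supp_sub(1)[OF H(1)] using V H(3) by (auto simp: disc_arcs_def trace_def)
  have trH: "tr F \<subseteq> support E H" unfolding supp_sub(1)[OF H(1)] using trace_mono[OF H(2)] by blast
  show ext: "exterior_face E H = outside (tr F)"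
    unfolding exterior_face_def
  proof (rule antisym)
    show "outside (support E H) \<subseteq> outside (tr F)" by (rule outside_mono[OF trH])
    show "outside (tr F) \<subseteq> outside (support E H)"
      using connected_unbounded_subset_outside[OF JD(6) _ JD(8)] suppH by blast
  qed
  have ext_disj: "outside (tr F) \<inter> support E H = {}" using suppH by blast
  have ext_face: "outside (tr F) \<in> faces E H"
    unfolding faces_def by (rule component_if_frontier_disjoint) (use JD ext_disj trH in auto)
  have face_cases: "\<phi> = outside (tr F) \<or> \<phi> \<subseteq> inside (tr F)" if phi: "\<phi> \<in> faces E H" for \<phi>
  proof (cases "\<phi> \<inter> outside (tr F) = {}")
    case True
    have "\<phi> \<inter> tr F = {}" using in_components_subset[OF phi[unfolded faces_def]] trH by blast
    then show ?thesis using True inside_Un_outside[of "tr F"] by blast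
  next
    case False
    then show ?thesis using components_nonoverlap[OF phi[unfolded faces_def] ext_face[unfolded faces_def]] by blast
  qed
  have uF: "pt u \<in> tr F" "pt v \<in> tr F"
    using walk_curve_props[OF A(1) N(1)] pathstart_in_path_image[of "walk_curve E c"]
      pathfinish_in_path_image[of "walk_curve E c"] unfolding F trace_Un by auto
  have apH: "pre_digraph.apath H u c v" "pre_digraph.apath H u d v"
    unfolding sub_apath[OF H(1)] using A u H(2) F by auto
  have cb: "clockwise_boundary E H (outside (tr F)) d c"
  proof -
    have im: "path_image (loop_of d c) = tr F"
      using loop_props(3)[OF A(2,1) N(2,1)] F by (simp add: Un_commute)
    have "winding_number (loop_of d c) z = winding_number (loop_of d c) w - 1"
      if z: "z \<in> outside (tr F)" and w: "w \<in> - (support E H \<union> outside (tr F))" for z w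
    proof -
      have wi: "w \<in> inside (tr F)" using w trH inside_Un_outside[of "tr F"] by blast
      have zo: "z \<notin> tr (set d \<union> set c)" "w \<notin> tr (set d \<union> set c)"
        using not_in_if_outside[OF z] not_in_if_inside[OF wi] F by (simp_all add: Un_commute)
      have "wdiff d c z = 0" using wdiff_outside[OF A(2,1)] N z F by (simp add: Un_commute)
      moreover have "wdiff d c w = 1" using sign[OF wi] wdiff_sym[of d c w] by simp
      ultimately show ?thesis
        using winding_loop[OF A(2,1) N(2,1) zo(1)] winding_loop[OF A(2,1) N(2,1) zo(2)] by simp
    qed
    then show ?thesis
      unfolding clockwise_boundary_def Let_def using N apH im JD(10) by auto
  qed
  then show "dom_cod E H c d"
    unfolding dom_cod_def face_dom_cod_def using ext ext_face by simp
  have "globular_face E H \<phi>" if "\<phi> \<in> faces E H" for \<phi>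
    using face_cases[OF that] inner[OF that] cb that by (auto simp: globular_face_def)
  moreover have "st_graph E H"
    unfolding st_graph_def vertex_incident_def st ext
    using sub_plane[OF H(1)] sub_source_of[OF H(1) src(1)] sub_target_of[OF H(1) src(2)] u ext_face uF JD(10)
    by auto
  ultimately show "globular E H" unfolding globular_def using sub_plane[OF H(1)] by blast
qed

lemma ends_lens:
  assumes "lens u c d v"
  shows "set (awalk_verts u c) \<union> set (awalk_verts u d) = ends (set c \<union> set d)"
  using set_awalk_verts_not_Nil[OF lens_awalk(1)[OF assms] lens_ne(1)[OF assms]]
    set_awalk_verts_not_Nil[OF lens_awalk(2)[OF assms] lens_ne(2)[OF assms]] by auto

text \<open>
  The inside of the curve is the only other face, with the same boundary as the exterior face.
\<close>

lemma lens_cycle_globular: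
  assumes lens: "lens u c d v" and F: "F = set c \<union> set d"
    and H: "subgraph H G" "verts H = ends F" "arcs H = F"
    and sign: "\<And>z. z \<in> inside (tr F) \<Longrightarrow> wdiff c d z = -1"
  shows "globular E H" "source_of H = u" "target_of H = v" "dom_cod E H c d"
    "exterior_face E H = outside (tr F)"
proof -
  have J: "jordan F" unfolding F by (rule lens_jordan[OF lens])
  note JD = jordanD[OF J]
  note A = lens_awalk[OF lens] and N = lens_ne[OF lens]
  have vH: "verts H = verts (path_union u c d)" unfolding path_union_sel ends_lens[OF lens] H F ..
  have aH: "arcs H = arcs (path_union u c d)" unfolding path_union_sel H F ..
  have src: "is_source H u" "is_target H v"
    using path_union_source_target[OF A] unfolding sub_is_source[OF H(1)] sub_is_target[OF H(1)]
      sub_is_source[OF path_union_sub[OF A]] sub_is_target[OF path_union_sub[OF A]] vH aH by auto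
  have supp: "support E H = tr F"
    using supp_path_union[OF A N] unfolding support_def vH aH F by simp
  have inner: "globular_face E H \<phi>" if phi: "\<phi> \<in> faces E H" "\<phi> \<subseteq> inside (tr F)" for \<phi>
  proof -
    have "inside (tr F) \<in> faces E H" unfolding faces_def supp
      by (rule component_if_frontier_disjoint) (use JD inside_no_overlap[of "tr F"] in auto)
    moreover have "\<phi> \<noteq> {}" using phi(1) in_components_nonempty unfolding faces_def by blast
    ultimately have eq: "\<phi> = inside (tr F)"
      using components_nonoverlap[of \<phi> "- support E H" "inside (tr F)"] phi unfolding faces_def by blast
    have im: "path_image (loop_of c d) = tr F" using loop_props(3)[OF A N] F by simp
    have "winding_number (loop_of c d) z = winding_number (loop_of c d) w - 1"
      if z: "z \<in> inside (tr F)" and w: "w \<in> - (support E H \<union> inside (tr F))" for z w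
    proof -
      have wo: "w \<in> outside (tr F)" using w supp inside_Un_outside[of "tr F"] by blast
      have zo: "z \<notin> tr (set c \<union> set d)" "w \<notin> tr (set c \<union> set d)"
        using not_in_if_inside[OF z] not_in_if_outside[OF wo] F by simp_all
      show ?thesis
        using winding_loop[OF A N zo(1)] winding_loop[OF A N zo(2)] sign[OF z]
          lens_wdiff_outside[OF lens, of w] wo F by simp
    qed
    moreover have "pre_digraph.apath H u c v" "pre_digraph.apath H u d v"
      unfolding sub_apath[OF H(1)] using A src(1) H(3) F unfolding sub_is_source[OF H(1)] by auto
    ultimately have "clockwise_boundary E H \<phi> c d"
      unfolding clockwise_boundary_def Let_def eq using N im JD(9) by auto
    then show ?thesis using phi by (auto simp: globular_face_def)
  qed
  have sub: "arcs H \<subseteq> disc_arcs F"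
    using arc_in_disc_iff[OF J] JD(11) H(3) unfolding disc_arcs_def by blast
  have V: "pt w \<in> disc F" if "w \<in> verts H" for w
    using pt_ends_trace[OF JD(11) that[unfolded H(2)]] unfolding disc_eq by (rule UnI1)
  show "globular E H" "source_of H = u" "target_of H = v" "dom_cod E H c d"
    "exterior_face E H = outside (tr F)"
    using region_globular[OF lens F H(1) eq_refl[OF H(3)[symmetric]] sub _ _ V _ _ sign inner] src
    unfolding sub_is_source[OF H(1)] sub_is_target[OF H(1)] by (simp_all only: simp_thms)
qed

text \<open>The part of \<open>G\<close> that is drawn in the disc: the largest subdivision of the lens.\<close>

definition disc_graph :: "'e set \<Rightarrow> ('v, 'e) pre_digraph" where
  "disc_graph F = \<lparr>verts = {w \<in> verts G. pt w \<in> disc F}, arcs = disc_arcs F, tail = tail G, head = head G\<rparr>"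

lemma disc_graph_sel:
  "verts (disc_graph F) = {w \<in> verts G. pt w \<in> disc F}" "arcs (disc_graph F) = disc_arcs F"
  "tail (disc_graph F) = tail G" "head (disc_graph F) = head G"
  by (auto simp: disc_graph_def)

lemma disc_graph_sub: "subgraph (disc_graph F) G"
proof -
  have "wf_digraph (disc_graph F)"
    by unfold_locales
      (use pt_ends_in_curve in \<open>auto simp: disc_graph_def disc_arcs_def\<close>)
  moreover have "wf_digraph G" by unfold_locales
  ultimately show ?thesis
    unfolding subgraph_def by (auto simp: disc_graph_def compatible_def disc_arcs_def)
qed

text \<open>
  The faces inside the curve are faces of \<open>G\<close> and so globular in \<open>G\<close>; their boundaries lie in
  the disc. A vertex in the disc is reached from the boundary of the disc, and reaches it,
  within the disc.
\<close>

lemma lens_disc_globular: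
  assumes lens: "lens u c d v" and F: "F = set c \<union> set d"
    and sign: "\<And>z. z \<in> inside (tr F) \<Longrightarrow> wdiff c d z = -1"
  shows "globular E (disc_graph F)" "source_of (disc_graph F) = u" "target_of (disc_graph F) = v"
    "dom_cod E (disc_graph F) c d"
proof -
  let ?H = "disc_graph F"
  have J: "jordan F" unfolding F by (rule lens_jordan[OF lens])
  note JD = jordanD[OF J]
  note A = lens_awalk[OF lens] and N = lens_ne[OF lens]
  note H = disc_graph_sub[of F]
  have FH: "F \<subseteq> disc_arcs F"
    using arc_in_disc_iff[OF J] JD(11) unfolding disc_arcs_def by blast
  have endsF: "ends F = verts (path_union u c d)" unfolding path_union_sel ends_lens[OF lens] F ..
  have pu: "is_source (path_union u c d) u" "is_target (path_union u c d) v"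
    by (rule path_union_source_target[OF A])+
  have reachF: "\<exists>p. set p \<subseteq> F \<and> awalk u p y" "\<exists>p. set p \<subseteq> F \<and> awalk y p v" if "y \<in> ends F" for y
  proof -
    have y: "y \<in> verts (path_union u c d)" using that unfolding endsF .
    have "arcs (path_union u c d) = F" unfolding path_union_sel F ..
    then show "\<exists>p. set p \<subseteq> F \<and> awalk u p y" "\<exists>p. set p \<subseteq> F \<and> awalk y p v"
      using pu y unfolding sub_is_source[OF path_union_sub[OF A]] sub_is_target[OF path_union_sub[OF A]]
      by metis+
  qed
  have in_disc: "set r \<subseteq> disc_arcs F" if "tr (set r) \<subseteq> disc F" "set r \<subseteq> arcs G" for r
    using that unfolding disc_arcs_def trace_def by blast
  have reach1: "\<exists>p. set p \<subseteq> disc_arcs F \<and> awalk u p w" if w: "w \<in> verts ?H" for w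
  proof -
    have w': "w \<in> verts G" "pt w \<in> disc F" using w by (auto simp: disc_graph_sel)
    obtain y r where yr: "y \<in> ends F" "awalk y r w" "tr (set r) \<subseteq> disc F"
      by (rule disc_descent[OF J w'])
    obtain p where p: "set p \<subseteq> F" "awalk u p y" using reachF(1)[OF yr(1)] by blast
    have "awalk u (p @ r) w" by (rule awalk_appendI[OF p(2) yr(2)])
    then show ?thesis using p(1) FH in_disc[OF yr(3) awalk_arcs[OF yr(2)]]
      by (intro exI[of _ "p @ r"]) auto
  qed
  have reach2: "\<exists>p. set p \<subseteq> disc_arcs F \<and> awalk w p v" if w: "w \<in> verts ?H" for w
  proof -
    have w': "w \<in> verts G" "pt w \<in> disc F" using w by (auto simp: disc_graph_sel)
    obtain y r where yr: "y \<in> ends F" "awalk w r y" "tr (set r) \<subseteq> disc F"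
      by (rule disc_ascent[OF J w'])
    obtain p where p: "set p \<subseteq> F" "awalk y p v" using reachF(2)[OF yr(1)] by blast
    have "awalk w (r @ p) v" by (rule awalk_appendI[OF yr(2) p(2)])
    then show ?thesis using p(1) FH in_disc[OF yr(3) awalk_arcs[OF yr(2)]]
      by (intro exI[of _ "r @ p"]) auto
  qed
  have suppH: "support E ?H \<subseteq> disc F"
    unfolding supp_sub(1)[OF H] disc_graph_sel by (auto simp: disc_arcs_def trace_def)
  have trH: "tr F \<subseteq> support E ?H"
    unfolding supp_sub(1)[OF H] disc_graph_sel using trace_mono[OF FH] by blast
  have supp_inside: "supp \<inter> inside (tr F) \<subseteq> support E ?H"
  proof
    fix z assume z: "z \<in> supp \<inter> inside (tr F)"
    then have "z \<in> supp" by simp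
    then show "z \<in> support E ?H"
    proof (rule supp_cases)
      fix w assume w: "w \<in> verts G" "z = pt w"
      then show ?thesis unfolding supp_sub(1)[OF H] disc_graph_sel using z disc_eq[of F] by blast
    next
      fix e assume e: "e \<in> arcs G" "z \<in> open_arc E e"
      have "e \<notin> F" using open_arc_in_trace[OF JD(11) e] z not_in_if_inside by blast
      then have "open_arc E e \<subseteq> inside (tr F)"
        using arc_side[OF J e(1)] z e inside_outside_disjoint by blast
      then have "e \<in> disc_arcs F" using arc_in_disc_iff[OF J e(1)] e by (simp add: disc_arcs_def)
      then show ?thesis unfolding supp_sub(1)[OF H] disc_graph_sel
        using open_arc_subset_curve[OF e(1)] e(2) by (auto simp: trace_def)
    qed
  qed
  have inner: "globular_face E ?H \<phi>" if phi: "\<phi> \<in> faces E ?H" "\<phi> \<subseteq> inside (tr F)" for \<phi>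
  proof -
    have phi_comp: "\<phi> \<in> components (- support E ?H)" using phi by (simp add: faces_def)
    have phi_ne: "\<phi> \<noteq> {}" "connected \<phi>" "\<phi> \<inter> support E ?H = {}"
      using in_components_nonempty[OF phi_comp] in_components_connected[OF phi_comp]
        in_components_subset[OF phi_comp] by auto
    have cH: "closed (support E ?H)"
      unfolding supp_sub(1)[OF H]
      by (intro closed_Un compact_imp_closed[OF compact_trace] finite_imp_closed)
        (use sub_tail_head(4)[OF H] finite_subset[OF sub_tail_head(3)[OF H]] in simp_all)
    have frH: "frontier \<phi> \<subseteq> support E ?H"
      using frontier_of_components_closed_complement[OF cH phi_comp] .
    have face: "\<phi> \<in> faces E G"
      unfolding faces_def
      by (rule component_if_frontier_disjoint)
        (use phi phi_ne supp_inside frH supp_sub(2)[OF H] in auto)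
    have "arcs G \<noteq> {}" using A(1) N(1) by (cases c) auto
    then obtain p q x y where pq: "p \<noteq> []" "q \<noteq> []" "apath x p y" "apath x q y"
      and pim: "path_image (loop_of p q) = frontier \<phi>"
      and wn: "\<And>z w. z \<in> \<phi> \<Longrightarrow> w \<in> - (supp \<union> \<phi>) \<Longrightarrow>
        winding_number (loop_of p q) z = winding_number (loop_of p q) w - 1"
      using faces_globular[OF _ face] unfolding globular_face_def clockwise_boundary_def Let_def by metis
    have ap: "awalk x p y" "awalk x q y" using pq by (auto simp: apath_def)
    have im: "tr (set p \<union> set q) = frontier \<phi>" using pim loop_props(3)[OF ap pq(1,2)] by simp
    then have trd: "tr (set p \<union> set q) \<subseteq> disc F" using frH suppH by blast
    have pqH: "set p \<subseteq> disc_arcs F" "set q \<subseteq> disc_arcs F"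
      using in_disc trd ap unfolding trace_Un by auto
    then have "x \<in> verts ?H"
    proof -
      obtain e p' where "p = e # p'" using pq(1) by (cases p) auto
      then have e: "e \<in> arcs G" "tail G e = x" "e \<in> disc_arcs F"
        using ap(1) pqH by (auto simp: awalk_Cons_iff)
      then show ?thesis using pt_ends_in_curve[OF e(1)] unfolding disc_graph_sel disc_arcs_def
        using tail_in_verts[OF e(1)] by auto
    qed
    then have apH: "pre_digraph.apath ?H x p y" "pre_digraph.apath ?H x q y"
      unfolding sub_apath[OF H] disc_graph_sel(2) using pqH ap by auto
    have "winding_number (loop_of p q) z = winding_number (loop_of p q) w - 1"
      if z: "z \<in> \<phi>" and w: "w \<in> - (support E ?H \<union> \<phi>)" for z w
    proof (cases "w \<in> supp")
      case False
      then show ?thesis using wn[OF z] w by auto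
    next
      case True
      then have "w \<notin> inside (tr F)" "w \<notin> tr F" using w supp_inside trH by auto
      then have wo: "w \<in> outside (tr F)" using inside_Un_outside[of "tr F"] by blast
      obtain w' where w': "w' \<in> outside (tr F)" "w' \<notin> supp"
        by (rule off_supp_dense[OF JD(5,4)])
      have const: "wdiff p q w = wdiff p q w'"
        by (rule wdiff_constant[OF ap _ JD(6) _ wo w'(1)]) (use trd pq in auto)
      have "w' \<notin> \<phi>" using w'(1) phi(2) not_inside_if_outside by blast
      then have "winding_number (loop_of p q) z = winding_number (loop_of p q) w' - 1"
        using wn[OF z] w'(2) by auto
      moreover have "w \<notin> tr (set p \<union> set q)" "w' \<notin> tr (set p \<union> set q)" using trd wo w' by auto
      ultimately show ?thesis
        using winding_loop[OF ap pq(1,2)] const by simp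
    qed
    then have "clockwise_boundary E ?H \<phi> p q"
      unfolding clockwise_boundary_def Let_def using pq apH pim by auto
    then show ?thesis using phi by (auto simp: globular_face_def)
  qed
  have uF: "u \<in> ends F" "v \<in> ends F" using pu endsF
    unfolding sub_is_source[OF path_union_sub[OF A]] sub_is_target[OF path_union_sub[OF A]] by simp_all
  have endsH: "y \<in> verts ?H" if y: "y \<in> ends F" for y
  proof -
    have "pt y \<in> tr F" by (rule pt_ends_trace[OF JD(11) y])
    then show ?thesis using ends_verts[OF JD(11)] y disc_eq[of F] unfolding disc_graph_sel by blast
  qed
  note R = region_globular[OF lens F H FH[folded disc_graph_sel(2)] _ endsH[OF uF(1)] endsH[OF uF(2)] _
    reach1[folded disc_graph_sel(2)] reach2[folded disc_graph_sel(2)] sign inner]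
  show "globular E ?H" "source_of ?H = u" "target_of ?H = v" "dom_cod E ?H c d"
    using R by (simp_all add: disc_graph_sel)
qed

end

section \<open>Series decomposition of a pair of parallel paths\<close>

context globular_digraph
begin

lemma pt_in_support_sub:
  assumes "subgraph H G" "w \<in> verts G"
  shows "pt w \<in> support E H \<longleftrightarrow> w \<in> verts H"
proof -
  note S = sub_tail_head[OF assms(1)]
  have "tail G e \<in> verts H" "head G e \<in> verts H" if "e \<in> arcs H" for e
    using wf_digraph.tail_in_verts[OF S(5) that] wf_digraph.head_in_verts[OF S(5) that]
    unfolding S(1,2) .
  then have e: "ends (arcs H) \<subseteq> verts H" by (intro Un_least image_subsetI)
  have 1: "pt w \<in> pt ` verts H \<longleftrightarrow> w \<in> verts H"
  proof
    assume "pt w \<in> pt ` verts H"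
    then obtain x where x: "x \<in> verts H" "pt w = pt x" by (rule imageE) simp
    then have "w = x" using inj_pt[OF assms(2), of x] S(3) by (simp add: subsetD)
    then show "w \<in> verts H" using x by simp
  qed (rule imageI)
  have 2: "pt w \<in> tr (arcs H) \<Longrightarrow> w \<in> verts H"
    using pt_in_trace[OF S(4) assms(2)] subsetD[OF e, of w] by simp
  show ?thesis
    unfolding supp_sub(1)[OF assms(1)] Un_iff 1 using 2 by iprover
qed

lemma open_arc_in_support_sub:
  assumes "subgraph H G" "e \<in> arcs G" "z \<in> open_arc E e"
  shows "z \<in> support E H \<longleftrightarrow> e \<in> arcs H"
proof -
  note S = sub_tail_head[OF assms(1)]
  have "z \<notin> pt ` verts H" using open_arc_vert[OF assms(2)] assms(3) S(3) by (metis imageE subsetD)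
  then show ?thesis
    unfolding supp_sub(1)[OF assms(1)] using open_arc_in_trace[OF S(4) assms(2,3)] by simp
qed

lemma sub_arc_verts:
  assumes "subgraph H G" "e \<in> arcs H"
  shows "tail G e \<in> verts H" "head G e \<in> verts H" "e \<in> arcs G"
proof -
  note S = sub_tail_head[OF assms(1)]
  show "tail G e \<in> verts H" "head G e \<in> verts H"
    using wf_digraph.tail_in_verts[OF S(5) assms(2)] wf_digraph.head_in_verts[OF S(5) assms(2)]
    unfolding S(1,2) .
  show "e \<in> arcs G" using S(4) assms(2) by (rule subsetD)
qed

lemma compact_support_sub:
  assumes "subgraph H G" shows "compact (support E H)"
  unfolding supp_sub(1)[OF assms]
  by (intro compact_Un compact_trace finite_imp_compact finite_imageI)
    (use sub_tail_head(4)[OF assms] finite_subset[OF sub_tail_head(3)[OF assms]] in simp_all)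

text \<open>Around \<open>z\<close> there is a ball that avoids \<open>X\<close> and contains points of the exterior face.\<close>

lemma outside_if_ext:
  assumes "z \<in> closure (outside supp)" "z \<notin> X" "compact X" "X \<subseteq> supp"
  shows "z \<in> outside X"
proof -
  have "open (- X)" using assms(3) by (simp add: compact_imp_closed open_Compl)
  then obtain r where r: "r > 0" "ball z r \<subseteq> - X" using assms(2) open_contains_ball by blast
  then obtain y where y: "y \<in> ball z r" "y \<in> outside supp"
    using assms(1) unfolding closure_approachable by (metis dist_commute mem_ball)
  have "y \<in> outside X" using outside_mono[OF assms(4)] y by blast
  then have "ball z r \<subseteq> outside X"
    using connected_subset_outside[OF connected_ball _ y(1)] r by blast
  then show ?thesis using r by auto
qed

lemma connected_walk_trace:
  assumes "awalk u p v"
  shows "connected (insert (pt u) (tr (set p)))" "pt v \<in> insert (pt u) (tr (set p))"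
proof -
  have "connected (insert (pt u) (tr (set p))) \<and> pt v \<in> insert (pt u) (tr (set p))"
  proof (cases "p = []")
    case True then show ?thesis using assms by (auto simp: awalk_Nil_iff)
  next
    case False
    note P = walk_curve_props[OF assms False]
    have "pt u \<in> tr (set p)" "pt v \<in> tr (set p)"
      using P pathstart_in_path_image[of "walk_curve E p"] pathfinish_in_path_image[of "walk_curve E p"] by auto
    then show ?thesis using connected_path_image[OF P(1)] P(4) by (simp add: insert_absorb)
  qed
  then show "connected (insert (pt u) (tr (set p)))" "pt v \<in> insert (pt u) (tr (set p))" by auto
qed

lemma walk_trace_avoids:
  assumes H: "subgraph H G" and p: "awalk u p v" and avoid: "set (awalk_verts u p) \<inter> verts H = {}"
  shows "insert (pt u) (tr (set p)) \<inter> support E H = {}"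
proof -
  have pA: "set p \<subseteq> arcs G" using p by blast
  have uv: "ends (set p) \<subseteq> set (awalk_verts u p)" "u \<in> set (awalk_verts u p)"
    using ends_subset_awalk_verts[OF p] hd_in_awalk_verts(1)[OF p] by auto
  have vert: "pt w \<notin> support E H" if "w \<in> set (awalk_verts u p)" for w
  proof -
    have "w \<in> verts G" using that p by (meson awalkE subsetD)
    then show ?thesis using pt_in_support_sub[OF H] that avoid by blast
  qed
  have "z \<notin> support E H" if z: "z \<in> tr (set p)" for z
  proof (rule trace_cases[OF pA z])
    fix e assume e: "e \<in> set p" "z \<in> open_arc E e"
    have "tail G e \<in> ends (set p)" using e(1) by simp
    then have "tail G e \<in> set (awalk_verts u p)" by (rule subsetD[OF uv(1)])
    then have "e \<notin> arcs H" using sub_arc_verts(1)[OF H, of e] avoid by blast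
    then show ?thesis using open_arc_in_support_sub[OF H _ e(2)] e(1) pA by blast
  next
    fix w assume "w \<in> ends (set p)" "z = pt w"
    then show ?thesis using vert[of w] subsetD[OF uv(1)] by simp
  qed
  then show ?thesis using vert[OF uv(2)] by blast
qed

lemma outside_from_s:
  assumes H: "subgraph H G" and p: "awalk s p v" "set (awalk_verts s p) \<inter> verts H = {}"
  shows "pt v \<in> outside (support E H)"
proof -
  note C = connected_walk_trace[OF p(1)] and A = walk_trace_avoids[OF H p]
  have "pt s \<in> outside (support E H)"
    using outside_if_ext[OF s_ext _ compact_support_sub[OF H] supp_sub(2)[OF H]] A by blast
  then show ?thesis using connected_subset_outside[OF C(1) A] C(2) by blast
qed

lemma outside_to_t:
  assumes H: "subgraph H G" and p: "awalk v p t" "set (awalk_verts v p) \<inter> verts H = {}"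
  shows "pt v \<in> outside (support E H)"
proof -
  note C = connected_walk_trace[OF p(1)] and A = walk_trace_avoids[OF H p]
  have "pt t \<in> outside (support E H)"
    using outside_if_ext[OF t_ext _ compact_support_sub[OF H] supp_sub(2)[OF H]] A C(2) by blast
  then show ?thesis using connected_subset_outside[OF C(1) A] C(2) by blast
qed

lemma open_arc_outside:
  assumes H: "subgraph H G" and e: "e \<in> arcs G" "e \<notin> arcs H"
    and w: "w = tail G e \<or> w = head G e" "pt w \<in> outside (support E H)"
  shows "open_arc E e \<subseteq> outside (support E H)"
proof -
  have dis: "open_arc E e \<inter> support E H = {}" using open_arc_in_support_sub[OF H e(1)] e(2) by blast
  have "pt w \<in> closure (open_arc E e)" using curve_subset_closure[OF e(1)] pt_ends_in_curve[OF e(1)] w(1) by blast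
  then have "outside (support E H) \<inter> open_arc E e \<noteq> {}"
    using open_Int_closure_eq_empty[OF open_outside[OF compact_imp_closed[OF compact_support_sub[OF H]]]] w(2) by blast
  then show ?thesis using connected_subset_outside[OF connected_open_arc[OF e(1)] dis] by blast
qed

lemma support_sub_cases:
  assumes "subgraph H G" "z \<in> support E H"
  obtains w where "w \<in> verts H" "z = pt w" | e where "e \<in> arcs H" "z \<in> open_arc E e"
proof -
  have "z \<in> supp" using supp_sub(2)[OF assms(1)] assms(2) by blast
  then show ?thesis
  proof (rule supp_cases)
    fix w assume "w \<in> verts G" "z = pt w"
    then show ?thesis using pt_in_support_sub[OF assms(1)] assms(2) that(1) by blast
  next
    fix e assume "e \<in> arcs G" "z \<in> open_arc E e"
    then show ?thesis using open_arc_in_support_sub[OF assms(1)] assms(2) that(2) by blast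
  qed
qed

text \<open>
  Every vertex of \<open>K\<close> reaches \<open>y\<close>, and \<open>y\<close> reaches every vertex of \<open>H\<close>. Thus a path from \<open>s\<close> to
  a vertex of \<open>K\<close> other than \<open>y\<close> avoids \<open>H\<close>, for otherwise there would be a directed cycle, and
  it connects the vertex to the exterior face. For \<open>H\<close> the same holds with paths to \<open>t\<close>.
\<close>

lemma series_separation:
  assumes K: "subgraph K G" "\<And>w. w \<in> verts K \<Longrightarrow> \<exists>r. awalk w r y"
    and H: "subgraph H G" "\<And>w. w \<in> verts H \<Longrightarrow> \<exists>r. awalk y r w"
  shows "support E K - {pt y} \<subseteq> outside (support E H)"
    and "support E H - {pt y} \<subseteq> outside (support E K)"
proof -
  have noarc: "e \<notin> arcs H" if eK: "e \<in> arcs K" for e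
  proof
    assume "e \<in> arcs H"
    then obtain r where r: "awalk y r (tail G e)" using sub_arc_verts(1)[OF H(1)] H(2) by blast
    obtain r' where r': "awalk (head G e) r' y" using sub_arc_verts(2)[OF K(1) eK] K(2) by blast
    have "awalk (tail G e) [e] (head G e)" using sub_arc_verts(3)[OF K(1) eK] by (simp add: arc_implies_awalk)
    then have "awalk y (r @ [e] @ r') y" using r r' awalk_appendI by blast
    then show False using acyclic_walk by blast
  qed
  have K': "pt w \<in> outside (support E H)" if w: "w \<in> verts K" "w \<noteq> y" for w
  proof -
    have wG: "w \<in> verts G" using w(1) sub_tail_head(3)[OF K(1)] by blast
    obtain p where p: "awalk s p w" using from_s[OF wG] by blast
    obtain r where r: "awalk w r y" using K(2)[OF w(1)] by blast
    have "set (awalk_verts s p) \<inter> verts H = {}"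
    proof (rule ccontr)
      assume "set (awalk_verts s p) \<inter> verts H \<noteq> {}"
      then obtain x where x: "x \<in> set (awalk_verts s p)" "x \<in> verts H" by blast
      obtain b where b: "awalk x b w" using awalk_split_vertex[OF p x(1)] by blast
      obtain a where a: "awalk y a x" using H(2)[OF x(2)] by blast
      have "awalk y (a @ b) w" by (rule awalk_appendI[OF a b])
      then show False using awalk_antisym[OF _ r] w(2) by blast
    qed
    then show ?thesis by (rule outside_from_s[OF H(1) p])
  qed
  have H': "pt w \<in> outside (support E K)" if w: "w \<in> verts H" "w \<noteq> y" for w
  proof -
    have wG: "w \<in> verts G" using w(1) sub_tail_head(3)[OF H(1)] by blast
    obtain p where p: "awalk w p t" using to_t[OF wG] by blast
    obtain r where r: "awalk y r w" using H(2)[OF w(1)] by blast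
    have "set (awalk_verts w p) \<inter> verts K = {}"
    proof (rule ccontr)
      assume "set (awalk_verts w p) \<inter> verts K \<noteq> {}"
      then obtain x where x: "x \<in> set (awalk_verts w p)" "x \<in> verts K" by blast
      obtain b where b: "awalk w b x" using awalk_split_vertex[OF p x(1)] by blast
      obtain a where a: "awalk x a y" using K(2)[OF x(2)] by blast
      have "awalk w (b @ a) y" by (rule awalk_appendI[OF b a])
      then show False using awalk_antisym[OF _ r] w(2) by blast
    qed
    then show ?thesis by (rule outside_to_t[OF K(1) p])
  qed
  show "support E K - {pt y} \<subseteq> outside (support E H)"
  proof
    fix z assume z: "z \<in> support E K - {pt y}"
    then have "z \<in> support E K" by simp
    then show "z \<in> outside (support E H)"
    proof (rule support_sub_cases[OF K(1)])
      fix w assume "w \<in> verts K" "z = pt w"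
      then show ?thesis using K' z by blast
    next
      fix e assume e: "e \<in> arcs K" "z \<in> open_arc E e"
      note V = sub_arc_verts[OF K(1) e(1)]
      obtain r' where r': "awalk (head G e) r' y" using V K(2) by blast
      have "tail G e \<noteq> y"
      proof
        assume "tail G e = y"
        then have "awalk y [e] (head G e)" using arc_implies_awalk[OF V(3)] by simp
        then have "awalk y ([e] @ r') y" using r' awalk_appendI by blast
        then show False using acyclic_walk by blast
      qed
      then have "pt (tail G e) \<in> outside (support E H)" using K' V by blast
      then show ?thesis using open_arc_outside[OF H(1) V(3) noarc[OF e(1)], of "tail G e"] e(2) by blast
    qed
  qed
  show "support E H - {pt y} \<subseteq> outside (support E K)"
  proof
    fix z assume z: "z \<in> support E H - {pt y}"
    then have "z \<in> support E H" by simp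
    then show "z \<in> outside (support E K)"
    proof (rule support_sub_cases[OF H(1)])
      fix w assume "w \<in> verts H" "z = pt w"
      then show ?thesis using H' z by blast
    next
      fix e assume e: "e \<in> arcs H" "z \<in> open_arc E e"
      note V = sub_arc_verts[OF H(1) e(1)]
      obtain r' where r': "awalk y r' (tail G e)" using V H(2) by blast
      have "head G e \<noteq> y"
      proof
        assume "head G e = y"
        then have "awalk (tail G e) [e] y" using arc_implies_awalk[OF V(3)] by simp
        then have "awalk y (r' @ [e]) y" using r' awalk_appendI by blast
        then show False using acyclic_walk by blast
      qed
      then have "pt (head G e) \<in> outside (support E K)" using H' V by blast
      then show ?thesis using open_arc_outside[OF K(1) V(3), of "head G e"] noarc e by blast
    qed
  qed
qed

lemma series_outside:
  assumes K: "subgraph K G" "\<And>w. w \<in> verts K \<Longrightarrow> \<exists>r. awalk w r y" "y \<in> verts K"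
    and H: "subgraph H G" "\<And>w. w \<in> verts H \<Longrightarrow> \<exists>r. awalk y r w" "y \<in> verts H"
    and z: "z \<in> outside (support E K)" "z \<in> outside (support E H)"
  shows "z \<in> outside (support E K \<union> support E H)"
proof (rule outside_Un_if_connected_Int[OF compact_support_sub[OF K(1)] compact_support_sub[OF H(1)] _ z])
  have "y \<in> verts G" using K sub_tail_head by blast
  then have "pt y \<in> support E K" "pt y \<in> support E H"
    using pt_in_support_sub[OF K(1)] pt_in_support_sub[OF H(1)] K(3) H(3) by blast+
  moreover have "support E K \<inter> support E H \<subseteq> {pt y}"
    using series_separation(1)[OF K(1,2) H(1,2)] not_in_if_outside by blast
  ultimately have "support E K \<inter> support E H = {pt y}" by blast
  then show "connected (support E K \<inter> support E H)" by simp
qed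

subsection \<open>Ears\<close>

lemma last_in_awalk_verts: "awalk u p v \<Longrightarrow> v \<in> set (awalk_verts u p)"
  using awlast_of_awalk[of u p v] last_in_set[of "awalk_verts u p"] by simp

lemma set_awalk_verts_append:
  assumes "awalk u p v" "awalk v q w"
  shows "set (awalk_verts u (p @ q)) = set (awalk_verts u p) \<union> set (awalk_verts v q)"
  using set_awalk_verts[OF assms(1)] set_awalk_verts[OF assms(2)]
    set_awalk_verts[OF awalk_appendI[OF assms]] last_in_awalk_verts[OF assms(1)] by auto

lemma set_awalk_verts_snoc:
  assumes "awalk u (p @ [e]) v"
  shows "set (awalk_verts u (p @ [e])) = insert (head G e) (set (awalk_verts u p))"
proof -
  have "awalk u p (tail G e)" "e \<in> arcs G" using assms by (auto simp: awalk_Cons_iff awalk_Nil_iff)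
  then have "tail G e \<in> set (awalk_verts u p)" by (intro last_in_awalk_verts)
  then show ?thesis using set_awalk_verts[OF assms] set_awalk_verts[OF \<open>awalk u p (tail G e)\<close>] by auto
qed

lemma last_visit:
  assumes "awalk m p w" "m \<in> V"
  shows "\<exists>p1 c y. p = p1 @ c \<and> y \<in> V \<and> awalk m p1 y \<and> awalk y c w \<and> set (awalk_verts y c) \<inter> V \<subseteq> {y}"
  using assms(1)
proof (induction p arbitrary: w rule: rev_induct)
  case Nil
  then show ?case using assms(2) by (auto simp: awalk_Nil_iff)
next
  case (snoc e p)
  have e: "e \<in> arcs G" "head G e = w" and p: "awalk m p (tail G e)"
    using snoc.prems by (auto simp: awalk_Cons_iff awalk_Nil_iff)
  show ?case
  proof (cases "w \<in> V")
    case True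
    then show ?thesis using snoc.prems e
      by (intro exI[of _ "p @ [e]"] exI[of _ "[]"] exI[of _ w]) (auto simp: awalk_Nil_iff)
  next
    case False
    obtain p1 c y where h: "p = p1 @ c" "y \<in> V" "awalk m p1 y" "awalk y c (tail G e)"
      "set (awalk_verts y c) \<inter> V \<subseteq> {y}" using snoc.IH[OF p] by blast
    have "awalk (tail G e) [e] w" using e arc_implies_awalk by blast
    then have c: "awalk y (c @ [e]) w" by (rule awalk_appendI[OF h(4)])
    then have "set (awalk_verts y (c @ [e])) \<inter> V \<subseteq> {y}"
      unfolding set_awalk_verts_snoc[OF c] using h(5) False e by auto
    then show ?thesis using h c by (intro exI[of _ p1] exI[of _ "c @ [e]"] exI[of _ y]) auto
  qed
qed

lemma first_visit:
  assumes "awalk w p n" "n \<in> V"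
  shows "\<exists>c p2 y. p = c @ p2 \<and> y \<in> V \<and> awalk w c y \<and> awalk y p2 n \<and> set (awalk_verts w c) \<inter> V \<subseteq> {y}"
  using assms(1)
proof (induction p arbitrary: w)
  case Nil
  then show ?case using assms(2) by (auto simp: awalk_Nil_iff)
next
  case (Cons e p)
  have e: "e \<in> arcs G" "tail G e = w" and p: "awalk (head G e) p n"
    using Cons.prems by (auto simp: awalk_Cons_iff)
  show ?case
  proof (cases "w \<in> V")
    case True
    then show ?thesis using Cons.prems e
      by (intro exI[of _ "[]"] exI[of _ "e # p"] exI[of _ w]) (auto simp: awalk_Nil_iff)
  next
    case False
    obtain c p2 y where h: "p = c @ p2" "y \<in> V" "awalk (head G e) c y" "awalk y p2 n"
      "set (awalk_verts (head G e) c) \<inter> V \<subseteq> {y}" using Cons.IH[OF p] by blast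
    then show ?thesis using False e
      by (intro exI[of _ "e # c"] exI[of _ p2] exI[of _ y]) (auto simp: awalk_Cons_iff)
  qed
qed

text \<open>
  Follow \<open>x\<close> from \<open>e\<close> in both directions until it meets \<open>p\<close>. In the absence of directed cycles,
  the two meeting points occur on \<open>p\<close> in the same order as on \<open>x\<close>.
\<close>

lemma ear:
  assumes "awalk m p n" "awalk m x n" "e \<in> set x" "e \<notin> set p"
  obtains p1 d p2 x1 c x2 y y' where "p = p1 @ d @ p2" "x = x1 @ c @ x2" "e \<in> set c"
    "lens y c d y'" "awalk m p1 y" "awalk m x1 y" "awalk y' p2 n" "awalk y' x2 n"
proof -
  let ?V = "set (awalk_verts m p)"
  obtain xa xb where x: "x = xa @ e # xb" using assms(3) by (meson split_list)
  then have xa: "awalk m xa (tail G e)" and e: "e \<in> arcs G" and xb: "awalk (head G e) xb n"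
    using assms(2) by (auto simp: awalk_Cons_iff)
  have mn: "m \<in> ?V" "n \<in> ?V"
    using hd_in_awalk_verts(1)[OF assms(1)] last_in_awalk_verts[OF assms(1)] .
  obtain x1 c1 y where h1: "xa = x1 @ c1" "y \<in> ?V" "awalk m x1 y" "awalk y c1 (tail G e)"
    "set (awalk_verts y c1) \<inter> ?V \<subseteq> {y}" using last_visit[OF xa mn(1)] by blast
  obtain c2 x2 y' where h2: "xb = c2 @ x2" "y' \<in> ?V" "awalk (head G e) c2 y'" "awalk y' x2 n"
    "set (awalk_verts (head G e) c2) \<inter> ?V \<subseteq> {y'}" using first_visit[OF xb mn(2)] by blast
  define c where "c = c1 @ [e] @ c2"
  have ce: "awalk (tail G e) [e] (head G e)" using e arc_implies_awalk by blast
  have c: "awalk y c y'" unfolding c_def by (intro awalk_appendI[OF h1(4)] awalk_appendI[OF ce] h2(3))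
  have cne: "c \<noteq> []" by (simp add: c_def)
  then have yy: "y \<noteq> y'" using c acyclic_walk by blast
  have ec: "awalk (tail G e) ([e] @ c2) y'" by (rule awalk_appendI[OF ce h2(3)])
  have "set (awalk_verts y c) = set (awalk_verts y c1) \<union> set (awalk_verts (head G e) c2)"
    using set_awalk_verts_append[OF h1(4) ec] last_in_awalk_verts[OF h1(4)] unfolding c_def by auto
  then have cV: "set (awalk_verts y c) \<inter> ?V \<subseteq> {y, y'}" using h1(5) h2(5) by blast
  have carc: "set c \<inter> set p = {}"
  proof (rule ccontr)
    assume "set c \<inter> set p \<noteq> {}"
    then obtain g where g: "g \<in> set c" "g \<in> set p" by blast
    have gG: "g \<in> arcs G" using g(2) assms(1) by blast
    have gend: "tail G g \<in> set (awalk_verts a q)" "head G g \<in> set (awalk_verts a q)"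
      if "awalk a q b" "g \<in> set q" for a q b
      using set_awalk_verts[OF that(1)] that(2) by auto
    note gp = gend[OF assms(1) g(2)]
    have "g \<noteq> e" using assms(4) g(2) by blast
    then consider "g \<in> set c1" | "g \<in> set c2" using g(1) by (auto simp: c_def)
    then have "tail G g = head G g"
    proof cases
      case 1
      then show ?thesis using gend[OF h1(4) 1] gp h1(5) by blast
    next
      case 2
      then show ?thesis using gend[OF h2(3) 2] gp h2(5) by blast
    qed
    then show False using no_loop[OF gG] by blast
  qed
  obtain p1 p' where p1: "p = p1 @ p'" "awalk m p1 y" "awalk y p' n"
    by (rule awalk_split_vertex[OF assms(1) h1(2)])
  have pverts: "?V = set (awalk_verts m p1) \<union> set (awalk_verts y p')"
    unfolding p1(1) by (rule set_awalk_verts_append[OF p1(2,3)])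
  have "y' \<notin> set (awalk_verts m p1)"
  proof
    assume "y' \<in> set (awalk_verts m p1)"
    then obtain r where "awalk y' r y" by (rule awalk_split_vertex[OF p1(2)])
    then show False using awalk_antisym[OF c] yy by blast
  qed
  then have "y' \<in> set (awalk_verts y p')" using h2(2) pverts by blast
  then obtain d p2 where d: "p' = d @ p2" "awalk y d y'" "awalk y' p2 n"
    by (rule awalk_split_vertex[OF p1(3)])
  have "set (awalk_verts y d) \<subseteq> ?V"
    using pverts set_awalk_verts_append[OF d(2,3)] unfolding d(1) by blast
  moreover have "set d \<subseteq> set p" unfolding p1(1) d(1) by auto
  moreover have "d \<noteq> []" using d(2) yy by (auto simp: awalk_Nil_iff)
  ultimately have "lens y c d y'"
    unfolding lens_def using awalk_apath[OF c] awalk_apath[OF d(2)] cne carc cV by blast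
  then show ?thesis
    using that[of p1 d p2 x1 c x2 y y'] p1 d h1 h2 x unfolding c_def by simp
qed

subsection \<open>Induction over a pair of parallel paths\<close>

text \<open>The blocks of which a pair of parallel paths is composed: common arcs and lenses.\<close>

definition piece :: "'v \<Rightarrow> 'e list \<Rightarrow> 'e list \<Rightarrow> 'v \<Rightarrow> bool" where
  "piece m c d y \<longleftrightarrow> (\<exists>e\<in>arcs G. c = [e] \<and> d = [e] \<and> tail G e = m \<and> head G e = y) \<or> lens m c d y"

lemma piece_awalk: "piece m c d y \<Longrightarrow> awalk m c y" "piece m c d y \<Longrightarrow> awalk m d y"
  unfolding piece_def using lens_awalk arc_implies_awalk by blast+

lemma piece_ne: "piece m c d y \<Longrightarrow> c \<noteq> []" "piece m c d y \<Longrightarrow> d \<noteq> []"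
  unfolding piece_def using lens_ne by blast+

text \<open>
  The first block is the first arc if both paths begin with it. Otherwise it is the ear at the
  first arc of \<open>p\<close>, which starts at the common initial vertex.
\<close>

lemma parallel_induct [consumes 2, case_names Nil piece]:
  assumes "awalk m p n" "awalk m q n"
    and Nil: "\<And>m. m \<in> verts G \<Longrightarrow> P m [] [] m"
    and step: "\<And>m c d y p q n. piece m c d y \<Longrightarrow> awalk y p n \<Longrightarrow> awalk y q n \<Longrightarrow> P y p q n \<Longrightarrow>
      P m (c @ p) (d @ q) n"
  shows "P m p q n"
  using assms(1,2)
proof (induction "length p" arbitrary: m p q rule: less_induct)
  case less
  show ?case
  proof (cases "p = []")
    case True
    then have "q = []" using awalk_Nil_both[OF less.prems] by simp
    then show ?thesis using True less.prems Nil by (auto simp: awalk_Nil_iff)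
  next
    case False
    then obtain e p' f q' where pq: "p = e # p'" "q = f # q'"
      using awalk_Nil_both[OF less.prems] by (metis list.exhaust)
    have e: "e \<in> arcs G" "tail G e = m" "awalk (head G e) p' n"
      and f: "f \<in> arcs G" "tail G f = m" "awalk (head G f) q' n"
      using less.prems pq by (auto simp: awalk_Cons_iff)
    show ?thesis
    proof (cases "e = f")
      case True
      have "P (head G e) p' q' n" using less.hyps[of p' "head G e" q'] e f True pq by simp
      moreover have "piece m [e] [e] (head G e)" using e by (auto simp: piece_def)
      ultimately have "P m ([e] @ p') ([e] @ q') n" using step e f True by blast
      then show ?thesis using pq True by simp
    next
      case False
      have eq: "e \<notin> set q"
      proof
        assume "e \<in> set q"
        then obtain a b where ab: "q = a @ e # b" by (meson split_list)
        then have "awalk m a m" using less.prems(2) e by (auto simp: awalk_Cons_iff)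
        then have "a = []" by (rule acyclic_walk)
        then show False using ab pq False by simp
      qed
      obtain q1 d q2 p1 c p2 y y' where h: "q = q1 @ d @ q2" "p = p1 @ c @ p2" "e \<in> set c" "lens y c d y'"
        "awalk m q1 y" "awalk m p1 y" "awalk y' q2 n" "awalk y' p2 n"
        using ear[OF less.prems(2,1) _ eq] pq by (metis list.set_intros(1))
      have "p1 = []"
      proof (rule ccontr)
        assume "p1 \<noteq> []"
        then obtain p1' where "p1 = e # p1'" using h(2) pq by (cases p1) auto
        then have "\<not> distinct p" using h(2,3) by auto
        then show False using awalk_distinct[OF less.prems(1)] by blast
      qed
      then have y: "y = m" using h(6) by (simp add: awalk_Nil_iff)
      then have "q1 = []" using h(5) acyclic_walk by blast
      have "c \<noteq> []" using lens_ne[OF h(4)] by blast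
      then have "P y' p2 q2 n" using less.hyps[of p2 y' q2] h by simp
      then have "P m (c @ p2) (d @ q2) n"
        using step[of m c d y' p2 n q2] h(4,7,8) y by (simp add: piece_def)
      then show ?thesis using h(1,2) \<open>p1 = []\<close> \<open>q1 = []\<close> by simp
    qed
  qed
qed

lemma path_union_append:
  assumes "awalk m c y" "awalk m d y" "awalk y p n" "awalk y q n"
  shows "path_union m (c @ p) (d @ q) = Digraph_Component.union (path_union m c d) (path_union y p q)"
proof -
  show ?thesis
    using set_awalk_verts_append[OF assms(1,3)] set_awalk_verts_append[OF assms(2,4)]
    by (auto simp: Digraph_Component.union_def path_graph_def)
qed

lemma path_union_reach:
  assumes "awalk m p n" "awalk m q n" "w \<in> verts (path_union m p q)"
  shows "\<exists>r. awalk m r w" "\<exists>r. awalk w r n"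
  using path_union_source_target[OF assms(1,2)] assms(3)
  unfolding sub_is_source[OF path_union_sub[OF assms(1,2)]] sub_is_target[OF path_union_sub[OF assms(1,2)]]
  by blast+

lemma path_union_ends_in:
  assumes "awalk m p n" "awalk m q n"
  shows "m \<in> verts (path_union m p q)" "n \<in> verts (path_union m p q)"
  using path_union_source_target[OF assms]
  unfolding sub_is_source[OF path_union_sub[OF assms]] sub_is_target[OF path_union_sub[OF assms]]
  by blast+

lemma support_union: "support E (Digraph_Component.union H K) = support E H \<union> support E K"
  by (auto simp: support_def Digraph_Component.union_def)

lemma piece_support: "piece m c d y \<Longrightarrow> support E (path_union m c d) = tr (set c \<union> set d)"
  by (rule supp_path_union[OF piece_awalk piece_ne])

lemma closure_outside_if_inside_empty:
  assumes "X \<subseteq> supp" "inside X = {}"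
  shows "closure (outside X) = UNIV"
proof -
  have "outside X = - X" using inside_Un_outside[of X] assms(2) by blast
  moreover have "interior X = {}" using interior_mono[OF assms(1)] interior_supp by blast
  ultimately show ?thesis by (simp add: closure_complement)
qed

lemma piece_subset_closure_outside:
  assumes "piece m c d y"
  shows "tr (set c \<union> set d) \<subseteq> closure (outside (tr (set c \<union> set d)))"
  using assms unfolding piece_def
proof
  assume "\<exists>e\<in>arcs G. c = [e] \<and> d = [e] \<and> tail G e = m \<and> head G e = y"
  then obtain e where e: "e \<in> arcs G" "c = [e]" "d = [e]" by blast
  have "inside (tr {e}) = {}" using inside_arc_empty[OF arc_curve[OF e(1)]] by (simp add: trace_insert)
  then have "closure (outside (tr {e})) = UNIV"
    using closure_outside_if_inside_empty trace_subset_supp[of "{e}"] e(1) by simp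
  then show ?thesis using e by simp
next
  assume "lens m c d y"
  then show ?thesis using jordanD(10)[OF lens_jordan] by (metis Diff_subset frontier_def)
qed

text \<open>
  A block \<open>X\<close> and the remainder \<open>Y\<close> have only the vertex \<open>y\<close> in common, and apart from it each
  lies outside the other. The inside of \<open>X\<close> is connected and has the initial vertex \<open>m\<close> in its
  closure, so it lies outside \<open>Y\<close> too.
\<close>

lemma piece_series_facts:
  assumes pc: "piece m c d y" and pq: "awalk y p n" "awalk y q n"
  defines "X \<equiv> tr (set c \<union> set d)" and "Y \<equiv> support E (path_union y p q)"
  shows "X - {pt y} \<subseteq> outside Y" "Y - {pt y} \<subseteq> outside X" "pt y \<in> X" "pt y \<in> Y"
    "\<And>z. z \<in> outside X \<Longrightarrow> z \<in> outside Y \<Longrightarrow> z \<in> outside (X \<union> Y)"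
    "support E (path_union m (c @ p) (d @ q)) = X \<union> Y"
    "inside X \<subseteq> outside Y"
proof -
  note A = piece_awalk[OF pc]
  let ?K = "path_union m c d" and ?H = "path_union y p q"
  have X: "X = support E ?K" unfolding X_def piece_support[OF pc] ..
  note K = path_union_sub[OF A] path_union_reach(2)[OF A] path_union_ends_in(2)[OF A]
  note H = path_union_sub[OF pq] path_union_reach(1)[OF pq] path_union_ends_in(1)[OF pq]
  show sep: "X - {pt y} \<subseteq> outside Y" "Y - {pt y} \<subseteq> outside X"
    unfolding X Y_def using series_separation[OF K(1,2) H(1,2)] by blast+
  have "y \<in> verts G" using A(1) by (rule awalk_last_in_verts)
  then show pty: "pt y \<in> X" "pt y \<in> Y"
    unfolding X Y_def using pt_in_support_sub[OF K(1)] pt_in_support_sub[OF H(1)] K(3) H(3) by blast+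
  show "z \<in> outside (X \<union> Y)" if "z \<in> outside X" "z \<in> outside Y" for z
    using series_outside[OF K H] that unfolding X Y_def by blast
  show "support E (path_union m (c @ p) (d @ q)) = X \<union> Y"
    unfolding path_union_append[OF A pq] support_union X Y_def ..
  have compX: "compact X" unfolding X by (rule compact_support_sub[OF K(1)])
  show "inside X \<subseteq> outside Y"
    using pc unfolding piece_def
  proof
    assume "\<exists>e\<in>arcs G. c = [e] \<and> d = [e] \<and> tail G e = m \<and> head G e = y"
    then obtain e where e: "e \<in> arcs G" "c = [e]" "d = [e]" by blast
    have "inside (tr {e}) = {}" using inside_arc_empty[OF arc_curve[OF e(1)]] by (simp add: trace_insert)
    then show ?thesis using e by (simp add: X_def)
  next
    assume lens: "lens m c d y"
    note JD = jordanD[OF lens_jordan[OF lens]]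
    have m: "m \<in> verts G" "m \<noteq> y"
      using A(1) lens_ne(1)[OF lens] acyclic_walk awalk_hd_in_verts by blast+
    have ptm: "pt m \<in> X" unfolding X using pt_in_support_sub[OF K(1) m(1)] path_union_ends_in(1)[OF A] by blast
    have "pt m \<noteq> pt y" using inj_pt[OF m(1) \<open>y \<in> verts G\<close>] m(2) by blast
    then have out: "pt m \<in> outside Y" using sep(1) ptm by blast
    have cl: "pt m \<in> closure (inside X)" using ptm JD(9) unfolding X_def frontier_def by blast
    have con: "connected (insert (pt m) (inside X))"
      by (rule connected_intermediate_closure[OF JD(3)[folded X_def]]) (use cl closure_subset in auto)
    have "inside X \<inter> Y = {}"
      using sep(2) pty not_in_if_inside not_inside_if_outside by blast
    then have "insert (pt m) (inside X) \<inter> Y = {}" using not_in_if_outside[OF out] by blast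
    then show "inside X \<subseteq> outside Y" using connected_subset_outside[OF con _ _ out] by blast
  qed
qed

lemma support_contains_trace:
  "awalk y p n \<Longrightarrow> awalk y q n \<Longrightarrow> tr (set p \<union> set q) \<subseteq> support E (path_union y p q)"
  unfolding supp_sub(1)[OF path_union_sub] path_union_sel by blast

lemma wdiff_outside_support:
  assumes "awalk y p n" "awalk y q n" "z \<in> outside (support E (path_union y p q))"
  shows "wdiff p q z = 0"
  by (rule wdiff_outside[OF assms(1,2) awalk_Nil_both[OF assms(1,2)]])
    (rule subsetD[OF outside_mono[OF support_contains_trace[OF assms(1,2)]] assms(3)])

text \<open>
  This makes every arc of the union of two parallel paths incident with the exterior face, as
  required of a glob.
\<close>

lemma support_subset_closure_outside:
  assumes "awalk m p n" "awalk m q n"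
  shows "support E (path_union m p q) \<subseteq> closure (outside (support E (path_union m p q)))"
  using assms
proof (induction rule: parallel_induct)
  case (Nil m)
  have "support E (path_union m [] []) = {pt m}"
    unfolding support_def path_union_sel by simp
  moreover have "closure (outside {pt m}) = UNIV"
    by (rule closure_outside_if_inside_empty) (use Nil pt_in_supp inside_convex in auto)
  ultimately show ?case by simp
next
  case (piece m c d y p q n)
  define X where "X = tr (set c \<union> set d)"
  define Y where "Y = support E (path_union y p q)"
  note F = piece_series_facts[OF piece(1-3), folded X_def Y_def]
  let ?C = "closure (outside (X \<union> Y))"
  have oX: "open (outside X)" "open (outside Y)"
    unfolding X_def Y_def piece_support[OF piece(1), symmetric]
    by (rule open_outside[OF compact_imp_closed[OF compact_support_sub[OF path_union_sub[OF piece_awalk[OF piece(1)]]]]],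
      rule open_outside[OF compact_imp_closed[OF compact_support_sub[OF path_union_sub[OF piece(2,3)]]]])
  have Xc: "X \<subseteq> closure (outside X)" unfolding X_def by (rule piece_subset_closure_outside[OF piece(1)])
  have Yc: "Y \<subseteq> closure (outside Y)" using piece.IH unfolding Y_def .
  have int: "outside X \<inter> outside Y \<subseteq> outside (X \<union> Y)" using F(5) by blast
  have X1: "X - {pt y} \<subseteq> ?C"
  proof
    fix z assume z: "z \<in> X - {pt y}"
    then have "z \<in> closure (outside X) \<inter> outside Y" using F(1) Xc by blast
    then have "z \<in> closure (outside X \<inter> outside Y)"
      using open_Int_closure_subset[OF oX(2), of "outside X"] by (auto simp: Int_commute)
    then show "z \<in> ?C" using closure_mono[OF int] by blast
  qed
  have Y1: "Y - {pt y} \<subseteq> ?C"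
  proof
    fix z assume z: "z \<in> Y - {pt y}"
    then have "z \<in> closure (outside Y) \<inter> outside X" using F(2) Yc by blast
    then have "z \<in> closure (outside X \<inter> outside Y)"
      using open_Int_closure_subset[OF oX(1), of "outside Y"] by (auto simp: Int_commute)
    then show "z \<in> ?C" using closure_mono[OF int] by blast
  qed
  have "pt y \<in> ?C"
  proof -
    obtain f c' where c: "c = c' @ [f]" using piece_ne(1)[OF piece(1)] by (metis rev_exhaust)
    then have f: "f \<in> arcs G" "head G f = y"
      using piece_awalk(1)[OF piece(1)] by (auto simp: awalk_Cons_iff awalk_Nil_iff)
    have "y \<in> verts G" using f by auto
    then have "pt y \<notin> open_arc E f" by (rule open_arc_vert[OF f(1)])
    moreover have "open_arc E f \<subseteq> X"
      using open_arc_subset_curve[OF f(1)] c unfolding X_def trace_def by auto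
    ultimately have "open_arc E f \<subseteq> X - {pt y}" by blast
    then have "open_arc E f \<subseteq> ?C" using X1 by blast
    then have "closure (open_arc E f) \<subseteq> ?C" by (simp add: closure_minimal)
    then show ?thesis using curve_subset_closure[OF f(1)] pt_ends_in_curve(2)[OF f(1)] f(2) by blast
  qed
  then show ?case unfolding F(6) using X1 Y1 by blast
qed

text \<open>
  A point inside the union is inside exactly one lens, and the other blocks contribute nothing
  there. The sign of the lens is determined by the hypothesis at a point off the graph.
\<close>

lemma wdiff_inside:
  assumes "awalk m p n" "awalk m q n" "\<And>z. z \<notin> supp \<Longrightarrow> wdiff p q z \<le> 0"
  shows "\<forall>z\<in>inside (support E (path_union m p q)). wdiff p q z = -1"
  using assms
proof (induction rule: parallel_induct)
  case (Nil m)
  have "support E (path_union m [] []) = {pt m}"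
    unfolding support_def path_union_sel by simp
  then show ?case using inside_convex[of "{pt m}"] by simp
next
  case (piece m c d y p q n)
  define X where "X = tr (set c \<union> set d)"
  define Y where "Y = support E (path_union y p q)"
  note F = piece_series_facts[OF piece(1-3), folded X_def Y_def]
  have zero: "wdiff p q z = 0" if "z \<in> inside X" for z
    using wdiff_outside_support[OF piece(2,3)] F(7) that unfolding Y_def by blast
  have XA: "X \<subseteq> supp" unfolding X_def
    by (rule trace_subset_supp) (use piece_awalk[OF piece(1)] in blast)
  have cd: "wdiff c d z = 0" if "z \<in> outside X" for z
    using wdiff_outside[OF piece_awalk[OF piece(1)]] piece_ne[OF piece(1)] that unfolding X_def by blast
  have sign: "wdiff c d z = -1" if z: "z \<in> inside X" for z
    using piece(1) unfolding piece_def
  proof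
    assume "\<exists>e\<in>arcs G. c = [e] \<and> d = [e] \<and> tail G e = m \<and> head G e = y"
    then obtain e where e: "e \<in> arcs G" "c = [e]" "d = [e]" by blast
    have "inside (tr {e}) = {}" using inside_arc_empty[OF arc_curve[OF e(1)]] by (simp add: trace_insert)
    then show ?thesis using e z by (simp add: X_def)
  next
    assume lens: "lens m c d y"
    note JD = jordanD[OF lens_jordan[OF lens], folded X_def]
    obtain \<epsilon> where eps: "\<epsilon> = 1 \<or> \<epsilon> = -1" "\<And>z. z \<in> inside X \<Longrightarrow> wdiff c d z = \<epsilon>"
      using lens_wdiff_inside[OF lens] unfolding X_def by metis
    obtain z' where z': "z' \<in> inside X" "z' \<notin> supp" by (rule off_supp_dense[OF JD(2,1)])
    have "wdiff (c @ p) (d @ q) z' \<le> 0" by (rule piece.prems[OF z'(2)])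
    then have "\<epsilon> \<le> 0" using eps(2)[OF z'(1)] zero[OF z'(1)] by (simp add: wdiff_append)
    then show ?thesis using eps z by fastforce
  qed
  have le: "wdiff p q z \<le> 0" if z: "z \<notin> supp" for z
  proof (cases "z \<in> inside X")
    case True then show ?thesis using zero by simp
  next
    case False
    then have "z \<in> outside X" using z XA inside_Un_outside[of X] by blast
    then show ?thesis using piece.prems[OF z] cd by (simp add: wdiff_append)
  qed
  note IH = piece.IH[OF le, folded Y_def]
  show ?case unfolding F(6)
  proof
    fix z assume z: "z \<in> inside (X \<union> Y)"
    then have zn: "z \<notin> X" "z \<notin> Y" using not_in_if_inside by blast+
    show "wdiff (c @ p) (d @ q) z = -1"
    proof (cases "z \<in> inside X")
      case True
      then show ?thesis using sign zero by (simp add: wdiff_append)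
    next
      case False
      then have zo: "z \<in> outside X" using zn inside_Un_outside[of X] by blast
      then have "z \<notin> outside Y" using F(5) z not_inside_if_outside by blast
      then have "z \<in> inside Y" using zn inside_Un_outside[of Y] by blast
      then show ?thesis using IH cd[OF zo] by (simp add: wdiff_append)
    qed
  qed
qed

text \<open>In this way the union of two comparable paths serves as a witness.\<close>

lemma path_union_glob:
  assumes pq: "awalk m p n" "awalk m q n" and le: "\<And>z. z \<notin> supp \<Longrightarrow> wdiff p q z \<le> 0"
    and glob: "globular E (path_union m p q)"
  shows "dom_cod E (path_union m p q) p q" "glob E (path_union m p q)"
proof -
  let ?U = "path_union m p q"
  define Y where "Y = support E ?U"
  have "dom_cod E ?U p q \<and> glob E ?U"
  proof (cases "p = []")
    case True
    then have "q = []" using awalk_Nil_both[OF pq] by simp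
    then show ?thesis using True glob unfolding dom_cod_def glob_def trivial_graph_def path_union_sel by simp
  next
    case False
    then have qne: "q \<noteq> []" using awalk_Nil_both[OF pq] by simp
    have Y: "Y = tr (set p \<union> set q)" unfolding Y_def by (rule supp_path_union[OF pq False qne])
    have compY: "compact Y" unfolding Y_def by (rule compact_support_sub[OF path_union_sub[OF pq]])
    have oY: "open (outside Y)" by (rule open_outside[OF compact_imp_closed[OF compY]])
    have fr: "frontier (outside Y) = Y"
    proof
      show "frontier (outside Y) \<subseteq> Y" by (rule frontier_outside_subset[OF compact_imp_closed[OF compY]])
      show "Y \<subseteq> frontier (outside Y)"
        using support_subset_closure_outside[OF pq, folded Y_def] oY not_in_if_outside
        unfolding frontier_def interior_open[OF oY] by blast
    qed
    have ext: "exterior_face E ?U = outside Y" by (simp add: exterior_face_def Y_def)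
    have "outside Y \<in> faces E ?U"
      unfolding faces_def Y_def[symmetric] outside_in_components
      using connected_outside[OF compact_imp_bounded[OF compY]]
        outside_bounded_nonempty[OF compact_imp_bounded[OF compY]] by simp
    note face = this
    have ap: "pre_digraph.apath ?U m p n" "pre_digraph.apath ?U m q n"
      unfolding sub_apath[OF path_union_sub[OF pq]] path_union_sel(2)
      using pq path_union_ends_in(1)[OF pq] by blast+
    have "winding_number (loop_of q p) z = winding_number (loop_of q p) w - 1"
      if z: "z \<in> outside Y" and w: "w \<in> - (Y \<union> outside Y)" for z w
    proof -
      have wi: "w \<in> inside Y" using w inside_Un_outside[of Y] by blast
      have zo: "z \<notin> tr (set q \<union> set p)" "w \<notin> tr (set q \<union> set p)"
        using not_in_if_outside[OF z] not_in_if_inside[OF wi] Y by (simp_all add: Un_commute)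
      have "wdiff q p z = 0"
        using wdiff_outside_support[OF pq, folded Y_def, OF z] wdiff_sym[of q p z] by simp
      moreover have "wdiff q p w = 1"
        using wdiff_inside[OF pq le, folded Y_def] wi wdiff_sym[of q p w] by simp
      ultimately show ?thesis
        using winding_loop[OF pq(2,1) qne False zo(1)] winding_loop[OF pq(2,1) qne False zo(2)] by simp
    qed
    then have "clockwise_boundary E ?U (outside Y) q p"
      unfolding clockwise_boundary_def Let_def Y_def[symmetric]
      using False qne ap loop_props(3)[OF pq(2,1) qne False] fr Y by (auto simp: Un_commute)
    then have dc: "dom_cod E ?U p q" unfolding dom_cod_def face_dom_cod_def ext using face by simp
    have "arc_incident E ?U e (exterior_face E ?U)" if e: "e \<in> arcs ?U" for e
      unfolding arc_incident_def ext fr using e face unfolding path_union_sel Y trace_def by blast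
    then show ?thesis using dc glob unfolding glob_def by blast
  qed
  then show "dom_cod E ?U p q" "glob E ?U" by auto
qed

end

section \<open>The order on paths and elementary cells\<close>

context globular_digraph
begin

lemma locally_constant:
  assumes "awalk m a n" "awalk m x n" "e \<in> arcs G" "e \<notin> set a \<union> set x" "z \<in> open_arc E e"
  obtains V where "open V" "z \<in> V" "\<And>w w'. w \<in> V \<Longrightarrow> w' \<in> V \<Longrightarrow> wdiff a x w = wdiff a x w'"
proof -
  have A: "set a \<union> set x \<subseteq> arcs G" using assms(1,2) by blast
  have "open (- tr (set a \<union> set x))"
    using compact_trace[OF A] by (simp add: compact_imp_closed open_Compl)
  moreover have "z \<in> - tr (set a \<union> set x)" using open_arc_in_trace[OF A assms(3,5)] assms(4) by simp
  ultimately obtain r where r: "r > 0" "ball z r \<subseteq> - tr (set a \<union> set x)"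
    using open_contains_ball by blast
  have "wdiff a x w = wdiff a x w'" if "w \<in> ball z r" "w' \<in> ball z r" for w w'
    by (rule wdiff_constant[OF assms(1,2) awalk_Nil_both[OF assms(1,2)] connected_ball _ that])
      (simp add: disjoint_eq_subset_Compl r(2))
  then show ?thesis by (rule that[OF open_ball centre_in_ball[THEN iffD2, OF r(1)]])
qed

lemma side_points:
  assumes "jordan F" "e \<in> F" "z \<in> open_arc E e" "open V" "z \<in> V"
  obtains w w' where "w \<in> V" "w \<in> inside (tr F)" "w \<notin> supp" "w' \<in> V" "w' \<in> outside (tr F)" "w' \<notin> supp"
proof -
  note JD = jordanD[OF assms(1)]
  have "z \<in> tr F" using open_arc_in_trace[OF JD(11) _ assms(3)] assms(2) JD(11) by blast
  then have "z \<in> closure (inside (tr F))" "z \<in> closure (outside (tr F))"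
    using JD(9,10) by (auto simp: frontier_def)
  then have "V \<inter> inside (tr F) \<noteq> {}" "V \<inter> outside (tr F) \<noteq> {}"
    using open_Int_closure_eq_empty[OF assms(4)] assms(5) by blast+
  moreover have "open (V \<inter> inside (tr F))" "open (V \<inter> outside (tr F))"
    using assms(4) JD(2,5) by (simp_all add: open_Int)
  ultimately obtain w w' where "w \<in> V \<inter> inside (tr F)" "w \<notin> supp" "w' \<in> V \<inter> outside (tr F)" "w' \<notin> supp"
    using off_supp_dense by metis
  then show ?thesis using that by blast
qed

lemma awalk_replace:
  assumes "awalk m (a @ c @ b) n" "awalk y c y'" "awalk y d y'" "awalk m a y" "awalk y' b n"
  shows "awalk m (a @ d @ b) n"
  using assms awalk_appendI by blast

lemma wdiff_replace: "wdiff (a @ c @ b) (a @ d @ b) z = wdiff c d z"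
  by (simp add: wdiff_append)

text \<open>
  Crossing \<open>e\<close> leads from the inside to the outside of the lens that is formed by the ear at
  \<open>e\<close>. The remaining contributions come from a closed curve that avoids \<open>e\<close>, so they are
  constant near \<open>z\<close>.
\<close>

lemma wdiff_jump:
  assumes "awalk m p n" "awalk m x n" "e \<in> set x" "e \<notin> set p" "z \<in> open_arc E e" "open V" "z \<in> V"
  obtains w where "w \<in> V" "w \<notin> supp" "wdiff p x w \<noteq> 0"
proof -
  obtain p1 d p2 x1 c x2 y y' where h: "p = p1 @ d @ p2" "x = x1 @ c @ x2" "e \<in> set c"
    "lens y c d y'" "awalk m p1 y" "awalk m x1 y" "awalk y' p2 n" "awalk y' x2 n"
    by (rule ear[OF assms(1-4)])
  \<comment> \<open>\<open>x\<close> with the ear replaced by the part of \<open>p\<close> that it bridges\<close>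
  define xd where "xd = x1 @ d @ x2"
  have xd: "awalk m xd n"
    unfolding xd_def using awalk_replace[OF assms(2)[unfolded h(2)] lens_awalk[OF h(4)] h(6,8)] .
  have eG: "e \<in> arcs G" using assms(2,3) by blast
  have "distinct x" by (rule awalk_distinct[OF assms(2)])
  then have "e \<notin> set xd" using h(2,3,4) unfolding xd_def lens_def by auto
  then obtain U where U: "open U" "z \<in> U" "\<And>w w'. w \<in> U \<Longrightarrow> w' \<in> U \<Longrightarrow> wdiff p xd w = wdiff p xd w'"
    using locally_constant[OF assms(1) xd eG _ assms(5)] assms(4) by (metis UnE)
  note J = lens_jordan[OF h(4)]
  have "e \<in> set c \<union> set d" "open (U \<inter> V)" "z \<in> U \<inter> V" using h(3) U assms by auto
  then obtain w w' where w: "w \<in> U \<inter> V" "w \<in> inside (tr (set c \<union> set d))" "w \<notin> supp"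
    "w' \<in> U \<inter> V" "w' \<in> outside (tr (set c \<union> set d))" "w' \<notin> supp"
    using side_points[OF J _ assms(5)] by metis
  have eq: "wdiff p x v = wdiff p xd v + wdiff d c v" for v
    using wdiff_trans[of p xd v x] wdiff_replace[of x1 d x2 c v] unfolding xd_def h(2) by simp
  obtain \<epsilon> where eps: "\<epsilon> = 1 \<or> \<epsilon> = -1" "\<And>z. z \<in> inside (tr (set c \<union> set d)) \<Longrightarrow> wdiff c d z = \<epsilon>"
    using lens_wdiff_inside[OF h(4)] by metis
  have "wdiff d c w \<noteq> 0" using eps(1) eps(2)[OF w(2)] wdiff_sym[of d c w] by auto
  moreover have "wdiff d c w' = 0" using lens_wdiff_outside[OF h(4) w(5)] wdiff_sym[of d c w'] by simp
  moreover have "wdiff p xd w = wdiff p xd w'" using U(3) w by blast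
  ultimately have "wdiff p x w \<noteq> wdiff p x w'" using eq by simp
  then have "wdiff p x w \<noteq> 0 \<or> wdiff p x w' \<noteq> 0" by auto
  then show ?thesis using that w by blast
qed

text \<open>
  An arc of \<open>c\<close> that occurs later on \<open>x\<close> than its position in \<open>c\<close> would be preceded by a closed
  walk.
\<close>

lemma awalk_prefix_if_subset:
  assumes "awalk m c v" "awalk m x n" "set c \<subseteq> set x"
  obtains x2 where "x = c @ x2" "awalk v x2 n"
proof -
  have "\<exists>x2. x = c @ x2 \<and> awalk v x2 n" using assms
  proof (induction c arbitrary: m x)
    case Nil
    then show ?case by (auto simp: awalk_Nil_iff)
  next
    case (Cons g c)
    have g: "g \<in> arcs G" "tail G g = m" "awalk (head G g) c v"
      using Cons.prems by (auto simp: awalk_Cons_iff)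
    obtain a b where x: "x = a @ g # b" using Cons.prems(3) split_list[of g x] by auto
    then have a: "awalk m a m" and b: "awalk (head G g) b n"
      using Cons.prems(2) g by (auto simp: awalk_Cons_iff)
    have "a = []" by (rule acyclic_walk[OF a])
    have "g \<notin> set c" using awalk_distinct[OF Cons.prems(1)] by simp
    then have "set c \<subseteq> set b" using Cons.prems(3) x \<open>a = []\<close> by auto
    then obtain x2 where "b = c @ x2" "awalk v x2 n" using Cons.IH[OF g(3) b] by blast
    then show ?case using x \<open>a = []\<close> by auto
  qed
  then show ?thesis using that by blast
qed

lemma parallel_eq_if_subset:
  assumes "awalk m c v" "awalk m x v" "set c \<subseteq> set x"
  shows "x = c"
proof -
  obtain x2 where "x = c @ x2" "awalk v x2 v" by (rule awalk_prefix_if_subset[OF assms])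
  then show ?thesis using acyclic_walk by simp
qed

lemma awalk_segment_if_subset:
  assumes "awalk y c y'" "c \<noteq> []" "awalk m x n" "set c \<subseteq> set x"
  obtains x1 x2 where "x = x1 @ c @ x2" "awalk m x1 y" "awalk y' x2 n"
proof -
  obtain g c' where c: "c = g # c'" using assms(2) by (cases c) auto
  then have g: "g \<in> arcs G" "tail G g = y" "awalk (head G g) c' y'"
    using assms(1) by (auto simp: awalk_Cons_iff)
  obtain a b where x: "x = a @ g # b" using assms(4) split_list[of g x] c by auto
  then have a: "awalk m a y" and b: "awalk y (g # b) n"
    using assms(3) g by (auto simp: awalk_Cons_iff)
  have "set c \<inter> set a = {}"
  proof (rule ccontr)
    assume "set c \<inter> set a \<noteq> {}"
    then obtain h where h: "h \<in> set c" "h \<in> set a" by blast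
    obtain c1 c2 where c12: "c = c1 @ h # c2" using h(1) by (meson split_list)
    obtain a1 a2 where a12: "a = a1 @ h # a2" using h(2) by (meson split_list)
    have "awalk (head G h) a2 y" "h \<in> arcs G" using a a12 by (auto simp: awalk_Cons_iff)
    moreover have "awalk y (c1 @ [h]) (head G h)" using assms(1) c12 by (auto simp: awalk_Cons_iff awalk_Nil_iff)
    ultimately have "awalk y ((c1 @ [h]) @ a2) y" using awalk_appendI by blast
    then show False using acyclic_walk by blast
  qed
  then have "set c \<subseteq> set (g # b)" using assms(4) x by auto
  then obtain x2 where "g # b = c @ x2" "awalk y' x2 n" by (rule awalk_prefix_if_subset[OF assms(1) b])
  then show ?thesis using that[of a x2] x a by simp
qed

definition paths :: "'e list set" where "paths = {p. awalk s p t}"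

text \<open>The order of the nerve in terms of winding numbers, see \<open>path_le_le\<close> and \<open>rel_witness\<close>.\<close>

definition le :: "'e list \<Rightarrow> 'e list \<Rightarrow> bool" where
  "le p q \<longleftrightarrow> p \<in> paths \<and> q \<in> paths \<and> (\<forall>z. z \<notin> supp \<longrightarrow> wdiff p q z \<le> 0)"

lemma finite_paths: "finite paths"
proof -
  have "paths \<subseteq> {p. apath s p t}" unfolding paths_def using awalk_apath by blast
  then show ?thesis using apaths_finite finite_subset by blast
qed

lemma pathsD: "p \<in> paths \<Longrightarrow> awalk s p t"
  by (simp add: paths_def)

lemma leD: "le p q \<Longrightarrow> awalk s p t" "le p q \<Longrightarrow> awalk s q t" "le p q \<Longrightarrow> z \<notin> supp \<Longrightarrow> wdiff p q z \<le> 0"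
  unfolding le_def paths_def by auto

lemma le_paths: "le p q \<Longrightarrow> p \<in> paths" "le p q \<Longrightarrow> q \<in> paths"
  unfolding le_def by auto

lemma le_refl: "p \<in> paths \<Longrightarrow> le p p"
  unfolding le_def by simp

lemma le_trans: "le p q \<Longrightarrow> le q r \<Longrightarrow> le p r"
  unfolding le_def using wdiff_trans by (metis add_nonpos_nonpos)

lemma wdiff_nonzero_if_noteq:
  assumes "p \<in> paths" "q \<in> paths" "p \<noteq> q"
  obtains w where "w \<notin> supp" "wdiff p q w \<noteq> 0"
proof -
  note A = pathsD[OF assms(1)] pathsD[OF assms(2)]
  have "\<not> set q \<subseteq> set p" using parallel_eq_if_subset[OF A(2,1)] assms(3) by blast
  then obtain e where e: "e \<in> set q" "e \<notin> set p" by blast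
  obtain z where "z \<in> open_arc E e" using open_arc_ne by blast
  then show ?thesis using wdiff_jump[OF A e _ open_UNIV] that by blast
qed

lemma le_antisym:
  assumes "le p q" "le q p" shows "p = q"
proof (rule ccontr)
  assume "p \<noteq> q"
  then obtain w where w: "w \<notin> supp" "wdiff p q w \<noteq> 0"
    using wdiff_nonzero_if_noteq le_paths[OF assms(1)] by blast
  then show False using leD(3)[OF assms(1) w(1)] leD(3)[OF assms(2) w(1)] wdiff_sym[of p q w] by simp
qed

subsection \<open>Cells\<close>

text \<open>
  A lens around a single interior face of \<open>G\<close>, with the orientation for which replacing \<open>c\<close> by
  \<open>d\<close> in a path gives a larger path.
\<close>

definition cell :: "'v \<Rightarrow> 'e list \<Rightarrow> 'e list \<Rightarrow> 'v \<Rightarrow> bool" where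
  "cell y c d y' \<longleftrightarrow> lens y c d y' \<and> (\<forall>z\<in>inside (tr (set c \<union> set d)). wdiff c d z = -1) \<and>
     inside (tr (set c \<union> set d)) \<inter> supp = {}"

text \<open>
  The blocks before the first lens are common arcs. As the winding numbers of the two paths
  agree inside this lens with those of its two sides, the sign is determined.
\<close>

lemma first_lens:
  assumes "awalk m p n" "awalk m q n" "p \<noteq> q" "\<And>z. z \<notin> supp \<Longrightarrow> wdiff p q z \<le> 0"
  shows "\<exists>p1 c p2 d y y'. p = p1 @ c @ p2 \<and> awalk m p1 y \<and> awalk y' p2 n \<and> lens y c d y' \<and>
    (\<forall>z\<in>inside (tr (set c \<union> set d)). wdiff c d z = -1 \<and> wdiff p q z = -1)"
  using assms
proof (induction rule: parallel_induct)
  case (Nil m)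
  then show ?case by simp
next
  case (piece m c d y p q n)
  from piece(1) consider e where "e \<in> arcs G" "c = [e]" "d = [e]" "tail G e = m" "head G e = y" | "lens m c d y"
    unfolding piece_def by blast
  then show ?case
  proof cases
    case 1
    have eq: "wdiff (c @ p) (d @ q) z = wdiff p q z" for z unfolding 1(2,3) wdiff_append by simp
    have "p \<noteq> q" using piece.prems(1) 1 by simp
    then obtain p1 c' p2 d' y1 y' where h: "p = p1 @ c' @ p2" "awalk y p1 y1" "awalk y' p2 n" "lens y1 c' d' y'"
      "\<forall>z\<in>inside (tr (set c' \<union> set d')). wdiff c' d' z = -1 \<and> wdiff p q z = -1"
      using piece.IH[OF \<open>p \<noteq> q\<close> piece.prems(2)[unfolded eq]] by blast
    have "awalk m (c @ p1) y1" by (rule awalk_appendI[OF piece_awalk(1)[OF piece(1)] h(2)])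
    moreover have "c @ p = (c @ p1) @ c' @ p2" using h(1) by simp
    ultimately show ?thesis unfolding eq using h(3-5) by blast
  next
    case 2
    define X where "X = tr (set c \<union> set d)"
    define Y where "Y = support E (path_union y p q)"
    note F = piece_series_facts[OF piece(1-3), folded X_def Y_def]
    have aw: "awalk m (c @ p) n" "awalk m (d @ q) n"
      using awalk_appendI piece_awalk[OF piece(1)] piece(2,3) by blast+
    have "wdiff c d z = -1 \<and> wdiff (c @ p) (d @ q) z = -1" if z: "z \<in> inside X" for z
    proof -
      have zY: "z \<in> outside Y" using F(7) z by blast
      then have "z \<notin> X \<union> Y" using not_in_if_outside not_in_if_inside z by blast
      then have "z \<in> inside (X \<union> Y)" using inside_mono[of X "X \<union> Y"] z by blast
      then have "wdiff (c @ p) (d @ q) z = -1"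
        using wdiff_inside[OF aw piece.prems(2)] unfolding F(6) by blast
      moreover have "wdiff p q z = 0"
        using wdiff_outside_support[OF piece(2,3)] zY unfolding Y_def by blast
      ultimately show ?thesis by (simp add: wdiff_append)
    qed
    moreover have "awalk m [] m" using lens_awalk(1)[OF 2] by (auto simp: awalk_Nil_iff)
    ultimately show ?thesis using 2 piece(2) unfolding X_def
      by (intro exI[of _ "[]"] exI[of _ c] exI[of _ p] exI[of _ d] exI[of _ m] exI[of _ y]) auto
  qed
qed

text \<open>
  The arc \<open>f\<close> extends to a path \<open>x'\<close> from \<open>u\<close> to \<open>v\<close> in the disc. It differs from both sides of
  the lens. The ear at an arc \<open>e\<close> of \<open>c\<close> off \<open>x'\<close> bounds a smaller disc, since it misses an arc
  of \<open>d\<close>. Its sign is that of the given lens, because both curves contain \<open>e\<close> with the same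
  orientation.
\<close>

lemma shrink_lens:
  assumes lens: "lens u c d v" and sign: "\<forall>z\<in>inside (tr (set c \<union> set d)). wdiff c d z = -1"
    and f: "f \<in> arcs G" "open_arc E f \<subseteq> inside (tr (set c \<union> set d))"
  obtains c1 c' c2 x y y' where "c = c1 @ c' @ c2" "awalk u c1 y" "awalk y' c2 v" "lens y c' x y'"
    "\<forall>z\<in>inside (tr (set c' \<union> set x)). wdiff c' x z = -1"
    "inside (tr (set c' \<union> set x)) \<subseteq> inside (tr (set c \<union> set d))"
    "card (disc_arcs (set c' \<union> set x)) < card (disc_arcs (set c \<union> set d))"
proof -
  define F where "F = set c \<union> set d"
  have J: "jordan F" unfolding F_def by (rule lens_jordan[OF lens])
  note JD = jordanD[OF J]
  note A = lens_awalk[OF lens]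
  have fF: "f \<notin> F"
  proof
    assume "f \<in> F"
    then have "open_arc E f \<subseteq> tr F" using open_arc_in_trace[OF JD(11) f(1)] by blast
    then have "open_arc E f \<subseteq> inside (tr F) \<inter> tr F" using f(2) unfolding F_def by (rule_tac Int_greatest)
    then show False using open_arc_ne[of f] inside_no_overlap[of "tr F"] by simp
  qed
  have fd: "path_image (curve E f) \<subseteq> disc F" using arc_in_disc_iff[OF J f(1)] f(2) unfolding F_def by blast
  have fe: "pt (tail G f) \<in> disc F" "pt (head G f) \<in> disc F" using fd pt_ends_in_curve[OF f(1)] by blast+
  obtain y1 r1 where y1: "y1 \<in> ends F" "awalk y1 r1 (tail G f)" "tr (set r1) \<subseteq> disc F"
    by (rule disc_descent[OF J tail_in_verts[OF f(1)] fe(1)])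
  obtain y2 r2 where y2: "y2 \<in> ends F" "awalk (head G f) r2 y2" "tr (set r2) \<subseteq> disc F"
    by (rule disc_ascent[OF J head_in_verts[OF f(1)] fe(2)])
  have endsF: "ends F = verts (path_union u c d)" unfolding path_union_sel ends_lens[OF lens] F_def ..
  note src = path_union_source_target[OF A, unfolded sub_is_source[OF path_union_sub[OF A]]
      sub_is_target[OF path_union_sub[OF A]] endsF[symmetric] path_union_sel(2), folded F_def]
  obtain a0 where a0: "set a0 \<subseteq> F" "awalk u a0 y1" using src(1) y1(1) by metis
  obtain b0 where b0: "set b0 \<subseteq> F" "awalk y2 b0 v" using src(2) y2(1) by metis
  define x' where "x' = a0 @ r1 @ [f] @ r2 @ b0"
  have x': "awalk u x' v" unfolding x'_def
    by (intro awalk_appendI[OF a0(2)] awalk_appendI[OF y1(2)] awalk_appendI[OF arc_implies_awalk[OF f(1)]]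
        awalk_appendI[OF y2(2)] b0(2))
  have trF: "tr B \<subseteq> disc F" if "B \<subseteq> F" for B using trace_mono[OF that] disc_eq[of F] by blast
  have "tr (set x') = tr (set a0) \<union> tr (set r1) \<union> path_image (curve E f) \<union> tr (set r2) \<union> tr (set b0)"
    unfolding x'_def by (auto simp: trace_def)
  then have x'd: "tr (set x') \<subseteq> disc F" using trF[OF a0(1)] trF[OF b0(1)] y1(3) y2(3) fd by simp
  have fx': "f \<in> set x'" by (simp add: x'_def)
  have "\<not> set c \<subseteq> set x'" using parallel_eq_if_subset[OF A(1) x'] fx' fF unfolding F_def by blast
  then obtain e where e: "e \<in> set c" "e \<notin> set x'" by blast
  have "\<not> set d \<subseteq> set x'" using parallel_eq_if_subset[OF A(2) x'] fx' fF unfolding F_def by blast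
  then obtain g where g: "g \<in> set d" "g \<notin> set x'" by blast
  obtain a1 x a2 c1 c' c2 y y' where h: "x' = a1 @ x @ a2" "c = c1 @ c' @ c2" "e \<in> set c'"
    "lens y c' x y'" "awalk u a1 y" "awalk u c1 y" "awalk y' a2 v" "awalk y' c2 v"
    by (rule ear[OF x' A(1) e])
  define F' where "F' = set c' \<union> set x"
  have J': "jordan F'" unfolding F'_def by (rule lens_jordan[OF h(4)])
  have "tr F' \<subseteq> tr (set c) \<union> tr (set x')"
    unfolding F'_def trace_Un h(1,2) by (auto simp: trace_def)
  then have trF': "tr F' \<subseteq> disc F" using x'd trF[of "set c"] unfolding F_def by blast
  have "g \<in> F" "g \<notin> F'" using g h lens unfolding F_def F'_def lens_def by auto
  then have card: "card (disc_arcs F') < card (disc_arcs F)" by (rule card_disc_arcs_less[OF J J' trF'])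
  have ins: "inside (tr F') \<subseteq> inside (tr F)" by (rule inside_mono_disc[OF J J' trF'])
  \<comment> \<open>the two curves differ by the closed curve along \<open>k\<close> and \<open>d\<close>, which avoids \<open>e\<close>\<close>
  define k where "k = c1 @ x @ c2"
  have k: "awalk u k v" unfolding k_def
    using awalk_replace[OF A(1)[unfolded h(2)] lens_awalk[OF h(4)] h(6,8)] .
  have eG: "e \<in> arcs G" using e(1) A(1) by blast
  have ekd: "e \<notin> set k \<union> set d"
    using e h(1-3) awalk_distinct[OF A(1)] lens unfolding k_def lens_def by auto
  obtain z where z: "z \<in> open_arc E e" using open_arc_ne by blast
  obtain V where V: "open V" "z \<in> V" "\<And>w w'. w \<in> V \<Longrightarrow> w' \<in> V \<Longrightarrow> wdiff k d w = wdiff k d w'"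
    using locally_constant[OF k A(2) eG ekd z] by blast
  have "e \<in> F" "e \<in> F'" using e h(3) unfolding F_def F'_def by auto
  obtain w0 where w0: "w0 \<in> V" "w0 \<in> outside (tr F)" using side_points[OF J \<open>e \<in> F\<close> z V(1,2)] by metis
  obtain w1 where w1: "w1 \<in> V" "w1 \<in> inside (tr F')" using side_points[OF J' \<open>e \<in> F'\<close> z V(1,2)] by metis
  have eq: "wdiff c d w = wdiff c' x w + wdiff k d w" for w
    using wdiff_trans[of c k w d] wdiff_replace[of c1 c' c2 x w] unfolding k_def h(2) by simp
  have "w0 \<in> outside (tr F')" using disc_mono[OF J J' trF'] w0 by blast
  then have "wdiff k d w0 = 0"
    using eq[of w0] lens_wdiff_outside[OF lens, folded F_def, OF w0(2)] lens_wdiff_outside[OF h(4), folded F'_def]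
    by simp
  then have "wdiff k d w1 = 0" using V(3)[OF w0(1) w1(1)] by simp
  then have s1: "wdiff c' x w1 = -1" using eq[of w1] sign ins w1(2) unfolding F_def by auto
  obtain \<epsilon> where eps: "\<And>z. z \<in> inside (tr F') \<Longrightarrow> wdiff c' x z = \<epsilon>"
    using lens_wdiff_inside[OF h(4), folded F'_def] by metis
  have "\<forall>z\<in>inside (tr F'). wdiff c' x z = -1" using eps s1 w1(2) by metis
  then show ?thesis using that[OF h(2,6,8,4)] ins card unfolding F_def F'_def by blast
qed

lemma exists_cell:
  assumes "lens u c d v" "\<forall>z\<in>inside (tr (set c \<union> set d)). wdiff c d z = -1"
  shows "\<exists>c1 c' c2 x y y'. c = c1 @ c' @ c2 \<and> awalk u c1 y \<and> awalk y' c2 v \<and> cell y c' x y' \<and>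
    inside (tr (set c' \<union> set x)) \<subseteq> inside (tr (set c \<union> set d))"
  using assms
proof (induction "card (disc_arcs (set c \<union> set d))" arbitrary: u c d v rule: less_induct)
  case less
  note J = lens_jordan[OF less.prems(1)] and A = lens_awalk[OF less.prems(1)]
  show ?case
  proof (cases "\<exists>f\<in>arcs G. open_arc E f \<subseteq> inside (tr (set c \<union> set d))")
    case True
    then obtain f where f: "f \<in> arcs G" "open_arc E f \<subseteq> inside (tr (set c \<union> set d))" by blast
    obtain c1 c' c2 x y y' where h: "c = c1 @ c' @ c2" "awalk u c1 y" "awalk y' c2 v" "lens y c' x y'"
      "\<forall>z\<in>inside (tr (set c' \<union> set x)). wdiff c' x z = -1"
      "inside (tr (set c' \<union> set x)) \<subseteq> inside (tr (set c \<union> set d))"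
      "card (disc_arcs (set c' \<union> set x)) < card (disc_arcs (set c \<union> set d))"
      by (rule shrink_lens[OF less.prems f])
    obtain a1 c'' a2 x' w w' where k: "c' = a1 @ c'' @ a2" "awalk y a1 w" "awalk w' a2 y'" "cell w c'' x' w'"
      "inside (tr (set c'' \<union> set x')) \<subseteq> inside (tr (set c' \<union> set x))"
      using less.hyps[OF h(7,4,5)] by blast
    have "c = (c1 @ a1) @ c'' @ (a2 @ c2)" using h(1) k(1) by simp
    moreover have "awalk u (c1 @ a1) w" "awalk w' (a2 @ c2) v"
      using awalk_appendI h(2,3) k(2,3) by blast+
    moreover have "inside (tr (set c'' \<union> set x')) \<subseteq> inside (tr (set c \<union> set d))"
      by (rule order_trans[OF k(5) h(6)])
    ultimately show ?thesis using k(4)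
      by (intro exI[of _ "c1 @ a1"] exI[of _ c''] exI[of _ "a2 @ c2"] exI[of _ x'] exI[of _ w] exI[of _ w']) blast
  next
    case False
    have "awalk u [] u" "awalk v [] v" using A(1) by (auto simp: awalk_Nil_iff)
    moreover have "cell u c d v"
      unfolding cell_def using less.prems empty_disc_face(1)[OF J] False by blast
    ultimately show ?thesis
      by (intro exI[of _ "[]"] exI[of _ c] exI[of _ "[]"] exI[of _ d] exI[of _ u] exI[of _ v]) auto
  qed
qed

lemma cellD:
  assumes "cell y c d y'"
  shows "lens y c d y'" "awalk y c y'" "awalk y d y'" "jordan (set c \<union> set d)"
    "z \<in> inside (tr (set c \<union> set d)) \<Longrightarrow> wdiff c d z = -1"
    "z \<in> inside (tr (set c \<union> set d)) \<Longrightarrow> z \<notin> supp"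
    "z \<in> outside (tr (set c \<union> set d)) \<Longrightarrow> wdiff c d z = 0"
    "z \<notin> supp \<Longrightarrow> z \<in> inside (tr (set c \<union> set d)) \<or> z \<in> outside (tr (set c \<union> set d))"
proof -
  show L: "lens y c d y'" using assms by (simp add: cell_def)
  show "awalk y c y'" "awalk y d y'" "jordan (set c \<union> set d)"
    using lens_awalk[OF L] lens_jordan[OF L] by blast+
  show "z \<in> inside (tr (set c \<union> set d)) \<Longrightarrow> wdiff c d z = -1"
    "z \<in> inside (tr (set c \<union> set d)) \<Longrightarrow> z \<notin> supp"
    using assms unfolding cell_def by blast+
  show "z \<in> outside (tr (set c \<union> set d)) \<Longrightarrow> wdiff c d z = 0" using lens_wdiff_outside[OF L] .
  have "tr (set c \<union> set d) \<subseteq> supp" using trace_subset_supp jordanD(11)[OF lens_jordan[OF L]] by blast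
  then show "z \<notin> supp \<Longrightarrow> z \<in> inside (tr (set c \<union> set d)) \<or> z \<in> outside (tr (set c \<union> set d))"
    using inside_Un_outside[of "tr (set c \<union> set d)"] by blast
qed

lemma wdiff_const_cell:
  assumes "cell y c d y'" "awalk m p n" "awalk m q n"
    "z \<in> inside (tr (set c \<union> set d))" "w \<in> inside (tr (set c \<union> set d))"
  shows "wdiff p q z = wdiff p q w"
proof (rule wdiff_constant[OF assms(2,3) awalk_Nil_both[OF assms(2,3)] _ _ assms(4,5)])
  show "connected (inside (tr (set c \<union> set d)))" by (rule jordanD(3)[OF cellD(4)[OF assms(1)]])
  have "tr (set p \<union> set q) \<subseteq> supp" by (rule trace_subset_supp) (use assms(2,3) in blast)
  then show "inside (tr (set c \<union> set d)) \<inter> tr (set p \<union> set q) = {}"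
    using assms(1) unfolding cell_def by blast
qed

text \<open>Inside the first lens between \<open>p\<close> and \<open>q\<close> there is a cell along \<open>p\<close>, by \<open>exists_cell\<close>.\<close>

lemma exists_flip:
  assumes "le p q" "p \<noteq> q"
  obtains p1 c p2 d y y' where "p = p1 @ c @ p2" "awalk s p1 y" "awalk y' p2 t" "cell y c d y'"
    "le (p1 @ d @ p2) q"
proof -
  obtain a1 c0 a2 d0 u v where h: "p = a1 @ c0 @ a2" "awalk s a1 u" "awalk v a2 t" "lens u c0 d0 v"
    "\<forall>z\<in>inside (tr (set c0 \<union> set d0)). wdiff c0 d0 z = -1 \<and> wdiff p q z = -1"
    using first_lens[OF leD(1,2)[OF assms(1)] assms(2) leD(3)[OF assms(1)]] by blast
  obtain c1 c c2 d y y' where k: "c0 = c1 @ c @ c2" "awalk u c1 y" "awalk y' c2 v" "cell y c d y'"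
    "inside (tr (set c \<union> set d)) \<subseteq> inside (tr (set c0 \<union> set d0))"
    using exists_cell[OF h(4)] h(5) by blast
  define p1 p2 where "p1 = a1 @ c1" and "p2 = c2 @ a2"
  have p: "p = p1 @ c @ p2" unfolding p1_def p2_def h(1) k(1) by simp
  have w: "awalk s p1 y" "awalk y' p2 t"
    unfolding p1_def p2_def using awalk_appendI h(2,3) k(2,3) by blast+
  let ?a = "p1 @ d @ p2"
  have a: "awalk s ?a t" using w cellD(3)[OF k(4)] awalk_appendI by blast
  have "wdiff ?a q z \<le> 0" if z: "z \<notin> supp" for z
  proof -
    have eq: "wdiff ?a q z = wdiff p q z - wdiff c d z"
      using wdiff_trans[of p ?a z q] wdiff_replace[of p1 c p2 d z] unfolding p by simp
    from cellD(8)[OF k(4) z] show ?thesis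
    proof
      assume zi: "z \<in> inside (tr (set c \<union> set d))"
      then show ?thesis using eq cellD(5)[OF k(4) zi] h(5) k(5) by auto
    next
      assume "z \<in> outside (tr (set c \<union> set d))"
      then show ?thesis using eq cellD(7)[OF k(4)] leD(3)[OF assms(1) z] by simp
    qed
  qed
  then have "le ?a q" unfolding le_def paths_def using a leD(2)[OF assms(1)] by blast
  then show ?thesis using that[OF p w k(4)] by blast
qed

text \<open>
  If \<open>x\<close> missed an arc of \<open>c\<close>, then across this arc \<open>wdiff (p1 @ c @ p2) x\<close> would jump like
  \<open>wdiff c d\<close>, from \<open>0\<close> in the cell to \<open>1\<close> on the other side.
\<close>

lemma cell_source_subset:
  assumes c: "cell y c d y'" and p: "awalk s p1 y" "awalk y' p2 t"
    and x: "le (p1 @ c @ p2) x" "z \<in> inside (tr (set c \<union> set d))" "wdiff (p1 @ c @ p2) x z = 0"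
  shows "set c \<subseteq> set x"
proof (rule ccontr)
  assume "\<not> set c \<subseteq> set x"
  then obtain e where e: "e \<in> set c" "e \<notin> set x" by blast
  let ?p = "p1 @ c @ p2" and ?a = "p1 @ d @ p2"
  note xw = leD(2)[OF x(1)] and pw = leD(1)[OF x(1)]
  have a: "awalk s ?a t" using p cellD(3)[OF c] awalk_appendI by blast
  have eG: "e \<in> arcs G" using e(1) cellD(2)[OF c] by blast
  have "e \<notin> set ?a \<union> set x"
    using e awalk_distinct[OF pw] cellD(1)[OF c] unfolding lens_def by auto
  moreover obtain z0 where z0: "z0 \<in> open_arc E e" using open_arc_ne by blast
  ultimately obtain V where V: "open V" "z0 \<in> V" "\<And>w w'. w \<in> V \<Longrightarrow> w' \<in> V \<Longrightarrow> wdiff ?a x w = wdiff ?a x w'"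
    using locally_constant[OF a xw eG] by metis
  have "e \<in> set c \<union> set d" using e by simp
  then obtain w w' where w: "w \<in> V" "w \<in> inside (tr (set c \<union> set d))" "w \<notin> supp"
    "w' \<in> V" "w' \<in> outside (tr (set c \<union> set d))" "w' \<notin> supp"
    using side_points[OF cellD(4)[OF c] _ z0 V(1,2)] by metis
  have eq: "wdiff ?p x v = wdiff c d v + wdiff ?a x v" for v
    using wdiff_trans[of ?p ?a v x] wdiff_replace[of p1 c p2 d v] by simp
  have "wdiff ?p x w = 0" using wdiff_const_cell[OF c pw xw x(2) w(2)] x(3) by simp
  then have "wdiff ?a x w = 1" using eq[of w] cellD(5)[OF c w(2)] by simp
  then have "wdiff ?p x w' = 1" using eq[of w'] V(3)[OF w(1,4)] cellD(7)[OF c w(5)] by simp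
  then show False using leD(3)[OF x(1) w(6)] by simp
qed

text \<open>The dual of \<open>cell_source_subset\<close>, for the arcs of \<open>d\<close>.\<close>

lemma cell_target_subset:
  assumes c: "cell y c d y'" and p: "awalk s p1 y" "awalk y' p2 t"
    and x: "le x (p1 @ d @ p2)" "z \<in> inside (tr (set c \<union> set d))" "wdiff x (p1 @ d @ p2) z = 0"
  shows "set d \<subseteq> set x"
proof (rule ccontr)
  assume "\<not> set d \<subseteq> set x"
  then obtain e where e: "e \<in> set d" "e \<notin> set x" by blast
  let ?p = "p1 @ c @ p2" and ?a = "p1 @ d @ p2"
  note xw = leD(1)[OF x(1)] and aw = leD(2)[OF x(1)]
  have pw: "awalk s ?p t" using p cellD(2)[OF c] awalk_appendI by blast
  have eG: "e \<in> arcs G" using e(1) cellD(3)[OF c] by blast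
  have "e \<notin> set x \<union> set ?p"
    using e awalk_distinct[OF aw] cellD(1)[OF c] unfolding lens_def by auto
  moreover obtain z0 where z0: "z0 \<in> open_arc E e" using open_arc_ne by blast
  ultimately obtain V where V: "open V" "z0 \<in> V" "\<And>w w'. w \<in> V \<Longrightarrow> w' \<in> V \<Longrightarrow> wdiff x ?p w = wdiff x ?p w'"
    using locally_constant[OF xw pw eG] by metis
  have "e \<in> set c \<union> set d" using e by simp
  then obtain w w' where w: "w \<in> V" "w \<in> inside (tr (set c \<union> set d))" "w \<notin> supp"
    "w' \<in> V" "w' \<in> outside (tr (set c \<union> set d))" "w' \<notin> supp"
    using side_points[OF cellD(4)[OF c] _ z0 V(1,2)] by metis
  have eq: "wdiff x ?a v = wdiff x ?p v + wdiff c d v" for v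
    using wdiff_trans[of x ?p v ?a] wdiff_replace[of p1 c p2 d v] by simp
  have "wdiff x ?a w = 0" using wdiff_const_cell[OF c xw aw x(2) w(2)] x(3) by simp
  then have "wdiff x ?p w = 1" using eq[of w] cellD(5)[OF c w(2)] by simp
  then have "wdiff x ?a w' = 1" using eq[of w'] V(3)[OF w(1,4)] cellD(7)[OF c w(5)] by simp
  then show False using leD(3)[OF x(1) w(6)] by simp
qed

end

section \<open>Paths related through a pasting diagram\<close>

locale pasting_digraph = globular_digraph G E s t
  for G :: "('v, 'e) pre_digraph" and E and s t :: 'v +
  fixes S :: "('v, 'e) pre_digraph set"
  assumes complete: "complete_pasting_diagram E G S"
    and has_faces: "contains_interior_faces E G S"
    and subdivisions: "closed_under_subdivisions E G S"
begin

lemma in_S: 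
  assumes "H \<in> S" shows "subgraph H G" "globular E H"
  using complete assms unfolding complete_pasting_diagram_def pasting_diagram_def globular_subgraph_def
  by blast+

lemma path_in_S: "awalk u p v \<Longrightarrow> path_graph G u p \<in> S"
  using complete awalk_apath unfolding complete_pasting_diagram_def pasting_diagram_def by blast

lemma sub_in_S:
  assumes "H \<in> S" "subgraph K H" "globular E K" shows "K \<in> S"
  using complete assms unfolding complete_pasting_diagram_def pasting_diagram_def globular_subgraph_def
  by blast

lemma join_in_S:
  assumes "H \<in> S" "K \<in> S" "is_target H y" "is_source K y"
  shows "Digraph_Component.union H K \<in> S"
proof -
  have "target_of H = source_of K"
    using sub_target_of(1)[OF in_S(1)[OF assms(1)] assms(3)] sub_source_of(1)[OF in_S(1)[OF assms(2)] assms(4)]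
    by simp
  then show ?thesis using complete assms(1,2) unfolding complete_pasting_diagram_def by blast
qed

lemma join_source_target:
  assumes H: "subgraph H G" "is_source H m" "is_target H y" and K: "subgraph K G" "is_source K y" "is_target K n"
  shows "is_source (Digraph_Component.union H K) m" "is_target (Digraph_Component.union H K) n"
proof -
  note U = union_sub[OF H(1) K(1)]
  have sel: "verts (Digraph_Component.union H K) = verts H \<union> verts K"
    "arcs (Digraph_Component.union H K) = arcs H \<union> arcs K" by (simp_all add: Digraph_Component.union_def)
  note hs = H(2)[unfolded sub_is_source[OF H(1)]] and ht = H(3)[unfolded sub_is_target[OF H(1)]]
    and ks = K(2)[unfolded sub_is_source[OF K(1)]] and kt = K(3)[unfolded sub_is_target[OF K(1)]]
  show "is_source (Digraph_Component.union H K) m"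
    unfolding sub_is_source[OF U] sel
  proof (intro conjI ballI)
    show "m \<in> verts H \<union> verts K" using hs by blast
    fix v assume "v \<in> verts H \<union> verts K"
    then show "\<exists>p. set p \<subseteq> arcs H \<union> arcs K \<and> awalk m p v"
    proof
      assume "v \<in> verts H" then show ?thesis using hs by blast
    next
      assume "v \<in> verts K"
      then obtain b where b: "set b \<subseteq> arcs K" "awalk y b v" using ks by blast
      obtain a where a: "set a \<subseteq> arcs H" "awalk m a y" using hs ht by blast
      have "awalk m (a @ b) v" by (rule awalk_appendI[OF a(2) b(2)])
      moreover have "set (a @ b) \<subseteq> arcs H \<union> arcs K" using a(1) b(1) by auto
      ultimately show ?thesis by blast
    qed
  qed
  show "is_target (Digraph_Component.union H K) n"
    unfolding sub_is_target[OF U] sel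
  proof (intro conjI ballI)
    show "n \<in> verts H \<union> verts K" using kt by blast
    fix v assume "v \<in> verts H \<union> verts K"
    then show "\<exists>p. set p \<subseteq> arcs H \<union> arcs K \<and> awalk v p n"
    proof
      assume "v \<in> verts K" then show ?thesis using kt by blast
    next
      assume "v \<in> verts H"
      then obtain a where a: "set a \<subseteq> arcs H" "awalk v a y" using ht by blast
      obtain b where b: "set b \<subseteq> arcs K" "awalk y b n" using ks kt by blast
      have "awalk v (a @ b) n" by (rule awalk_appendI[OF a(2) b(2)])
      moreover have "set (a @ b) \<subseteq> arcs H \<union> arcs K" using a(1) b(1) by auto
      ultimately show ?thesis by blast
    qed
  qed
qed

lemma sub_sub:
  assumes "subgraph K G" "subgraph H G" "verts K \<subseteq> verts H" "arcs K \<subseteq> arcs H"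
  shows "subgraph K H"
  using assms unfolding subgraph_def compatible_def by simp

lemma lens_orient:
  assumes "lens u c d v"
  obtains c' d' where "lens u c' d' v" "{c', d'} = {c, d}" "set c' \<union> set d' = set c \<union> set d"
    "\<And>z. z \<in> inside (tr (set c \<union> set d)) \<Longrightarrow> wdiff c' d' z = -1"
proof -
  obtain \<epsilon> where eps: "\<epsilon> = 1 \<or> \<epsilon> = -1" "\<And>z. z \<in> inside (tr (set c \<union> set d)) \<Longrightarrow> wdiff c d z = \<epsilon>"
    using lens_wdiff_inside[OF assms] by metis
  show ?thesis
  proof (cases "\<epsilon> = -1")
    case True
    then show ?thesis using that[OF assms _ refl] eps by blast
  next
    case False
    then have "wdiff d c z = -1" if "z \<in> inside (tr (set c \<union> set d))" for z
      using eps(1) eps(2)[OF that] wdiff_sym[of d c z] by simp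
    then show ?thesis using that[OF lens_sym[OF assms]] by blast
  qed
qed

text \<open>
  The two sides form a globular subgraph of \<open>A\<close>, and the graph in the disc is a subdivision of
  it.
\<close>

lemma lens_in_S:
  assumes lens: "lens u c d v" and A: "A \<in> S" "set c \<union> set d \<subseteq> arcs A"
  shows "path_union u c d \<in> S" "disc_graph (set c \<union> set d) \<in> S"
    "is_source (disc_graph (set c \<union> set d)) u" "is_target (disc_graph (set c \<union> set d)) v"
proof -
  let ?K = "path_union u c d" and ?F = "set c \<union> set d"
  note W = lens_awalk[OF lens]
  note K = path_union_sub[OF W]
  have sel: "verts ?K = ends ?F" "arcs ?K = ?F" unfolding path_union_sel ends_lens[OF lens] by auto
  obtain c' d' where cd: "lens u c' d' v" "{c', d'} = {c, d}" "set c' \<union> set d' = ?F"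
    "\<And>z. z \<in> inside (tr ?F) \<Longrightarrow> wdiff c' d' z = -1" by (rule lens_orient[OF lens]) blast
  note KG = lens_cycle_globular[OF cd(1) cd(3)[symmetric] K sel cd(4)]
  note DG = lens_disc_globular[OF cd(1) cd(3)[symmetric] cd(4)]
  note AG = in_S(1)[OF A(1)]
  have "y \<in> verts A" if "y \<in> ends ?F" for y
    using that A(2) sub_arc_verts(1,2)[OF AG] by auto
  then have "verts ?K \<subseteq> verts A" unfolding sel by (rule_tac subsetI)
  then have "subgraph ?K A" using sub_sub[OF K AG] A(2) unfolding sel by blast
  then show KS: "?K \<in> S" using sub_in_S[OF A(1)] KG(1) by blast
  have J: "jordan ?F" by (rule lens_jordan[OF lens])
  note D = disc_graph_sub[of ?F]
  have "?F \<subseteq> disc_arcs ?F" using arc_in_disc_iff[OF J] jordanD(11)[OF J] unfolding disc_arcs_def by blast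
  moreover have "y \<in> verts (disc_graph ?F)" if "y \<in> ends ?F" for y
  proof -
    have "pt y \<in> disc ?F" using pt_ends_trace[OF jordanD(11)[OF J] that] disc_eq[of ?F] by blast
    moreover have "y \<in> verts G" using ends_verts[OF jordanD(11)[OF J]] that by (rule subsetD)
    ultimately show ?thesis by (simp add: disc_graph_sel)
  qed
  ultimately have "subgraph ?K (disc_graph ?F)"
    using sub_sub[OF K D] unfolding sel disc_graph_sel(2) by (simp add: subset_iff)
  moreover have "same_boundary E ?K (disc_graph ?F)"
    unfolding same_boundary_def using KG DG by metis
  ultimately have "subdivision_of E G (disc_graph ?F) ?K"
    unfolding subdivision_of_def globular_subgraph_def using K D KG(1) DG(1) by blast
  then show "disc_graph ?F \<in> S" using subdivisions KS unfolding closed_under_subdivisions_def by blast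
  have gl: "is_source (disc_graph ?F) (source_of (disc_graph ?F)) \<and> is_target (disc_graph ?F) (target_of (disc_graph ?F))"
  proof -
    have "\<not> trivial_graph (disc_graph ?F)"
      using \<open>?F \<subseteq> disc_arcs ?F\<close> lens_ne(1)[OF lens] unfolding trivial_graph_def disc_graph_sel by auto
    then have "st_graph E (disc_graph ?F)" using DG(1) unfolding globular_def by blast
    then show ?thesis unfolding st_graph_def source_of_def target_of_def by (metis theI')
  qed
  then show "is_source (disc_graph ?F) u" "is_target (disc_graph ?F) v" using DG(2,3) by simp_all
qed

lemma path_graph_source_target:
  assumes "awalk u p v"
  shows "is_source (path_graph G u p) u" "is_target (path_graph G u p) v"
proof -
  have eq: "path_union u p p = path_graph G u p" by (simp add: Digraph_Component.union_def path_graph_def)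
  show "is_source (path_graph G u p) u" "is_target (path_graph G u p) v"
    using path_union_source_target[OF assms assms] unfolding eq .
qed

text \<open>
  Both claims follow block by block. The graph \<open>B\<close> is the join of the common arcs and of the
  graphs in the discs of the lenses.
\<close>

lemma parallel_in_S_aux:
  assumes "awalk m p n" "awalk m q n"
    and A: "A \<in> S" "(set p - set q) \<union> (set q - set p) \<subseteq> arcs A"
  shows "path_union m p q \<in> S \<and>
    (\<exists>B\<in>S. is_source B m \<and> is_target B n \<and> set p \<union> set q \<subseteq> arcs B \<and>
       (\<forall>f\<in>arcs G. open_arc E f \<inter> inside (support E (path_union m p q)) \<noteq> {} \<longrightarrow> f \<in> arcs B))"
  using assms(1,2,4)
proof (induction rule: parallel_induct)
  case (Nil m)
  have aw: "awalk m [] m" using Nil by (simp add: awalk_Nil_iff)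
  have eq: "path_union m [] [] = path_graph G m []" by (simp add: Digraph_Component.union_def path_graph_def)
  have "support E (path_union m [] []) = {pt m}" unfolding support_def path_union_sel by simp
  then have ins: "inside (support E (path_union m [] [])) = {}" using inside_convex[of "{pt m}"] by simp
  have "path_graph G m [] \<in> S" by (rule path_in_S[OF aw])
  then show ?case unfolding ins unfolding eq using path_graph_source_target[OF aw]
    by (intro conjI bexI[of _ "path_graph G m []"]) simp_all
next
  case (piece m c d y p q n)
  note PA = piece_awalk[OF piece(1)]
  define X where "X = tr (set c \<union> set d)"
  define Y where "Y = support E (path_union y p q)"
  note F = piece_series_facts[OF piece(1-3), folded X_def Y_def]
  have dis: "set c \<inter> set p = {}" "set c \<inter> set q = {}" "set d \<inter> set p = {}" "set d \<inter> set q = {}"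
    using awalk_distinct[OF awalk_appendI] PA piece(2,3) by auto
  have sub: "(set p - set q) \<union> (set q - set p) \<subseteq> arcs A"
  proof -
    have "(set p - set q) \<union> (set q - set p) \<subseteq>
        (set (c @ p) - set (d @ q)) \<union> (set (d @ q) - set (c @ p))" using dis by auto
    then show ?thesis using piece.prems by (rule order_trans)
  qed
  obtain B where U: "path_union y p q \<in> S" and B: "B \<in> S" "is_source B y" "is_target B n" "set p \<union> set q \<subseteq> arcs B"
    "\<And>f. f \<in> arcs G \<Longrightarrow> open_arc E f \<inter> inside Y \<noteq> {} \<Longrightarrow> f \<in> arcs B"
    using piece.IH[OF sub] unfolding Y_def by blast
  have "path_union m c d \<in> S \<and> (\<exists>C\<in>S. is_source C m \<and> is_target C y \<and> set c \<union> set d \<subseteq> arcs C \<and>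
      (\<forall>f\<in>arcs G. open_arc E f \<inter> inside X \<noteq> {} \<longrightarrow> f \<in> arcs C))"
    using piece(1) unfolding piece_def
  proof
    assume "\<exists>e\<in>arcs G. c = [e] \<and> d = [e] \<and> tail G e = m \<and> head G e = y"
    then obtain e where e: "e \<in> arcs G" "c = [e]" "d = [e]" by blast
    have "inside (tr {e}) = {}" using inside_arc_empty[OF arc_curve[OF e(1)]] by (simp add: trace_insert)
    then have ins: "inside X = {}" using e by (simp add: X_def)
    have eq: "path_union m c d = path_graph G m c"
      using e by (simp add: Digraph_Component.union_def path_graph_def)
    have "arcs (path_graph G m c) = set c \<union> set d" using e by (simp add: path_graph_def)
    then show ?thesis
      unfolding eq ins using path_in_S[OF PA(1)] path_graph_source_target[OF PA(1)]
      by (intro conjI bexI[of _ "path_graph G m c"]) simp_all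
  next
    assume lens: "lens m c d y"
    have cA: "set c \<union> set d \<subseteq> arcs A" using piece.prems dis lens unfolding lens_def by auto
    note L = lens_in_S[OF lens A(1) cA]
    have J: "jordan (set c \<union> set d)" by (rule lens_jordan[OF lens])
    have "f \<in> disc_arcs (set c \<union> set d)" if f: "f \<in> arcs G" "open_arc E f \<inter> inside X \<noteq> {}" for f
    proof -
      have "f \<notin> set c \<union> set d"
      proof
        assume "f \<in> set c \<union> set d"
        then have "open_arc E f \<subseteq> X" using open_arc_in_trace[OF jordanD(11)[OF J] f(1)] unfolding X_def by blast
        then show False using f(2) not_in_if_inside by blast
      qed
      then have "open_arc E f \<subseteq> inside X"
        using arc_side[OF J f(1)] f(2) not_inside_if_outside unfolding X_def by blast
      then show ?thesis using arc_in_disc_iff[OF J f(1)] f(1) unfolding X_def disc_arcs_def by simp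
    qed
    moreover have "set c \<union> set d \<subseteq> disc_arcs (set c \<union> set d)"
      using arc_in_disc_iff[OF J] jordanD(11)[OF J] unfolding disc_arcs_def by blast
    ultimately show ?thesis using L by (intro conjI L(1) bexI[OF _ L(2)]) (simp_all add: disc_graph_sel(2))
  qed
  then obtain C where K: "path_union m c d \<in> S" and C: "C \<in> S" "is_source C m" "is_target C y" "set c \<union> set d \<subseteq> arcs C"
    "\<And>f. f \<in> arcs G \<Longrightarrow> open_arc E f \<inter> inside X \<noteq> {} \<Longrightarrow> f \<in> arcs C" by blast
  have "path_union m (c @ p) (d @ q) \<in> S"
    unfolding path_union_append[OF PA piece(2,3)]
    by (rule join_in_S[OF K U path_union_source_target(2)[OF PA] path_union_source_target(1)[OF piece(2,3)]])
  moreover have "Digraph_Component.union C B \<in> S" by (rule join_in_S[OF C(1) B(1) C(3) B(2)])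
  moreover have "is_source (Digraph_Component.union C B) m" "is_target (Digraph_Component.union C B) n"
    by (rule join_source_target[OF in_S(1)[OF C(1)] C(2,3) in_S(1)[OF B(1)] B(2,3)])+
  moreover have arcs: "arcs (Digraph_Component.union C B) = arcs C \<union> arcs B" by (simp add: Digraph_Component.union_def)
  moreover have "f \<in> arcs C \<union> arcs B" if f: "f \<in> arcs G" "open_arc E f \<inter> inside (X \<union> Y) \<noteq> {}" for f
  proof -
    obtain z where z: "z \<in> open_arc E f" "z \<in> inside (X \<union> Y)" using f(2) by blast
    have "z \<in> inside X \<or> z \<in> inside Y"
    proof (rule ccontr)
      assume "\<not> (z \<in> inside X \<or> z \<in> inside Y)"
      moreover have "z \<notin> X" "z \<notin> Y" using not_in_if_inside[OF z(2)] by auto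
      ultimately have "z \<in> outside X" "z \<in> outside Y" using inside_Un_outside[of X] inside_Un_outside[of Y] by blast+
      then show False using F(5) z(2) not_inside_if_outside by blast
    qed
    then show ?thesis using C(5)[OF f(1)] B(5)[OF f(1)] z(1) by blast
  qed
  ultimately show ?case unfolding F(6) using C(4) B(4)
    by (intro conjI bexI[of _ "Digraph_Component.union C B"]) auto
qed

lemma parallel_in_S:
  assumes "awalk m p n" "awalk m q n" "A \<in> S" "(set p - set q) \<union> (set q - set p) \<subseteq> arcs A"
  shows "path_union m p q \<in> S"
  using parallel_in_S_aux[OF assms] by blast

lemma parallel_filling_in_S:
  assumes "awalk m p n" "awalk m q n" "A \<in> S" "(set p - set q) \<union> (set q - set p) \<subseteq> arcs A"
  obtains B where "B \<in> S" "is_source B m" "set p \<union> set q \<subseteq> arcs B"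
    "\<And>f. f \<in> arcs G \<Longrightarrow> open_arc E f \<inter> inside (support E (path_union m p q)) \<noteq> {} \<Longrightarrow> f \<in> arcs B"
  using parallel_in_S_aux[OF assms] by blast

text \<open>
  The relation by which \<open>S\<close> determines its nerve, see \<open>diagram_nerve_eq\<close>. The arcs common to
  both paths are left out because paths are members of \<open>S\<close> anyway and can be supplied by joins.
\<close>

definition rel :: "'e list \<Rightarrow> 'e list \<Rightarrow> bool" where
  "rel p q \<longleftrightarrow> le p q \<and> (\<exists>A\<in>S. (set p - set q) \<union> (set q - set p) \<subseteq> arcs A)"

lemma rel_le: "rel p q \<Longrightarrow> le p q" by (simp add: rel_def)

lemma rel_refl: "p \<in> paths \<Longrightarrow> rel p p"
  unfolding rel_def using le_refl path_in_S pathsD by blast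

text \<open>
  Suppose that an arc of \<open>x\<close> is missing from \<open>B\<close>. Then it runs outside the union of \<open>p\<close> and \<open>q\<close>,
  where \<open>wdiff p q\<close> vanishes. So \<open>wdiff p x\<close> and \<open>wdiff x q\<close>, both of which are at most \<open>0\<close>,
  vanish near the arc as well, although \<open>wdiff p x\<close> jumps there.
\<close>

lemma between_in_filling:
  assumes pq: "awalk s p t" "awalk s q t"
    and B: "set p \<union> set q \<subseteq> arcs B"
      "\<And>f. f \<in> arcs G \<Longrightarrow> open_arc E f \<inter> inside (support E (path_union s p q)) \<noteq> {} \<Longrightarrow> f \<in> arcs B"
    and x: "le p x" "le x q"
  shows "set x \<subseteq> arcs B"
proof
  fix e assume e: "e \<in> set x"
  note xw = leD(2)[OF x(1)]
  have eG: "e \<in> arcs G" using e xw by blast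
  let ?Y = "support E (path_union s p q)"
  show "e \<in> arcs B"
  proof (rule ccontr)
    assume nB: "e \<notin> arcs B"
    then have epq: "e \<notin> set p" "e \<notin> set q" using B(1) by auto
    obtain z where z: "z \<in> open_arc E e" using open_arc_ne by blast
    have "z \<notin> ?Y" using open_arc_in_support_sub[OF path_union_sub[OF pq] eG z] epq
      by (simp only: path_union_sel(2) Un_iff simp_thms)
    moreover have "z \<notin> inside ?Y" using B(2)[OF eG] nB z by blast
    ultimately have zo: "z \<in> outside ?Y" using inside_Un_outside[of ?Y] by blast
    have "open (outside ?Y)"
      by (rule open_outside[OF compact_imp_closed[OF compact_support_sub[OF path_union_sub[OF pq]]]])
    then obtain w where w: "w \<in> outside ?Y" "w \<notin> supp" "wdiff p x w \<noteq> 0"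
      using wdiff_jump[OF pq(1) xw e epq(1) z _ zo] by blast
    have "wdiff p q w = 0" by (rule wdiff_outside_support[OF pq w(1)])
    then show False using wdiff_trans[of p x w q] leD(3)[OF x(1) w(2)] leD(3)[OF x(2) w(2)] w(3) by simp
  qed
qed

lemma rel_subinterval:
  assumes "rel p q" "le p p'" "le p' q'" "le q' q"
  shows "rel p' q'"
proof -
  obtain A where A: "A \<in> S" "(set p - set q) \<union> (set q - set p) \<subseteq> arcs A" using assms(1) unfolding rel_def by blast
  note pq = leD(1,2)[OF rel_le[OF assms(1)]]
  obtain B where B: "B \<in> S" "set p \<union> set q \<subseteq> arcs B"
    "\<And>f. f \<in> arcs G \<Longrightarrow> open_arc E f \<inter> inside (support E (path_union s p q)) \<noteq> {} \<Longrightarrow> f \<in> arcs B"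
    using parallel_filling_in_S[OF pq A] by metis
  have "set p' \<subseteq> arcs B" "set q' \<subseteq> arcs B"
    using between_in_filling[OF pq B(2,3)] assms le_trans by blast+
  then show ?thesis unfolding rel_def using B(1) assms(3) by blast
qed

lemma cell_in_S:
  assumes "cell y c d y'"
  shows "path_union y c d \<in> S"
proof -
  note L = cellD(1)[OF assms] and W = cellD(2,3)[OF assms] and J = cellD(4)[OF assms]
  note N = lens_ne[OF L]
  let ?F = "set c \<union> set d"
  let ?\<phi> = "inside (tr ?F)"
  note JD = jordanD[OF J]
  have trs: "tr ?F \<subseteq> supp" by (rule trace_subset_supp[OF JD(11)])
  have face: "?\<phi> \<in> faces E G"
    unfolding faces_def by (rule component_if_frontier_disjoint)
      (use JD trs assms in \<open>auto simp: cell_def\<close>)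
  have "\<not> bounded (outside supp)"
    by (rule unbounded_outside[OF compact_imp_bounded[OF compact_supp]])
  then have ne: "?\<phi> \<noteq> exterior_face E G" using JD(7) unfolding exterior_face_def by metis
  have "winding_number (loop_of c d) z = winding_number (loop_of c d) w - 1"
    if z: "z \<in> ?\<phi>" and w: "w \<in> - (supp \<union> ?\<phi>)" for z w
  proof -
    have wo: "w \<in> outside (tr ?F)" using w cellD(8)[OF assms, of w] by blast
    show ?thesis
      using winding_loop[OF W N not_in_if_inside[OF z]] winding_loop[OF W N not_in_if_outside[OF wo]]
        cellD(5)[OF assms z] cellD(7)[OF assms wo] by simp
  qed
  then have "clockwise_boundary E G ?\<phi> c d"
    unfolding clockwise_boundary_def Let_def
    using N awalk_apath[OF W(1)] awalk_apath[OF W(2)] loop_props(3)[OF W N] JD(9) by auto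
  then have "face_dom_cod E G ?\<phi> c d" unfolding face_dom_cod_def using face ne by simp
  then have "path_union y c d \<in> face_graphs E G ?\<phi>"
    unfolding face_graphs_def using awalk_apath[OF W(1)] awalk_apath[OF W(2)] by blast
  then show ?thesis using has_faces face ne unfolding contains_interior_faces_def interior_faces_def by blast
qed

lemma rel_cell:
  assumes "cell y c d y'" "le (p1 @ c @ p2) (p1 @ d @ p2)"
  shows "rel (p1 @ c @ p2) (p1 @ d @ p2)"
proof -
  have "arcs (path_union y c d) = set c \<union> set d" by (rule path_union_sel(2))
  then have "(set (p1 @ c @ p2) - set (p1 @ d @ p2)) \<union> (set (p1 @ d @ p2) - set (p1 @ c @ p2))
      \<subseteq> arcs (path_union y c d)" by auto
  then show ?thesis unfolding rel_def using cell_in_S[OF assms(1)] assms(2) by blast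
qed

text \<open>
  The arcs in which the new paths differ lie in the join of three members of \<open>S\<close>: the parts of
  the two paths before the cell, the cell, and the parts behind it.
\<close>

lemma rel_add_cell:
  assumes c: "cell y c d y'" and p: "awalk s p1 y" "awalk y' p2 t" and x: "awalk s x1 y" "awalk y' x2 t"
    and r: "rel (p1 @ c @ p2) (x1 @ c @ x2)" and l: "le (p1 @ c @ p2) (x1 @ d @ x2)"
  shows "rel (p1 @ c @ p2) (x1 @ d @ x2)"
proof -
  obtain A where A: "A \<in> S" "(set (p1 @ c @ p2) - set (x1 @ c @ x2)) \<union> (set (x1 @ c @ x2) - set (p1 @ c @ p2)) \<subseteq> arcs A"
    using r unfolding rel_def by blast
  note W = cellD(2,3)[OF c]
  have D: "distinct (a @ c @ b)" if "awalk s a y" "awalk y' b t" for a b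
    by (rule awalk_distinct[OF awalk_appendI[OF that(1) awalk_appendI[OF W(1) that(2)]]])
  have "(set p1 - set x1) \<union> (set x1 - set p1) \<subseteq> arcs A" "(set p2 - set x2) \<union> (set x2 - set p2) \<subseteq> arcs A"
    using A(2) D[OF p] D[OF x] D[OF p(1) x(2)] D[OF x(1) p(2)] by auto
  then have U: "path_union s p1 x1 \<in> S" "path_union y' p2 x2 \<in> S"
    using parallel_in_S A(1) p x by blast+
  let ?K = "Digraph_Component.union (path_union s p1 x1) (path_union y c d)"
  let ?L = "Digraph_Component.union ?K (path_union y' p2 x2)"
  note st1 = path_union_source_target[OF p(1) x(1)] and st2 = path_union_source_target[OF W]
    and st3 = path_union_source_target[OF p(2) x(2)]
  have K: "?K \<in> S" by (rule join_in_S[OF U(1) cell_in_S[OF c] st1(2) st2(1)])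
  have "is_target ?K y'"
    by (rule join_source_target(2)[OF path_union_sub[OF p(1) x(1)] st1 path_union_sub[OF W] st2])
  then have L: "?L \<in> S" by (rule join_in_S[OF K U(2) _ st3(1)])
  have "arcs ?L = set p1 \<union> set x1 \<union> (set c \<union> set d) \<union> (set p2 \<union> set x2)"
    by (simp add: Digraph_Component.union_def path_graph_def)
  then have "(set (p1 @ c @ p2) - set (x1 @ d @ x2)) \<union> (set (x1 @ d @ x2) - set (p1 @ c @ p2)) \<subseteq> arcs ?L" by auto
  then show ?thesis unfolding rel_def using L l by blast
qed

lemma le_cell:
  assumes "cell y c d y'" "awalk s p1 y" "awalk y' p2 t"
  shows "le (p1 @ c @ p2) (p1 @ d @ p2)"
proof -
  have "awalk s (p1 @ c @ p2) t" "awalk s (p1 @ d @ p2) t"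
    using assms(2,3) cellD(2,3)[OF assms(1)] awalk_appendI by blast+
  moreover have "wdiff (p1 @ c @ p2) (p1 @ d @ p2) z \<le> 0" if "z \<notin> supp" for z
    unfolding wdiff_replace using cellD(8)[OF assms(1) that] cellD(5,7)[OF assms(1), of z] by auto
  ultimately show ?thesis by (simp add: le_def paths_def)
qed

text \<open>
  Choose \<open>q'\<close> minimal between \<open>p\<close> and \<open>q\<close> with \<open>\<not> rel p q'\<close>, and let \<open>a\<close> arise from \<open>p\<close> by
  crossing a cell, with \<open>le a q'\<close>. If \<open>x\<close> has not crossed the cell yet, it contains the first
  side of the cell, and its join \<open>j\<close> with \<open>a\<close> arises by crossing it; otherwise \<open>x\<close> is already
  above \<open>a\<close>. Suppose that \<open>x\<close> is not \<open>q\<close>, but \<open>j\<close> is. Then \<open>q'\<close> contains the second side of the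
  cell, and going back across the cell leads to a path \<open>k\<close> below \<open>q'\<close>. Now \<open>rel p k\<close> by the
  choice of \<open>q'\<close>, and adding the cell gives \<open>rel p q'\<close>, a contradiction.
\<close>

lemma exists_contracting_path:
  assumes "le p q" "\<not> rel p q"
  shows "\<exists>a. le p a \<and> p \<noteq> a \<and> le a q \<and> a \<noteq> q \<and>
    (\<forall>x. le p x \<longrightarrow> le x q \<longrightarrow> (\<exists>j. le x j \<and> le a j \<and> le j q \<and>
       (\<forall>y. le x y \<longrightarrow> le a y \<longrightarrow> le j y) \<and> (x \<noteq> q \<longrightarrow> j \<noteq> q)))"
proof -
  define Q where "Q = {q'. le p q' \<and> le q' q \<and> \<not> rel p q'}"
  have "q \<in> Q" unfolding Q_def using assms le_refl le_paths by blast
  then obtain q' where q': "q' \<in> Q" "\<And>r. r \<in> Q \<Longrightarrow> card {x. le p x \<and> le x q'} \<le> card {x. le p x \<and> le x r}"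
    using ex_has_least_nat[of "\<lambda>r. r \<in> Q" q "\<lambda>r. card {x. le p x \<and> le x r}"] by blast
  have q'Q: "le p q'" "le q' q" "\<not> rel p q'" using q'(1) unfolding Q_def by auto
  have fin: "finite {x. le p x \<and> le x r}" for r
    by (rule finite_subset[OF _ finite_paths]) (use le_paths in blast)
  have min: "rel p x" if x: "le p x" "le x q'" "x \<noteq> q'" for x
  proof (rule ccontr)
    assume n: "\<not> rel p x"
    then have "x \<in> Q" unfolding Q_def using x q'Q(2) le_trans by blast
    then have le: "card {z. le p z \<and> le z q'} \<le> card {z. le p z \<and> le z x}" by (rule q'(2))
    have "{z. le p z \<and> le z x} \<subset> {z. le p z \<and> le z q'}"
    proof
      show "{z. le p z \<and> le z x} \<subseteq> {z. le p z \<and> le z q'}" using x(2) le_trans by blast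
      have "q' \<in> {z. le p z \<and> le z q'}" using q'Q(1) le_refl le_paths by blast
      moreover have "q' \<notin> {z. le p z \<and> le z x}" using le_antisym[OF x(2)] x(3) by blast
      ultimately show "{z. le p z \<and> le z x} \<noteq> {z. le p z \<and> le z q'}" by blast
    qed
    then have "card {z. le p z \<and> le z x} < card {z. le p z \<and> le z q'}" by (rule psubset_card_mono[OF fin])
    then show False using le by simp
  qed
  have "p \<noteq> q'" using q'Q(1,3) rel_refl le_paths by blast
  then obtain p1 c p2 d y y' where p: "p = p1 @ c @ p2" and w: "awalk s p1 y" "awalk y' p2 t"
    and c: "cell y c d y'" and aq': "le (p1 @ d @ p2) q'"
    by (rule exists_flip[OF q'Q(1)])
  define a where "a = p1 @ d @ p2"
  note aq' = aq'[folded a_def]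
  have pa: "le p a" unfolding p a_def by (rule le_cell[OF c w])
  have rpa: "rel p a" unfolding p a_def by (rule rel_cell[OF c le_cell[OF c w]])
  define F where "F = set c \<union> set d"
  note C = cellD[OF c, folded F_def]
  have dpa: "wdiff p a z = wdiff c d z" for z unfolding p a_def by (rule wdiff_replace)
  obtain z0 where z0: "z0 \<in> inside (tr F)" using jordanD(1)[OF C(4)] by blast
  have z0s: "z0 \<notin> supp" by (rule C(6)[OF z0])
  have pa0: "wdiff p a z0 = -1" unfolding dpa by (rule C(5)[OF z0])
  have "p \<noteq> a" using pa0 by auto
  have "a \<noteq> q'" using rpa q'Q(3) by blast
  have aq: "le a q" by (rule le_trans[OF aq' q'Q(2)])
  have "a \<noteq> q" using le_antisym[OF q'Q(2)] aq' \<open>a \<noteq> q'\<close> by blast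
  have const: "wdiff x r z = wdiff x r z0" if "le x r" "z \<in> inside (tr F)" for x r z
    using wdiff_const_cell[OF c leD(1,2)[OF that(1)]] that(2) z0 unfolding F_def by blast
  have above: "wdiff p r z0 \<le> -1" if "le a r" for r
    using wdiff_trans[of p a z0 r] pa0 leD(3)[OF that z0s] by simp
  have "\<exists>j. le x j \<and> le a j \<and> le j q \<and> (\<forall>y. le x y \<longrightarrow> le a y \<longrightarrow> le j y) \<and> (x \<noteq> q \<longrightarrow> j \<noteq> q)"
    if x: "le p x" "le x q" for x
  proof (cases "wdiff p x z0 = 0")
    case True
    have "set c \<subseteq> set x"
      using cell_source_subset[OF c w x(1)[unfolded p] z0[unfolded F_def]] True unfolding p by blast
    then obtain x1 x2 where xc: "x = x1 @ c @ x2" and xw: "awalk s x1 y" "awalk y' x2 t"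
      by (rule awalk_segment_if_subset[OF C(2) lens_ne(1)[OF C(1)] leD(2)[OF x(1)]])
    define j where "j = x1 @ d @ x2"
    have xj: "le x j" unfolding xc j_def by (rule le_cell[OF c xw])
    have dxj: "wdiff x j z = wdiff c d z" for z unfolding xc j_def by (rule wdiff_replace)
    have lub: "le j r" if r: "le x r" "le a r" for r
    proof -
      have "wdiff j r z \<le> 0" if z: "z \<notin> supp" for z
      proof -
        have eq: "wdiff j r z = wdiff x r z - wdiff c d z" using wdiff_trans[of x j z r] dxj[of z] by simp
        from C(8)[OF z] show ?thesis
        proof
          assume zi: "z \<in> inside (tr F)"
          have "wdiff x r z0 \<le> -1" using wdiff_trans[of p x z0 r] True above[OF r(2)] by simp
          then show ?thesis using eq const[OF r(1) zi] C(5)[OF zi] by simp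
        next
          assume "z \<in> outside (tr F)"
          then show ?thesis using eq C(7) leD(3)[OF r(1) z] by simp
        qed
      qed
      then show ?thesis unfolding le_def using le_paths xj r by blast
    qed
    have aj: "le a j"
    proof -
      have "wdiff a j z \<le> 0" if z: "z \<notin> supp" for z
        using wdiff_trans[of p a z j] wdiff_trans[of p x z j] dxj[of z] dpa[of z] leD(3)[OF x(1) z] by simp
      then show ?thesis unfolding le_def using le_paths xj aq by blast
    qed
    have "j \<noteq> q" if "x \<noteq> q"
    proof
      assume jq: "j = q"
      have "wdiff p q z0 = -1" using wdiff_trans[of p x z0 q] True dxj[of z0] C(5)[OF z0] jq by simp
      then have "wdiff p q' z0 = -1" and q'q0: "wdiff q' q z0 = 0"
        using wdiff_trans[of p q' z0 q] above[OF aq'] leD(3)[OF q'Q(2) z0s] by auto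
      have "set d \<subseteq> set q'"
        using cell_target_subset[OF c xw, folded j_def, unfolded jq, OF q'Q(2) z0[unfolded F_def] q'q0] .
      then obtain k1 k2 where k: "q' = k1 @ d @ k2" and kw: "awalk s k1 y" "awalk y' k2 t"
        by (rule awalk_segment_if_subset[OF C(3) lens_ne(2)[OF C(1)] leD(2)[OF q'Q(1)]])
      define k where "k = k1 @ c @ k2"
      have kq': "le k q'" unfolding k k_def by (rule le_cell[OF c kw])
      have dk: "wdiff k q' z = wdiff c d z" for z unfolding k k_def by (rule wdiff_replace)
      have pk: "le p k"
      proof -
        have "wdiff p k z \<le> 0" if z: "z \<notin> supp" for z
        proof -
          have eq: "wdiff p k z = wdiff p q' z - wdiff c d z" using wdiff_trans[of p k z q'] dk[of z] by simp
          from C(8)[OF z] show ?thesis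
          proof
            assume zi: "z \<in> inside (tr F)"
            then show ?thesis using eq const[OF q'Q(1) zi] C(5)[OF zi] \<open>wdiff p q' z0 = -1\<close> by simp
          next
            assume "z \<in> outside (tr F)"
            then show ?thesis using eq C(7) leD(3)[OF q'Q(1) z] by simp
          qed
        qed
        then show ?thesis unfolding le_def using le_paths q'Q(1) kq' by blast
      qed
      have "k \<noteq> q'" using dk[of z0] C(5)[OF z0] by auto
      then have "rel p k" using min[OF pk kq'] by blast
      then have "rel p q'"
        using rel_add_cell[OF c w kw] q'Q(1) unfolding p k k_def by blast
      then show False using q'Q(3) by blast
    qed
    then show ?thesis using xj aj lub x(2) aq by blast
  next
    case False
    have "wdiff p x z0 \<in> \<int>"
    proof (rule wdiff_int[OF leD(1,2)[OF x(1)] awalk_Nil_both[OF leD(1,2)[OF x(1)]]])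
      have "tr (set p \<union> set x) \<subseteq> supp"
        by (rule trace_subset_supp) (use leD(1,2)[OF x(1)] in blast)
      then show "z0 \<notin> tr (set p \<union> set x)" using z0s by blast
    qed
    then obtain i where i: "wdiff p x z0 = of_int i" by (rule Ints_cases)
    then have "i < 0" using leD(3)[OF x(1) z0s] False by simp
    \<comment> \<open>integrality turns a negative winding number into one that is at most \<open>-1\<close>\<close>
    then have "i \<le> -1" by simp
    then have m1: "wdiff p x z0 \<le> -1" unfolding i by simp
    have ax: "le a x"
    proof -
      have "wdiff a x z \<le> 0" if z: "z \<notin> supp" for z
      proof -
        have eq: "wdiff a x z = wdiff p x z - wdiff c d z" using wdiff_trans[of p a z x] dpa[of z] by simp
        from C(8)[OF z] show ?thesis
        proof
          assume zi: "z \<in> inside (tr F)"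
          then show ?thesis using eq const[OF x(1) zi] C(5)[OF zi] m1 by simp
        next
          assume "z \<in> outside (tr F)"
          then show ?thesis using eq C(7) leD(3)[OF x(1) z] by simp
        qed
      qed
      then show ?thesis unfolding le_def using le_paths x(1) aq by blast
    qed
    then show ?thesis using x(2) le_refl le_paths[OF x(2)] by blast
  qed
  then show ?thesis using pa \<open>p \<noteq> a\<close> aq \<open>a \<noteq> q\<close> by blast
qed

end

section \<open>Nerves of complexes of chains\<close>

text \<open>
  The part of the nerve whose simplices have their sets of vertices in the abstract simplicial
  complex \<open>\<K>\<close>.
\<close>

definition chain_nerve :: "('a \<Rightarrow> 'a \<Rightarrow> bool) \<Rightarrow> 'a set set \<Rightarrow> 'a list sset" where
  "chain_nerve le \<K> =
     \<lparr>simplices = (\<lambda>n. {xs. length xs = Suc n \<and> sorted_wrt le xs \<and> set xs \<in> \<K>}),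
      act = (\<lambda>n \<theta> xs. map ((!) xs) \<theta>)\<rparr>"

definition down_closed :: "'a set set \<Rightarrow> bool" where
  "down_closed \<K> \<longleftrightarrow> (\<forall>K\<in>\<K>. \<forall>L. L \<noteq> {} \<longrightarrow> L \<subseteq> K \<longrightarrow> L \<in> \<K>)"

lemma down_closedD: "down_closed \<K> \<Longrightarrow> K \<in> \<K> \<Longrightarrow> L \<noteq> {} \<Longrightarrow> L \<subseteq> K \<Longrightarrow> L \<in> \<K>"
  unfolding down_closed_def by blast

lemma chain_nerve_sel:
  "xs \<in> simplices (chain_nerve le \<K>) n \<longleftrightarrow> length xs = Suc n \<and> sorted_wrt le xs \<and> set xs \<in> \<K>"
  "act (chain_nerve le \<K>) n \<theta> xs = map ((!) xs) \<theta>"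
  by (simp_all add: chain_nerve_def)

lemma operatorsD:
  assumes "\<theta> \<in> operators m n"
  shows "length \<theta> = Suc m" "sorted \<theta>" "\<theta> \<noteq> []" "i \<in> set \<theta> \<Longrightarrow> i < Suc n"
  using assms unfolding operators_def by auto

lemma sorted_wrt_map_nth:
  assumes "sorted_wrt le xs" "\<forall>x\<in>set xs. le x x" "sorted \<theta>" "\<forall>i\<in>set \<theta>. i < length xs"
  shows "sorted_wrt le (map ((!) xs) \<theta>)"
  unfolding sorted_wrt_map
proof (rule sorted_wrt_mono_rel[OF _ assms(3)])
  fix i j assume ij: "i \<in> set \<theta>" "j \<in> set \<theta>" "i \<le> j"
  show "le (xs ! i) (xs ! j)"
  proof (cases "i = j")
    case True then show ?thesis using assms(2,4) ij by simp
  next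
    case False then show ?thesis using sorted_wrt_nth_less[OF assms(1), of i j] ij assms(4) by simp
  qed
qed

lemma act_chain_nerve:
  assumes "down_closed \<K>" "\<forall>K\<in>\<K>. \<forall>x\<in>K. le x x"
    and "\<theta> \<in> operators m n" "xs \<in> simplices (chain_nerve le \<K>) n"
  shows "map ((!) xs) \<theta> \<in> simplices (chain_nerve le \<K>) m"
proof -
  note xs = assms(4)[unfolded chain_nerve_sel] and th = operatorsD[OF assms(3)]
  have lt: "i < length xs" if "i \<in> set \<theta>" for i using th(4)[OF that] xs by simp
  have "sorted_wrt le (map ((!) xs) \<theta>)"
    by (rule sorted_wrt_map_nth) (use xs assms(2) th lt in auto)
  moreover have "set (map ((!) xs) \<theta>) \<in> \<K>"
    by (rule down_closedD[OF assms(1)]) (use xs th(3) lt in auto)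
  ultimately show ?thesis using th(1) by (simp add: chain_nerve_sel)
qed

lemma simplicial_set_chain_nerve:
  assumes "down_closed \<K>" "\<forall>K\<in>\<K>. \<forall>x\<in>K. le x x"
  shows "simplicial_set (chain_nerve le \<K>)"
  unfolding simplicial_set_def chain_nerve_sel(2)
proof (intro conjI allI ballI)
  fix m n \<theta> xs assume "\<theta> \<in> operators m n" "xs \<in> simplices (chain_nerve le \<K>) n"
  then show "map ((!) xs) \<theta> \<in> simplices (chain_nerve le \<K>) m" by (rule act_chain_nerve[where le = le, OF assms])
next
  fix n xs assume "xs \<in> simplices (chain_nerve le \<K>) n"
  then show "map ((!) xs) [0..<Suc n] = xs" using map_nth[of xs] by (simp add: chain_nerve_sel)
next
  fix k m n \<eta> \<theta> xs assume "\<eta> \<in> operators k m" "\<theta> \<in> operators m n"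
  then show "map ((!) (map ((!) xs) \<theta>)) \<eta> = map ((!) xs) (map ((!) \<theta>) \<eta>)"
    using operatorsD(1)[of \<theta> m n] operatorsD(4)[of \<eta> k m] by simp
qed

lemma standard_simplex_chain_nerve:
  "standard_simplex n = chain_nerve (\<le>) {L. L \<noteq> {} \<and> L \<subseteq> {..n}}"
  unfolding standard_simplex_def nerve_def chain_nerve_def by auto

lemma horn_chain_nerve:
  "horn n j = chain_nerve (\<le>) {L. L \<noteq> {} \<and> L \<subseteq> {..n} \<and> (\<exists>i\<le>n. i \<noteq> j \<and> i \<notin> L)}"
proof -
  have "{xs. (length xs = Suc m \<and> set xs \<subseteq> {..n} \<and> sorted xs) \<and> (\<exists>i\<le>n. i \<noteq> j \<and> i \<notin> set xs)} =
    {xs. length xs = Suc m \<and> sorted xs \<and> set xs \<noteq> {} \<and> set xs \<subseteq> {..n} \<and> (\<exists>i\<le>n. i \<noteq> j \<and> i \<notin> set xs)}" for m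
    by (intro Collect_cong) (metis length_0_conv nat.distinct(1) set_empty)
  then show ?thesis by (simp add: horn_def standard_simplex_def nerve_def chain_nerve_def)
qed

lemma simplicial_set_standard_simplex: "simplicial_set (standard_simplex n)"
  and simplicial_set_horn: "simplicial_set (horn n j)"
  unfolding standard_simplex_chain_nerve horn_chain_nerve
  by (rule simplicial_set_chain_nerve; auto simp: down_closed_def)+

subsection \<open>Lifting along inclusions of chain nerves\<close>

abbreviation lifts_inclusion ::
  "('a \<Rightarrow> 'a \<Rightarrow> bool) \<Rightarrow> 'a set set \<Rightarrow> 'a set set \<Rightarrow> 'x sset \<Rightarrow> 'y sset \<Rightarrow> (nat \<Rightarrow> 'x \<Rightarrow> 'y) \<Rightarrow> bool" where
  "lifts_inclusion le \<K> \<L> X Y f \<equiv> lifts_against (chain_nerve le \<K>) (chain_nerve le \<L>) (\<lambda>n x. x) X Y f"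

lemma lifts_againstD:
  assumes "lifts_against A B (\<lambda>n x. x) X Y f" "simplicial_map A X u" "simplicial_map B Y v"
    and "\<forall>n. \<forall>a\<in>simplices A n. f n (u n a) = v n a"
  shows "\<exists>h. simplicial_map B X h \<and> (\<forall>n. \<forall>a\<in>simplices A n. h n a = u n a) \<and>
      (\<forall>n. \<forall>b\<in>simplices B n. f n (h n b) = v n b)"
  by (rule assms(1)[unfolded lifts_against_def, THEN spec[of _ u], THEN spec[of _ v], THEN mp,
        OF conjI[OF assms(2) conjI[OF assms(3,4)]]])

lemma lifts_inclusion_refl: "lifts_inclusion le \<K> \<K> X Y f"
  unfolding lifts_against_def
proof (intro allI impI)
  fix u v
  assume "simplicial_map (chain_nerve le \<K>) X u \<and> simplicial_map (chain_nerve le \<K>) Y v \<and>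
    (\<forall>n. \<forall>a\<in>simplices (chain_nerve le \<K>) n. f n (u n a) = v n a)"
  then show "\<exists>h. simplicial_map (chain_nerve le \<K>) X h \<and>
      (\<forall>n. \<forall>a\<in>simplices (chain_nerve le \<K>) n. h n a = u n a) \<and>
      (\<forall>n. \<forall>b\<in>simplices (chain_nerve le \<K>) n. f n (h n b) = v n b)"
    by (intro exI[of _ u]) simp
qed

lemma simplicial_map_restrict:
  assumes "simplicial_map (chain_nerve le \<L>) Y v" "\<K> \<subseteq> \<L>" "simplicial_set (chain_nerve le \<K>)"
  shows "simplicial_map (chain_nerve le \<K>) Y v"
proof -
  have "x \<in> simplices (chain_nerve le \<L>) n" if "x \<in> simplices (chain_nerve le \<K>) n" for x n
    using that assms(2) by (auto simp: chain_nerve_sel)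
  note sub = this
  show ?thesis
    unfolding simplicial_map_def
  proof (intro conjI allI ballI)
    show "simplicial_set (chain_nerve le \<K>)" by (rule assms(3))
    show "simplicial_set Y" using assms(1) by (simp add: simplicial_map_def)
  next
    fix n x assume "x \<in> simplices (chain_nerve le \<K>) n"
    from sub[OF this] show "v n x \<in> simplices Y n" using assms(1) by (simp add: simplicial_map_def)
  next
    fix m n \<theta> x assume "\<theta> \<in> operators m n" "x \<in> simplices (chain_nerve le \<K>) n"
    then have "v m (act (chain_nerve le \<L>) n \<theta> x) = act Y n \<theta> (v n x)"
      using sub assms(1) by (simp add: simplicial_map_def)
    then show "v m (act (chain_nerve le \<K>) n \<theta> x) = act Y n \<theta> (v n x)" by (simp add: chain_nerve_sel(2))
  qed
qed

lemma lifts_inclusion_trans: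
  assumes "lifts_inclusion le \<K> \<L> X Y f" "lifts_inclusion le \<L> \<M> X Y f"
    and "\<K> \<subseteq> \<L>" "\<L> \<subseteq> \<M>" "simplicial_set (chain_nerve le \<L>)"
  shows "lifts_inclusion le \<K> \<M> X Y f"
  unfolding lifts_against_def
proof (intro allI impI)
  fix u v
  assume uv: "simplicial_map (chain_nerve le \<K>) X u \<and> simplicial_map (chain_nerve le \<M>) Y v \<and>
    (\<forall>n. \<forall>a\<in>simplices (chain_nerve le \<K>) n. f n (u n a) = v n a)"
  have sub: "a \<in> simplices (chain_nerve le \<L>) n" if "a \<in> simplices (chain_nerve le \<K>) n" for a n
    using that assms(3) by (auto simp: chain_nerve_sel)
  from uv have u: "simplicial_map (chain_nerve le \<K>) X u" and v: "simplicial_map (chain_nerve le \<M>) Y v"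
    and fu: "\<forall>n. \<forall>a\<in>simplices (chain_nerve le \<K>) n. f n (u n a) = v n a" by simp_all
  obtain h where h: "simplicial_map (chain_nerve le \<L>) X h \<and>
      (\<forall>n. \<forall>a\<in>simplices (chain_nerve le \<K>) n. h n a = u n a) \<and>
      (\<forall>n. \<forall>b\<in>simplices (chain_nerve le \<L>) n. f n (h n b) = v n b)"
    using lifts_againstD[OF assms(1) u simplicial_map_restrict[OF v assms(4,5)] fu] ..
  obtain k where k: "simplicial_map (chain_nerve le \<M>) X k \<and>
      (\<forall>n. \<forall>a\<in>simplices (chain_nerve le \<L>) n. k n a = h n a) \<and>
      (\<forall>n. \<forall>b\<in>simplices (chain_nerve le \<M>) n. f n (k n b) = v n b)"
    using lifts_againstD[OF assms(2) conjunct1[OF h] v conjunct2[OF conjunct2[OF h]]] ..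
  show "\<exists>h. simplicial_map (chain_nerve le \<M>) X h \<and>
      (\<forall>n. \<forall>a\<in>simplices (chain_nerve le \<K>) n. h n a = u n a) \<and>
      (\<forall>n. \<forall>b\<in>simplices (chain_nerve le \<M>) n. f n (h n b) = v n b)"
    using k h sub by (intro exI[of _ k]) simp
qed

text \<open>
  The simplex \<open>\<sigma>\<close> and its \<open>j\<close>-th face are attached along an inner horn. A simplex with vertices
  in \<open>\<sigma>\<close> is recorded by the positions of its vertices in \<open>\<sigma>\<close>, a simplex of the standard simplex,
  at which the filler \<open>h'\<close> of the horn is evaluated. On the old simplices among them this agrees
  with \<open>u\<close>, as their positions lie in the horn.
\<close>

lemma lifts_attach_simplex:
  assumes fib: "mid_fibration X Y f"
    and anti: "\<forall>x y. le x y \<longrightarrow> le y x \<longrightarrow> x = y"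
    and \<sigma>: "length \<sigma> = Suc n" "distinct \<sigma>" "sorted_wrt le \<sigma>" "\<forall>x\<in>set \<sigma>. le x x"
    and j: "0 < j" "j < n"
    and down: "down_closed \<K>" and refl: "\<forall>K\<in>\<K>. \<forall>x\<in>K. le x x"
    and new: "set \<sigma> \<notin> \<K>" "set \<sigma> - {\<sigma> ! j} \<notin> \<K>"
    and old: "\<forall>i\<le>n. i \<noteq> j \<longrightarrow> set \<sigma> - {\<sigma> ! i} \<in> \<K>"
    and L: "\<L> = \<K> \<union> {set \<sigma>, set \<sigma> - {\<sigma> ! j}}"
  shows "lifts_inclusion le \<K> \<L> X Y f"
  unfolding lifts_against_def
proof (intro allI impI)
  fix u v
  assume uv: "simplicial_map (chain_nerve le \<K>) X u \<and> simplicial_map (chain_nerve le \<L>) Y v \<and>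
    (\<forall>m. \<forall>a\<in>simplices (chain_nerve le \<K>) m. f m (u m a) = v m a)"
  then have u: "simplicial_map (chain_nerve le \<K>) X u" and v: "simplicial_map (chain_nerve le \<L>) Y v"
    and fu: "\<And>m a. a \<in> simplices (chain_nerve le \<K>) m \<Longrightarrow> f m (u m a) = v m a" by simp_all
  have sets: "simplicial_set X" "simplicial_set Y" using u v by (simp_all add: simplicial_map_def)
  let ?K = "set \<sigma>"
  let ?s = "map ((!) \<sigma>)"
  have inj: "\<sigma> ! i = \<sigma> ! k \<longleftrightarrow> i = k" if "i \<le> n" "k \<le> n" for i k
    using that \<sigma>(1,2) by (simp add: nth_eq_iff_index_eq)
  have Kn: "?K = (!) \<sigma> ` {..n}" using \<sigma>(1) by (auto simp: set_conv_nth less_Suc_eq_le)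
  have missing: "\<exists>i\<le>n. i \<noteq> j \<and> \<sigma> ! i \<notin> M" if "M \<subseteq> ?K" "M \<noteq> ?K" "M \<noteq> ?K - {\<sigma> ! j}" for M
  proof (rule ccontr)
    assume "\<not> (\<exists>i\<le>n. i \<noteq> j \<and> \<sigma> ! i \<notin> M)"
    then have "\<And>i. i \<le> n \<Longrightarrow> i \<noteq> j \<Longrightarrow> \<sigma> ! i \<in> M" by blast
    then have "?K - {\<sigma> ! j} \<subseteq> M" unfolding Kn by auto
    then show False using that by blast
  qed
  have sub_in: "M \<in> \<K>" if "M \<noteq> {}" "M \<subseteq> ?K" "i \<le> n" "i \<noteq> j" "\<sigma> ! i \<notin> M" for M i
    by (rule down_closedD[OF down old[rule_format, OF that(3,4)] that(1)]) (use that in blast)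
  have sub_in': "M \<in> \<L>" if "M \<noteq> {}" "M \<subseteq> ?K" for M
    using missing[OF that(2)] sub_in[OF that] unfolding L by blast
  have set_s: "set (?s ys) = (!) \<sigma> ` set ys" for ys by simp
  have s_sorted: "sorted_wrt le (?s ys)" if "sorted ys" "set ys \<subseteq> {..n}" for ys
    by (rule sorted_wrt_map_nth[where le = le, OF \<sigma>(3,4) that(1)]) (use that(2) \<sigma>(1) in auto)
  have s_std: "?s ys \<in> simplices (chain_nerve le \<L>) m" if "ys \<in> simplices (standard_simplex n) m" for ys m
  proof -
    have ys: "length ys = Suc m" "sorted ys" "set ys \<subseteq> {..n}" "set ys \<noteq> {}"
      using that unfolding standard_simplex_chain_nerve chain_nerve_sel by auto
    have "set (?s ys) \<in> \<L>" using sub_in'[of "set (?s ys)"] ys Kn by auto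
    then show ?thesis using ys s_sorted unfolding chain_nerve_sel by simp
  qed
  have s_horn: "?s ys \<in> simplices (chain_nerve le \<K>) m" if "ys \<in> simplices (horn n j) m" for ys m
  proof -
    have ys: "length ys = Suc m" "sorted ys" "set ys \<subseteq> {..n}" "set ys \<noteq> {}"
      and "\<exists>i\<le>n. i \<noteq> j \<and> i \<notin> set ys"
      using that unfolding horn_chain_nerve chain_nerve_sel by auto
    then obtain i where i: "i \<le> n" "i \<noteq> j" "i \<notin> set ys" by blast
    have "\<sigma> ! i \<notin> set (?s ys)" using i inj[OF i(1)] ys(3) by auto
    then have "set (?s ys) \<in> \<K>" using sub_in[OF _ _ i(1,2), of "set (?s ys)"] ys Kn by auto
    then show ?thesis using ys s_sorted unfolding chain_nerve_sel by simp
  qed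
  have act_s: "?s (map ((!) ys) \<theta>) = map ((!) (?s ys)) \<theta>" if "\<theta> \<in> operators k m" "length ys = Suc m" for ys \<theta> k m
    using operatorsD(4)[OF that(1)] that(2) by simp
  have act_std: "act (standard_simplex n) m \<theta> ys = map ((!) ys) \<theta>" for m \<theta> ys
    unfolding standard_simplex_chain_nerve chain_nerve_sel(2) ..
  have act_horn: "act (horn n j) m \<theta> ys = map ((!) ys) \<theta>" for m \<theta> ys
    unfolding horn_chain_nerve chain_nerve_sel(2) ..
  have nat_u: "u k (map ((!) xs) \<theta>) = act X m \<theta> (u m xs)"
    if "\<theta> \<in> operators k m" "xs \<in> simplices (chain_nerve le \<K>) m" for k m \<theta> xs
    using u that unfolding simplicial_map_def chain_nerve_sel(2) by simp
  have nat_v: "v k (map ((!) xs) \<theta>) = act Y m \<theta> (v m xs)"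
    if "\<theta> \<in> operators k m" "xs \<in> simplices (chain_nerve le \<L>) m" for k m \<theta> xs
    using v that unfolding simplicial_map_def chain_nerve_sel(2) by simp
  have u': "simplicial_map (horn n j) X (\<lambda>m ys. u m (?s ys))"
    unfolding simplicial_map_def act_horn
  proof (intro conjI allI ballI)
    fix m ys assume "ys \<in> simplices (horn n j) m"
    then show "u m (?s ys) \<in> simplices X m" using s_horn u by (simp add: simplicial_map_def)
  next
    fix m k \<theta> ys assume th: "\<theta> \<in> operators m k" and ys: "ys \<in> simplices (horn n j) k"
    have "length ys = Suc k" using ys unfolding horn_chain_nerve chain_nerve_sel by blast
    from act_s[OF th this] show "u m (?s (map ((!) ys) \<theta>)) = act X k \<theta> (u k (?s ys))"
      using nat_u[OF th s_horn[OF ys]] by (simp only:)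
  qed (use sets simplicial_set_horn in auto)
  have v': "simplicial_map (standard_simplex n) Y (\<lambda>m ys. v m (?s ys))"
    unfolding simplicial_map_def act_std
  proof (intro conjI allI ballI)
    fix m ys assume "ys \<in> simplices (standard_simplex n) m"
    then show "v m (?s ys) \<in> simplices Y m" using s_std v by (simp add: simplicial_map_def)
  next
    fix m k \<theta> ys assume th: "\<theta> \<in> operators m k" and ys: "ys \<in> simplices (standard_simplex n) k"
    have "length ys = Suc k" using ys unfolding standard_simplex_chain_nerve chain_nerve_sel by blast
    from act_s[OF th this] show "v m (?s (map ((!) ys) \<theta>)) = act Y k \<theta> (v k (?s ys))"
      using nat_v[OF th s_std[OF ys]] by (simp only:)
  qed (use sets simplicial_set_standard_simplex in auto)
  have "lifts_against (horn n j) (standard_simplex n) (\<lambda>_ x. x) X Y f"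
    using fib j by (simp add: mid_fibration_def)
  note lift = this
  have "\<forall>m. \<forall>a\<in>simplices (horn n j) m. f m (u m (?s a)) = v m (?s a)"
    using fu s_horn by simp
  from lifts_againstD[OF lift u' v' this] obtain h' where H': "simplicial_map (standard_simplex n) X h' \<and>
      (\<forall>m. \<forall>a\<in>simplices (horn n j) m. h' m a = u m (?s a)) \<and>
      (\<forall>m. \<forall>b\<in>simplices (standard_simplex n) m. f m (h' m b) = v m (?s b))"
    ..
  then have h': "simplicial_map (standard_simplex n) X h'"
    and h'u: "\<And>m a. a \<in> simplices (horn n j) m \<Longrightarrow> h' m a = u m (?s a)"
    and fh': "\<And>m b. b \<in> simplices (standard_simplex n) m \<Longrightarrow> f m (h' m b) = v m (?s b)"
    by simp_all
  define idx where "idx = map (inv_into {..n} ((!) \<sigma>))"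
  have inv: "\<sigma> ! inv_into {..n} ((!) \<sigma>) y = y" "inv_into {..n} ((!) \<sigma>) y \<le> n" if "y \<in> ?K" for y
    using f_inv_into_f[of y "(!) \<sigma>" "{..n}"] inv_into_into[of y "(!) \<sigma>" "{..n}"] that unfolding Kn by auto
  have s_idx: "?s (idx x) = x" if "set x \<subseteq> ?K" for x
    unfolding idx_def by (simp add: map_idI inv that[THEN subsetD])
  have idx_std: "idx x \<in> simplices (standard_simplex n) m"
    if x: "x \<in> simplices (chain_nerve le \<L>) m" "set x \<subseteq> ?K" for x m
  proof -
    have xs: "length x = Suc m" "sorted_wrt le x" using x unfolding chain_nerve_sel by auto
    have "sorted_wrt (\<lambda>a b. inv_into {..n} ((!) \<sigma>) a \<le> inv_into {..n} ((!) \<sigma>) b) x"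
    proof (rule sorted_wrt_mono_rel[OF _ xs(2)])
      fix a b assume ab: "a \<in> set x" "b \<in> set x" "le a b"
      let ?a = "inv_into {..n} ((!) \<sigma>) a" and ?b = "inv_into {..n} ((!) \<sigma>) b"
      have A: "\<sigma> ! ?a = a" "?a \<le> n" and B: "\<sigma> ! ?b = b" "?b \<le> n" using inv ab x(2) by blast+
      show "?a \<le> ?b"
      proof (rule ccontr)
        assume "\<not> ?a \<le> ?b"
        then have "le (\<sigma> ! ?b) (\<sigma> ! ?a)" using sorted_wrt_nth_less[OF \<sigma>(3), of ?b ?a] \<sigma>(1) A(2) by simp
        then have "a = b" using anti ab(3) A(1) B(1) by metis
        then show False using \<open>\<not> ?a \<le> ?b\<close> by simp
      qed
    qed
    then have "sorted (idx x)" unfolding idx_def by (simp add: sorted_wrt_map)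
    moreover have "set (idx x) \<subseteq> {..n}" using inv(2) x(2) unfolding idx_def by auto
    ultimately show ?thesis
      using xs unfolding standard_simplex_chain_nerve chain_nerve_sel idx_def by auto
  qed
  have agree: "h' m (idx x) = u m x" if x: "x \<in> simplices (chain_nerve le \<K>) m" "set x \<subseteq> ?K" for x m
  proof -
    have xK: "set x \<in> \<K>" using x(1) unfolding chain_nerve_sel by blast
    then have xL: "x \<in> simplices (chain_nerve le \<L>) m" using x(1) unfolding chain_nerve_sel L by blast
    obtain i where i: "i \<le> n" "i \<noteq> j" "\<sigma> ! i \<notin> set x" using missing[OF x(2)] xK new by metis
    have "i \<notin> set (idx x)"
    proof
      assume "i \<in> set (idx x)"
      then have "\<sigma> ! i \<in> set (?s (idx x))" unfolding set_s by blast
      then show False using i(3) s_idx[OF x(2)] by simp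
    qed
    then have "idx x \<in> simplices (horn n j) m"
      using idx_std[OF xL x(2)] i unfolding standard_simplex_chain_nerve horn_chain_nerve chain_nerve_sel by blast
    then show ?thesis using h'u s_idx[OF x(2)] by simp
  qed
  define h where "h m x = (if set x \<in> \<K> then u m x else h' m (idx x))" for m x
  have LK: "set x \<subseteq> ?K" if "x \<in> simplices (chain_nerve le \<L>) m" "set x \<notin> \<K>" for x m
    using that unfolding chain_nerve_sel L by blast
  have inK: "x \<in> simplices (chain_nerve le \<K>) m" if "x \<in> simplices (chain_nerve le \<L>) m" "set x \<in> \<K>" for x m
    using that unfolding chain_nerve_sel by blast
  have h_K: "h m x = h' m (idx x)" if "x \<in> simplices (chain_nerve le \<L>) m" "set x \<subseteq> ?K" for x m
    using agree[OF inK[OF that(1)] that(2)] unfolding h_def by simp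
  have downL: "down_closed \<L>"
    using down sub_in' unfolding down_closed_def L by blast
  have reflL: "\<forall>K\<in>\<L>. \<forall>x\<in>K. le x x"
    using refl \<sigma>(4) unfolding L by blast
  have "simplicial_map (chain_nerve le \<L>) X h"
    unfolding simplicial_map_def chain_nerve_sel(2)
  proof (intro conjI allI ballI)
    show "simplicial_set (chain_nerve le \<L>)" by (rule simplicial_set_chain_nerve[where le = le, OF downL reflL])
    show "simplicial_set X" by (rule sets)
  next
    fix m x assume x: "x \<in> simplices (chain_nerve le \<L>) m"
    show "h m x \<in> simplices X m"
    proof (cases "set x \<in> \<K>")
      case True
      then show ?thesis using u inK[OF x True] unfolding h_def simplicial_map_def by simp
    next
      case False
      then show ?thesis using h' idx_std[OF x LK[OF x False]] unfolding h_def simplicial_map_def by simp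
    qed
  next
    fix k m \<theta> x assume th: "\<theta> \<in> operators k m" and x: "x \<in> simplices (chain_nerve le \<L>) m"
    have xm: "length x = Suc m" using x unfolding chain_nerve_sel by blast
    show "h k (map ((!) x) \<theta>) = act X m \<theta> (h m x)"
    proof (cases "set x \<in> \<K>")
      case True
      have "map ((!) x) \<theta> \<in> simplices (chain_nerve le \<K>) k"
        by (rule act_chain_nerve[where le = le, OF down refl th inK[OF x True]])
      then have "set (map ((!) x) \<theta>) \<in> \<K>" unfolding chain_nerve_sel by blast
      then show ?thesis using nat_u[OF th inK[OF x True]] True unfolding h_def by simp
    next
      case False
      have xK: "set x \<subseteq> ?K" by (rule LK[OF x False])
      have lt: "i < length x" if "i \<in> set \<theta>" for i using operatorsD(4)[OF th that] xm by simp
      have yL: "map ((!) x) \<theta> \<in> simplices (chain_nerve le \<L>) k"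
        by (rule act_chain_nerve[where le = le, OF downL reflL th x])
      have "set (map ((!) x) \<theta>) \<subseteq> ?K" using xK lt by auto
      then have "h k (map ((!) x) \<theta>) = h' k (idx (map ((!) x) \<theta>))" by (rule h_K[OF yL])
      also have "idx (map ((!) x) \<theta>) = map ((!) (idx x)) \<theta>" unfolding idx_def using lt by simp
      also have "h' k \<dots> = act X m \<theta> (h' m (idx x))"
        using h' th idx_std[OF x xK] unfolding simplicial_map_def act_std by simp
      finally show ?thesis using h_K[OF x xK] by simp
    qed
  qed
  moreover have "h m a = u m a" if "a \<in> simplices (chain_nerve le \<K>) m" for m a
    using that unfolding h_def chain_nerve_sel by simp
  moreover have "f m (h m b) = v m b" if b: "b \<in> simplices (chain_nerve le \<L>) m" for m b
  proof (cases "set b \<in> \<K>")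
    case True
    then show ?thesis using fu inK[OF b] unfolding h_def by simp
  next
    case False
    then show ?thesis using fh'[OF idx_std[OF b LK[OF b False]]] s_idx[OF LK[OF b False]] unfolding h_def by simp
  qed
  ultimately show "\<exists>h. simplicial_map (chain_nerve le \<L>) X h \<and>
      (\<forall>m. \<forall>a\<in>simplices (chain_nerve le \<K>) m. h m a = u m a) \<and>
      (\<forall>m. \<forall>b\<in>simplices (chain_nerve le \<L>) m. f m (h m b) = v m b)" by (intro exI[of _ h]) simp
qed

section \<open>Chains spanned by a relation on a finite poset\<close>

locale finite_poset =
  fixes P :: "'a set" and le :: "'a \<Rightarrow> 'a \<Rightarrow> bool"
  assumes fin: "finite P"
    and le_in: "le x y \<Longrightarrow> x \<in> P \<and> y \<in> P"
    and le_refl: "x \<in> P \<Longrightarrow> le x x"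
    and le_trans: "le x y \<Longrightarrow> le y z \<Longrightarrow> le x z"
    and le_anti: "le x y \<Longrightarrow> le y x \<Longrightarrow> x = y"
begin

definition chain :: "'a set \<Rightarrow> bool" where
  "chain K \<longleftrightarrow> K \<noteq> {} \<and> K \<subseteq> P \<and> (\<forall>x\<in>K. \<forall>y\<in>K. le x y \<or> le y x)"

text \<open>The chains whose least and greatest elements are related.\<close>

definition spanned :: "('a \<Rightarrow> 'a \<Rightarrow> bool) \<Rightarrow> 'a set set" where
  "spanned R = {K. chain K \<and> (\<exists>u\<in>K. \<exists>v\<in>K. R u v \<and> (\<forall>y\<in>K. le u y \<and> le y v))}"

definition convex_rel :: "('a \<Rightarrow> 'a \<Rightarrow> bool) \<Rightarrow> bool" where
  "convex_rel R \<longleftrightarrow> (\<forall>p q p' q'. R p q \<longrightarrow> le p p' \<longrightarrow> le p' q' \<longrightarrow> le q' q \<longrightarrow> R p' q')"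

lemma chain_finite: "chain K \<Longrightarrow> finite K"
  unfolding chain_def using fin finite_subset by blast

lemma chain_subset: "chain K \<Longrightarrow> L \<noteq> {} \<Longrightarrow> L \<subseteq> K \<Longrightarrow> chain L"
  unfolding chain_def by blast

lemma chain_extremum:
  assumes "chain K" "r = le \<or> r = (\<lambda>x y. le y x)"
  shows "\<exists>v\<in>K. \<forall>y\<in>K. r y v"
proof -
  have trans: "r x z" if "r x y" "r y z" for x y z using that assms(2) le_trans by blast
  have refl: "r x x" if "x \<in> P" for x using that assms(2) le_refl by blast
  have "finite K" "K \<noteq> {}" using assms(1) chain_finite unfolding chain_def by blast+
  then show ?thesis using assms(1)
  proof (induction K rule: finite_ne_induct)
    case (singleton x) then show ?case using refl unfolding chain_def by blast
  next
    case (insert x F)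
    have "chain F" using chain_subset[OF insert.prems insert.hyps(2)] by blast
    then obtain v where v: "v \<in> F" "\<forall>y\<in>F. r y v" using insert.IH by blast
    have "le x v \<or> le v x" "x \<in> P" using insert.prems v(1) unfolding chain_def by blast+
    then have "r x v \<or> r v x" "r x x" using assms(2) refl by blast+
    then show ?case using v trans by blast
  qed
qed

lemma chain_max: "chain K \<Longrightarrow> \<exists>v\<in>K. \<forall>y\<in>K. le y v"
  using chain_extremum[of K le] by simp

lemma chain_min: "chain K \<Longrightarrow> \<exists>v\<in>K. \<forall>y\<in>K. le v y"
  using chain_extremum[of K "\<lambda>x y. le y x"] by simp

lemma chain_list:
  assumes "chain K"
  shows "\<exists>xs. set xs = K \<and> distinct xs \<and> sorted_wrt le xs"
  using assms
proof (induction "card K" arbitrary: K)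
  case 0
  then show ?case using chain_finite unfolding chain_def by simp
next
  case (Suc n)
  obtain v where v: "v \<in> K" "\<forall>y\<in>K. le v y" using chain_min[OF Suc.prems] by blast
  have c: "n = card (K - {v})" using Suc.hyps(2) v(1) chain_finite[OF Suc.prems] by simp
  show ?case
  proof (cases "K - {v} = {}")
    case True
    then have K: "K = {v}" using v(1) by blast
    have "set [v] = K \<and> distinct [v] \<and> sorted_wrt le [v]" unfolding K by simp
    then show ?thesis by (rule exI)
  next
    case False
    then have "chain (K - {v})" by (rule chain_subset[OF Suc.prems _ Diff_subset])
    from Suc.hyps(1)[OF c this] obtain xs where xs: "set xs = K - {v}" "distinct xs" "sorted_wrt le xs"
      by (elim exE conjE)
    have "set (v # xs) = K" using xs(1) v(1) by auto
    moreover have "distinct (v # xs)" "sorted_wrt le (v # xs)" using xs v(2) by simp_all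
    ultimately show ?thesis by (intro exI[of _ "v # xs"] conjI)
  qed
qed

lemma spanned_down_closed:
  assumes "convex_rel R" shows "down_closed (spanned R)"
  unfolding down_closed_def
proof (intro ballI allI impI)
  fix K L assume K: "K \<in> spanned R" and L: "L \<noteq> {}" "L \<subseteq> K"
  have c: "chain L" using K L chain_subset unfolding spanned_def by blast
  obtain u v where uv: "R u v" "\<forall>y\<in>K. le u y \<and> le y v" using K unfolding spanned_def by blast
  obtain a b where ab: "a \<in> L" "b \<in> L" "\<forall>y\<in>L. le a y" "\<forall>y\<in>L. le y b" using chain_min[OF c] chain_max[OF c] by blast
  have "R a b" using assms uv ab L(2) unfolding convex_rel_def by blast
  then show "L \<in> spanned R" using c ab unfolding spanned_def by blast
qed

lemma spanned_refl: "\<forall>K\<in>spanned R. \<forall>x\<in>K. le x x"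
  unfolding spanned_def chain_def using le_refl by blast

lemma simplicial_set_spanned: "convex_rel R \<Longrightarrow> simplicial_set (chain_nerve le (spanned R))"
  by (rule simplicial_set_chain_nerve[where le = le, OF spanned_down_closed spanned_refl])

lemma finite_spanned: "finite (spanned R)"
  by (rule finite_subset[of _ "Pow P"]) (auto simp: spanned_def chain_def fin)

lemma set_in_spanned:
  assumes "sorted_wrt le xs" "xs \<noteq> []"
  shows "set xs \<in> spanned R \<longleftrightarrow> set xs \<subseteq> P \<and> R (hd xs) (last xs)"
proof -
  have H: "le (hd xs) y" "le y (last xs)" if "set xs \<subseteq> P" "y \<in> set xs" for y
  proof -
    obtain i where i: "i < length xs" "y = xs ! i" using \<open>y \<in> set xs\<close> by (auto simp: in_set_conv_nth)
    have "le y y" using that le_refl by blast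
    have hd: "hd xs = xs ! 0" and last: "last xs = xs ! (length xs - 1)"
      using assms(2) by (simp_all add: hd_conv_nth last_conv_nth)
    show "le (hd xs) y"
    proof (cases "i = 0")
      case True then show ?thesis using \<open>le y y\<close> hd i(2) by simp
    next
      case False then show ?thesis using sorted_wrt_nth_less[OF assms(1), of 0 i] hd i by simp
    qed
    show "le y (last xs)"
    proof (cases "i = length xs - 1")
      case True then show ?thesis using \<open>le y y\<close> last i(2) by simp
    next
      case False
      then have "i < length xs - 1" using i(1) by simp
      then show ?thesis using sorted_wrt_nth_less[OF assms(1), of i "length xs - 1"] last i by simp
    qed
  qed
  have hl: "hd xs \<in> set xs" "last xs \<in> set xs" using assms(2) by auto
  show ?thesis
  proof
    assume K: "set xs \<in> spanned R"
    then obtain u v where uv: "u \<in> set xs" "v \<in> set xs" "R u v" "\<forall>y\<in>set xs. le u y \<and> le y v"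
      unfolding spanned_def by blast
    have P: "set xs \<subseteq> P" using K unfolding spanned_def chain_def by blast
    have "u = hd xs" "v = last xs" using uv H[OF P] hl le_anti by blast+
    then show "set xs \<subseteq> P \<and> R (hd xs) (last xs)" using P uv(3) by simp
  next
    assume A: "set xs \<subseteq> P \<and> R (hd xs) (last xs)"
    have "le x y \<or> le y x" if "x \<in> set xs" "y \<in> set xs" for x y
    proof -
      obtain i k where ik: "i < length xs" "x = xs ! i" "k < length xs" "y = xs ! k"
        using \<open>x \<in> set xs\<close> \<open>y \<in> set xs\<close> by (auto simp: in_set_conv_nth)
      have "le x x" using A that le_refl by blast
      then show ?thesis
        using sorted_wrt_nth_less[OF assms(1), of i k] sorted_wrt_nth_less[OF assms(1), of k i] ik
        by (cases i k rule: linorder_cases) auto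
    qed
    then have "chain (set xs)" unfolding chain_def using A assms(2) by auto
    then show "set xs \<in> spanned R" unfolding spanned_def using A H hl by blast
  qed
qed

subsection \<open>Adding one interval\<close>

text \<open>
  The new chains \<open>K\<close> are those from \<open>p\<close> to \<open>q\<close>. Let \<open>N K\<close> consist of the elements of \<open>K\<close> that
  are not above \<open>a\<close>, and let \<open>\<tau> K\<close> be the join of its maximum with \<open>a\<close>. Inserting \<open>\<tau> K\<close> into \<open>K\<close>
  or deleting it does not change \<open>N K\<close>, so the new chains are paired off, and \<open>\<tau> K\<close> differs from
  \<open>p\<close> and from \<open>q\<close>. The pairs are attached in the order of \<open>card (N K) + card K\<close>, \<open>K\<close> being the
  larger member of the pair. Consider the facet without \<open>b\<close>, for \<open>b\<close> other than \<open>\<tau> K\<close>. If it is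
  the larger member of its pair, then it comes earlier as it has fewer elements. If it is the
  smaller one, then \<open>b\<close> belongs to \<open>N K\<close>, and the larger member of its pair has as many elements
  as \<open>K\<close>, but fewer that are not above \<open>a\<close>.
\<close>

lemma lifts_add_interval:
  assumes fib: "mid_fibration X Y f"
    and R: "convex_rel R" and nR: "\<not> R p q"
    and R1: "convex_rel (\<lambda>x y. R x y \<or> x = p \<and> y = q)"
    and a: "le p a" "p \<noteq> a" "le a q"
    and J: "\<forall>x. le p x \<longrightarrow> le x q \<longrightarrow> (le x (J x) \<and> le a (J x) \<and> le (J x) q \<and>
        (\<forall>y. le x y \<longrightarrow> le a y \<longrightarrow> le (J x) y) \<and> (x \<noteq> q \<longrightarrow> J x \<noteq> q))"
  shows "lifts_inclusion le (spanned R) (spanned (\<lambda>x y. R x y \<or> x = p \<and> y = q)) X Y f"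
proof -
  let ?R1 = "\<lambda>x y. R x y \<or> x = p \<and> y = q"
  let ?K0 = "spanned R" and ?K1 = "spanned ?R1"
  define U where "U = {K. chain K \<and> p \<in> K \<and> q \<in> K \<and> (\<forall>y\<in>K. le p y \<and> le y q)}"
  have K1: "?K1 = ?K0 \<union> U" unfolding spanned_def U_def by blast
  have K0U: "?K0 \<inter> U = {}"
  proof (rule ccontr)
    assume "?K0 \<inter> U \<noteq> {}"
    then obtain K u v where K: "K \<in> U" "u \<in> K" "v \<in> K" "R u v" "\<forall>y\<in>K. le u y \<and> le y v"
      unfolding spanned_def by blast
    then have "u = p" "v = q" using le_anti unfolding U_def by blast+
    then show False using K(4) nR by simp
  qed
  define N where "N K = {y \<in> K. \<not> le a y}" for K
  define mx where "mx K = (THE x. x \<in> N K \<and> (\<forall>y\<in>N K. le y x))" for K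
  define \<tau> where "\<tau> K = J (mx K)" for K
  have nap: "\<not> le a p" using a le_anti by blast
  have mx: "mx K \<in> N K" "\<forall>y\<in>N K. le y (mx K)" if "K \<in> U" for K
  proof -
    have "p \<in> N K" using that nap unfolding U_def N_def by blast
    then have "chain (N K)" using that chain_subset[of K "N K"] unfolding U_def N_def by blast
    then obtain x where x: "x \<in> N K \<and> (\<forall>y\<in>N K. le y x)" using chain_max by blast
    then have "mx K = x" unfolding mx_def using le_anti by (intro the_equality) blast+
    then show "mx K \<in> N K" "\<forall>y\<in>N K. le y (mx K)" using x by simp_all
  qed
  have mxI: "le p (mx K)" "le (mx K) q" "mx K \<noteq> q" if "K \<in> U" for K
    using mx(1)[OF that] that a(3) unfolding N_def U_def by blast+
  have JT: "le (mx K) (\<tau> K) \<and> le a (\<tau> K) \<and> le (\<tau> K) q \<and>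
      (\<forall>y. le (mx K) y \<longrightarrow> le a y \<longrightarrow> le (\<tau> K) y) \<and> (mx K \<noteq> q \<longrightarrow> \<tau> K \<noteq> q)" if "K \<in> U" for K
    using J[rule_format, OF mxI(1,2)[OF that]] unfolding \<tau>_def .
  have \<tau>N: "\<tau> K \<notin> N L" if "K \<in> U" for K L using JT[OF that] unfolding N_def by blast
  have \<tau>pq: "\<tau> K \<noteq> p" "\<tau> K \<noteq> q" if "K \<in> U" for K
    using JT[OF that] nap mxI(3)[OF that] by blast+
  have cong: "mx K = mx L" if "N K = N L" for K L using that unfolding mx_def by simp
  have \<tau>cong: "\<tau> K = \<tau> L" if "N K = N L" for K L using cong[OF that] unfolding \<tau>_def by simp
  have insU: "insert (\<tau> K) K \<in> U" "N (insert (\<tau> K) K) = N K" "\<tau> (insert (\<tau> K) K) = \<tau> K" if K: "K \<in> U" for K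
  proof -
    note T = JT[OF K]
    show NN: "N (insert (\<tau> K) K) = N K" using T unfolding N_def by blast
    show "\<tau> (insert (\<tau> K) K) = \<tau> K" by (rule \<tau>cong[OF NN])
    have ch: "chain K" using K unfolding U_def by blast
    have cmp: "le y (\<tau> K) \<or> le (\<tau> K) y" if y: "y \<in> K" for y
    proof (cases "le a y")
      case False
      then have "le y (mx K)" using mx(2)[OF K] y unfolding N_def by blast
      then show ?thesis using T le_trans by blast
    next
      case True
      have "mx K \<in> K" "\<not> le a (mx K)" using mx(1)[OF K] unfolding N_def by auto
      then have "le (mx K) y" using ch y True le_trans unfolding chain_def by blast
      then show ?thesis using T True by blast
    qed
    have tP: "\<tau> K \<in> P" "le (\<tau> K) (\<tau> K)" using T le_in le_refl by blast+
    have "chain (insert (\<tau> K) K)" using ch cmp tP unfolding chain_def by blast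
    moreover have "le p (\<tau> K)" using T mxI(1)[OF K] le_trans by blast
    ultimately show "insert (\<tau> K) K \<in> U" using K T unfolding U_def by blast
  qed
  have remU: "K - {\<tau> K} \<in> U" "N (K - {\<tau> K}) = N K" "\<tau> (K - {\<tau> K}) = \<tau> K" if K: "K \<in> U" for K
  proof -
    show NN: "N (K - {\<tau> K}) = N K" using \<tau>N[OF K] unfolding N_def by blast
    show "\<tau> (K - {\<tau> K}) = \<tau> K" by (rule \<tau>cong[OF NN])
    have "p \<in> K - {\<tau> K}" "q \<in> K - {\<tau> K}" using K \<tau>pq[OF K] unfolding U_def by auto
    then show "K - {\<tau> K} \<in> U" using K chain_subset[of K "K - {\<tau> K}"] unfolding U_def by blast
  qed
  have finU: "finite K" if "K \<in> U" for K using that chain_finite unfolding U_def by blast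
  define \<mu> where "\<mu> K = card (N K) + card K" for K
  have down1: "down_closed ?K1" by (rule spanned_down_closed[OF R1])
  have main: "lifts_inclusion le \<K> ?K1 X Y f"
    if "?K0 \<subseteq> \<K>" "\<K> \<subseteq> ?K1" "down_closed \<K>" "\<And>K. K \<in> U \<Longrightarrow> \<tau> K \<in> K \<Longrightarrow> K - {\<tau> K} \<in> \<K> \<Longrightarrow> K \<in> \<K>" for \<K>
    using that
  proof (induction "card (?K1 - \<K>)" arbitrary: \<K> rule: less_induct)
    case less
    show ?case
    proof (cases "\<K> = ?K1")
      case True then show ?thesis using lifts_inclusion_refl by simp
    next
      case False
      \<comment> \<open>a new chain is missing together with its partner, as \<open>\<K>\<close> is closed under subsets\<close>
      have lower_upper: "insert (\<tau> K) K \<notin> \<K>" if "K \<in> U" "K \<notin> \<K>" for K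
      proof
        assume "insert (\<tau> K) K \<in> \<K>"
        then have "K \<in> \<K>" by (rule down_closedD[OF less.prems(3)]) (use that in \<open>auto simp: U_def\<close>)
        then show False using that by blast
      qed
      obtain K0 where "K0 \<in> ?K1" "K0 \<notin> \<K>" using False less.prems(2) by blast
      then have K0: "K0 \<in> U" "K0 \<notin> \<K>" using less.prems(1) K1 by blast+
      define Q where "Q K \<longleftrightarrow> K \<in> U \<and> \<tau> K \<in> K \<and> K \<notin> \<K>" for K
      have "Q (insert (\<tau> K0) K0)" unfolding Q_def using insU[OF K0(1)] lower_upper[OF K0] by simp
      then obtain K where K: "Q K" and min: "\<And>L. Q L \<Longrightarrow> \<mu> K \<le> \<mu> L"
        using ex_has_least_nat[of Q _ \<mu>] by blast
      have KU: "K \<in> U" "\<tau> K \<in> K" "K \<notin> \<K>" using K unfolding Q_def by auto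
      have facet: "K - {b} \<in> \<K>" if b: "b \<in> K" "b \<noteq> \<tau> K" for b
      proof (rule ccontr)
        assume nK: "K - {b} \<notin> \<K>"
        have "K - {b} \<noteq> {}" using KU(2) b by blast
        then have "K - {b} \<in> ?K1" using down_closedD[OF down1, of K "K - {b}"] KU(1) K1 by blast
        then have bU: "K - {b} \<in> U" using nK less.prems(1) K1 by blast
        have card: "card (K - {b}) < card K" by (rule card_Diff1_less[OF finU[OF KU(1)] b(1)])
        have NK: "finite (N K)" using finU[OF KU(1)] unfolding N_def by simp
        have Nb: "N (K - {b}) = N K - {b}" unfolding N_def by blast
        show False
        proof (cases "\<tau> (K - {b}) \<in> K - {b}")
          case True
          have "card (N (K - {b})) \<le> card (N K)" unfolding Nb by (rule card_mono[OF NK]) blast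
          then have "\<mu> (K - {b}) < \<mu> K" using card unfolding \<mu>_def by simp
          moreover have "Q (K - {b})" unfolding Q_def using bU nK True by blast
          ultimately show False using min[of "K - {b}"] by simp
        next
          case False
          have bN: "b \<in> N K"
          proof (rule ccontr)
            assume "b \<notin> N K"
            then have "N (K - {b}) = N K" unfolding Nb by blast
            then have "\<tau> (K - {b}) = \<tau> K" by (rule \<tau>cong)
            then show False using False KU(2) b(2) by simp
          qed
          let ?L = "insert (\<tau> (K - {b})) (K - {b})"
          have "card (N ?L) < card (N K)"
            unfolding insU(2)[OF bU] unfolding Nb by (rule card_Diff1_less[OF NK bN])
          moreover have "card ?L = card K"
            using card_insert_disjoint[OF _ False] finU[OF KU(1)] card_Suc_Diff1[OF finU[OF KU(1)] b(1)] by simp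
          ultimately have "\<mu> ?L < \<mu> K" unfolding \<mu>_def by simp
          moreover have "Q ?L" unfolding Q_def using insU[OF bU] lower_upper[OF bU nK] by simp
          ultimately show False using min[of ?L] by simp
        qed
      qed
      obtain \<sigma> where \<sigma>: "set \<sigma> = K" "distinct \<sigma>" "sorted_wrt le \<sigma>"
        using chain_list KU(1) unfolding U_def by blast
      have lenK: "length \<sigma> = card K" using \<sigma>(1,2) distinct_card by metis
      obtain j where j: "j < length \<sigma>" "\<sigma> ! j = \<tau> K" using KU(2) \<sigma>(1) by (metis in_set_conv_nth)
      obtain ip where ip: "ip < length \<sigma>" "\<sigma> ! ip = p" using KU(1) \<sigma>(1) unfolding U_def by (metis (mono_tags) in_set_conv_nth mem_Collect_eq)
      obtain iq where iq: "iq < length \<sigma>" "\<sigma> ! iq = q" using KU(1) \<sigma>(1) unfolding U_def by (metis (mono_tags) in_set_conv_nth mem_Collect_eq)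
      have bnd: "le p (\<tau> K)" "le (\<tau> K) q" using KU unfolding U_def by blast+
      have "ip < j"
      proof (rule ccontr)
        assume "\<not> ip < j"
        moreover have "ip \<noteq> j" using ip j \<tau>pq(1)[OF KU(1)] by auto
        ultimately have "le (\<tau> K) p" using sorted_wrt_nth_less[OF \<sigma>(3), of j ip] ip j by simp
        then show False using bnd(1) le_anti \<tau>pq(1)[OF KU(1)] by blast
      qed
      have "j < iq"
      proof (rule ccontr)
        assume "\<not> j < iq"
        moreover have "iq \<noteq> j" using iq j \<tau>pq(2)[OF KU(1)] by auto
        ultimately have "le q (\<tau> K)" using sorted_wrt_nth_less[OF \<sigma>(3), of iq j] iq j by simp
        then show False using bnd(2) le_anti \<tau>pq(2)[OF KU(1)] by blast
      qed
      define n where "n = length \<sigma> - 1"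
      have n: "length \<sigma> = Suc n" "0 < j" "j < n" unfolding n_def using \<open>ip < j\<close> \<open>j < iq\<close> iq by simp_all
      define \<L> where "\<L> = \<K> \<union> {K, K - {\<tau> K}}"
      have rm: "K - {\<tau> K} \<notin> \<K>" using less.prems(4)[OF KU(1,2)] KU(3) by blast
      have reflK: "\<forall>M\<in>\<K>. \<forall>x\<in>M. le x x" using less.prems(2) spanned_refl[of ?R1] by blast
      have anti: "\<forall>x y. le x y \<longrightarrow> le y x \<longrightarrow> x = y" using le_anti by blast
      have step: "lifts_inclusion le \<K> \<L> X Y f"
      proof (rule lifts_attach_simplex[where le = le, OF fib anti n(1) \<sigma>(2,3) _ n(2,3) less.prems(3) reflK])
        show "\<forall>x\<in>set \<sigma>. le x x" using \<sigma>(1) KU(1) le_refl unfolding U_def chain_def by blast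
        show "set \<sigma> \<notin> \<K>" "set \<sigma> - {\<sigma> ! j} \<notin> \<K>" using KU(3) rm \<sigma>(1) j(2) by simp_all
        show "\<forall>i\<le>n. i \<noteq> j \<longrightarrow> set \<sigma> - {\<sigma> ! i} \<in> \<K>"
        proof (intro allI impI)
          fix i assume i: "i \<le> n" "i \<noteq> j"
          have "\<sigma> ! i \<in> K" using \<sigma>(1) n(1) i(1) nth_mem[of i \<sigma>] by simp
          moreover have "\<sigma> ! i \<noteq> \<tau> K" using j n(1) i \<sigma>(2) nth_eq_iff_index_eq[of \<sigma> i j] by simp
          ultimately show "set \<sigma> - {\<sigma> ! i} \<in> \<K>" using facet \<sigma>(1) by simp
        qed
        show "\<L> = \<K> \<union> {set \<sigma>, set \<sigma> - {\<sigma> ! j}}" unfolding \<L>_def \<sigma>(1) j(2) ..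
      qed
      have LK1: "\<L> \<subseteq> ?K1" unfolding \<L>_def using less.prems(2) KU(1) remU(1)[OF KU(1)] K1 by blast
      have downL: "down_closed \<L>"
        unfolding down_closed_def
      proof (intro ballI allI impI)
        fix A B assume A: "A \<in> \<L>" and B: "B \<noteq> {}" "B \<subseteq> A"
        show "B \<in> \<L>"
        proof (cases "A \<in> \<K>")
          case True
          then show ?thesis using down_closedD[OF less.prems(3) True B] unfolding \<L>_def by blast
        next
          case False
          then have "A \<subseteq> K" using A unfolding \<L>_def by blast
          then have BK: "B \<subseteq> K" using B by blast
          show ?thesis
          proof (cases "B = K \<or> B = K - {\<tau> K}")
            case True then show ?thesis unfolding \<L>_def by blast
          next
            case False
            then obtain b where "b \<in> K" "b \<noteq> \<tau> K" "b \<notin> B" using BK by blast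
            then have "K - {b} \<in> \<K>" "B \<subseteq> K - {b}" using facet BK by blast+
            then show ?thesis using down_closedD[OF less.prems(3) _ B(1)] unfolding \<L>_def by blast
          qed
        qed
      qed
      have less_card: "card (?K1 - \<L>) < card (?K1 - \<K>)"
      proof (rule psubset_card_mono)
        show "finite (?K1 - \<K>)" using finite_spanned by simp
        have "K \<in> ?K1 - \<K>" "K \<notin> ?K1 - \<L>" using KU K1 unfolding \<L>_def by blast+
        then show "?K1 - \<L> \<subset> ?K1 - \<K>" unfolding \<L>_def by blast
      qed
      have pair: "M \<in> \<L>" if M: "M \<in> U" "\<tau> M \<in> M" "M - {\<tau> M} \<in> \<L>" for M
      proof -
        consider "M - {\<tau> M} \<in> \<K>" | "M - {\<tau> M} = K" | "M - {\<tau> M} = K - {\<tau> K}"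
          using M(3) unfolding \<L>_def by blast
        then show ?thesis
        proof cases
          case 1 then show ?thesis using less.prems(4)[OF M(1,2)] unfolding \<L>_def by blast
        next
          case 2
          have "\<tau> K = \<tau> (M - {\<tau> M})" by (rule arg_cong[OF 2[symmetric]])
          also have "\<dots> = \<tau> M" by (rule remU(3)[OF M(1)])
          finally show ?thesis using KU(2) 2 by blast
        next
          case 3
          have "\<tau> K = \<tau> (K - {\<tau> K})" by (rule remU(3)[OF KU(1), symmetric])
          also have "\<dots> = \<tau> (M - {\<tau> M})" by (rule arg_cong[OF 3[symmetric]])
          also have "\<dots> = \<tau> M" by (rule remU(3)[OF M(1)])
          finally have eq: "\<tau> K = \<tau> M" .
          have "M = insert (\<tau> M) (M - {\<tau> M})" by (rule insert_Diff[OF M(2), symmetric])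
          also have "\<dots> = insert (\<tau> K) (K - {\<tau> K})" by (rule arg_cong2[where f = insert, OF eq[symmetric] 3])
          also have "\<dots> = K" by (rule insert_Diff[OF KU(2)])
          finally show ?thesis by (simp add: \<L>_def)
        qed
      qed
      have "lifts_inclusion le \<L> ?K1 X Y f"
        by (rule less.hyps[OF less_card _ LK1 downL pair]) (use less.prems(1) in \<open>auto simp: \<L>_def\<close>)
      moreover have "simplicial_set (chain_nerve le \<L>)"
        by (rule simplicial_set_chain_nerve[where le = le, OF downL]) (use LK1 spanned_refl[of ?R1] in blast)
      moreover have "\<K> \<subseteq> \<L>" unfolding \<L>_def by blast
      ultimately show ?thesis using lifts_inclusion_trans[OF step] LK1 by blast
    qed
  qed
  show ?thesis
  proof (rule main)
    show "?K0 \<subseteq> ?K1" using K1 by blast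
    show "down_closed ?K0" by (rule spanned_down_closed[OF R])
    show "K \<in> ?K0" if "K \<in> U" "\<tau> K \<in> K" "K - {\<tau> K} \<in> ?K0" for K
      using remU(1)[OF that(1)] that(3) K0U by blast
  qed blast
qed

text \<open>
  Related pairs are added in the order of the size of their intervals, which keeps the relation
  convex. The contracting elements depend on the order alone and so remain available.
\<close>

theorem lifts_spanned:
  assumes fib: "mid_fibration X Y f"
    and R: "convex_rel R" and R': "convex_rel R'" and sub: "\<And>x y. R x y \<Longrightarrow> R' x y"
    and le: "\<And>x y. R' x y \<Longrightarrow> le x y"
    and contract: "\<And>p q. R' p q \<Longrightarrow> \<not> R p q \<Longrightarrow> \<exists>a. le p a \<and> p \<noteq> a \<and> le a q \<and>
      (\<forall>x. le p x \<longrightarrow> le x q \<longrightarrow> (\<exists>j. le x j \<and> le a j \<and> le j q \<and>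
         (\<forall>y. le x y \<longrightarrow> le a y \<longrightarrow> le j y) \<and> (x \<noteq> q \<longrightarrow> j \<noteq> q)))"
  shows "lifts_inclusion le (spanned R) (spanned R') X Y f"
  using R sub contract
proof (induction "card {(p, q). R' p q \<and> \<not> R p q}" arbitrary: R rule: less_induct)
  case less
  let ?D = "{(p, q). R' p q \<and> \<not> R p q}"
  have finD: "finite ?D"
    by (rule finite_subset[of _ "P \<times> P"]) (use fin le le_in in blast)+
  show ?case
  proof (cases "?D = {}")
    case True
    then have "R = R'" using less.prems(2) by (intro ext) blast
    then show ?thesis using lifts_inclusion_refl by simp
  next
    case False
    define w where "w pq = card {x. le (fst pq) x \<and> le x (snd pq)}" for pq
    obtain pq where pq: "pq \<in> ?D" "\<And>r. r \<in> ?D \<Longrightarrow> w pq \<le> w r"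
      using False ex_has_least_nat[of "\<lambda>r. r \<in> ?D" _ w] by blast
    obtain p q where [simp]: "pq = (p, q)" by (cases pq)
    have D: "R' p q" "\<not> R p q" using pq(1) by auto
    have min: "R p' q'" if p': "le p p'" "le p' q'" "le q' q" "(p', q') \<noteq> (p, q)" for p' q'
    proof (rule ccontr)
      assume "\<not> R p' q'"
      moreover have "R' p' q'" using R' D(1) p' unfolding convex_rel_def by blast
      ultimately have "w (p, q) \<le> w (p', q')" using pq(2)[of "(p', q')"] by simp
      moreover have "w (p', q') < w (p, q)"
        unfolding w_def fst_conv snd_conv
      proof (rule psubset_card_mono)
        show "finite {x. le p x \<and> le x q}" by (rule finite_subset[OF _ fin]) (use le_in in blast)
        have "p \<notin> {x. le p' x \<and> le x q'} \<or> q \<notin> {x. le p' x \<and> le x q'}" using p' le_anti by blast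
        moreover have "p \<in> {x. le p x \<and> le x q}" "q \<in> {x. le p x \<and> le x q}"
          using le[OF D(1)] le_in le_refl by blast+
        moreover have "{x. le p' x \<and> le x q'} \<subseteq> {x. le p x \<and> le x q}" using p' le_trans by blast
        ultimately show "{x. le p' x \<and> le x q'} \<subset> {x. le p x \<and> le x q}" by blast
      qed
      ultimately show False by simp
    qed
    let ?R1 = "\<lambda>x y. R x y \<or> x = p \<and> y = q"
    have conv: "convex_rel ?R1"
      unfolding convex_rel_def using less.prems(1)[unfolded convex_rel_def] min by blast
    obtain a where a: "le p a" "p \<noteq> a" "le a q"
      and ex: "\<forall>x. le p x \<longrightarrow> le x q \<longrightarrow> (\<exists>j. le x j \<and> le a j \<and> le j q \<and>
         (\<forall>y. le x y \<longrightarrow> le a y \<longrightarrow> le j y) \<and> (x \<noteq> q \<longrightarrow> j \<noteq> q))"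
      using less.prems(3)[OF D] by blast
    from ex have "\<forall>x. \<exists>j. le p x \<longrightarrow> le x q \<longrightarrow> (le x j \<and> le a j \<and> le j q \<and>
         (\<forall>y. le x y \<longrightarrow> le a y \<longrightarrow> le j y) \<and> (x \<noteq> q \<longrightarrow> j \<noteq> q))" by blast
    then obtain J where J: "\<forall>x. le p x \<longrightarrow> le x q \<longrightarrow> (le x (J x) \<and> le a (J x) \<and> le (J x) q \<and>
         (\<forall>y. le x y \<longrightarrow> le a y \<longrightarrow> le (J x) y) \<and> (x \<noteq> q \<longrightarrow> J x \<noteq> q))"
      using choice[of "\<lambda>x j. le p x \<longrightarrow> le x q \<longrightarrow> (le x j \<and> le a j \<and> le j q \<and>
         (\<forall>y. le x y \<longrightarrow> le a y \<longrightarrow> le j y) \<and> (x \<noteq> q \<longrightarrow> j \<noteq> q))"] by blast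
    have step: "lifts_inclusion le (spanned R) (spanned ?R1) X Y f"
      by (rule lifts_add_interval[OF fib less.prems(1) D(2) conv a J])
    have "card {(x, y). R' x y \<and> \<not> ?R1 x y} < card ?D"
      by (rule psubset_card_mono[OF finD]) (use D in blast)
    then have rest: "lifts_inclusion le (spanned ?R1) (spanned R') X Y f"
    proof (rule less.hyps[OF _ conv])
      show "R' x y" if "?R1 x y" for x y using that less.prems(2) D(1) by blast
    qed (use less.prems(3) in blast)
    have "spanned R \<subseteq> spanned ?R1" "spanned ?R1 \<subseteq> spanned R'"
      using less.prems(2) D(1) unfolding spanned_def by blast+
    then show ?thesis by (rule lifts_inclusion_trans[OF step rest _ _ simplicial_set_spanned[OF conv]])
  qed
qed

end

section \<open>The nerve of a pasting diagram\<close>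

context globular_digraph
begin

sublocale paths: finite_poset paths le
  by unfold_locales (use finite_paths le_paths le_refl le_trans le_antisym in blast)+

end

locale pasting_nerve = pasting_digraph G E "source_of G" "target_of G" S
  for G :: "('v, 'e) pre_digraph" and E S
begin

abbreviation "src \<equiv> source_of G"
abbreviation "tgt \<equiv> target_of G"

lemma st_paths_eq: "st_paths G = paths"
  unfolding st_paths_def paths_def using awalk_apath by (auto simp: apath_def)

text \<open>
  The definition of the boundary of a face prescribes the jump of the winding number between the
  exterior face, where it vanishes, and the other faces.
\<close>

lemma dom_cod_wdiff:
  assumes H: "subgraph H G" and dc: "dom_cod E H c d"
  shows "set c \<union> set d \<subseteq> arcs H" "z \<notin> supp \<Longrightarrow> wdiff c d z \<le> 0"
proof -
  have "set c \<union> set d \<subseteq> arcs H \<and> (z \<notin> supp \<longrightarrow> wdiff c d z \<le> 0)"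
  proof (cases "c = [] \<and> d = []")
    case True then show ?thesis by simp
  next
    case False
    let ?X = "outside (support E H)"
    have "clockwise_boundary E H ?X d c"
      using dc False unfolding dom_cod_def face_dom_cod_def exterior_face_def by simp
    then obtain u v where N: "d \<noteq> []" "c \<noteq> []" and ap: "pre_digraph.apath H u d v" "pre_digraph.apath H u c v"
      and wn: "\<And>z w. z \<in> ?X \<Longrightarrow> w \<in> - (support E H \<union> ?X) \<Longrightarrow>
        winding_number (loop_of d c) z = winding_number (loop_of d c) w - 1"
      unfolding clockwise_boundary_def Let_def by blast
    have W: "awalk u d v" "awalk u c v" and A: "set c \<union> set d \<subseteq> arcs H"
      using ap unfolding sub_apath[OF H] by auto
    have sub: "tr (set d \<union> set c) \<subseteq> support E H"
      unfolding supp_sub(1)[OF H] using trace_mono[of "set d \<union> set c" "arcs H"] A by blast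
    have zero: "wdiff d c w = 0" if "w \<in> ?X" for w
      by (rule wdiff_outside[OF W]) (use N subsetD[OF outside_mono[OF sub] that] in simp_all)
    have "wdiff c d z \<le> 0" if z: "z \<notin> supp"
    proof (cases "z \<in> ?X")
      case True
      then show ?thesis using zero wdiff_sym[of c d z] by simp
    next
      case False
      have zH: "z \<notin> support E H" using z supp_sub(2)[OF H] by blast
      obtain w where w: "w \<in> ?X"
        using outside_bounded_nonempty[OF compact_imp_bounded[OF compact_support_sub[OF H]]] by blast
      have off: "w \<notin> tr (set d \<union> set c)" "z \<notin> tr (set d \<union> set c)"
        using not_in_if_outside[OF w] zH sub by auto
      have "z \<in> - (support E H \<union> ?X)" using zH False by simp
      from wn[OF w this] have "complex_of_real (wdiff d c w) = complex_of_real (wdiff d c z) - 1"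
        using winding_loop[OF W N off(1)] winding_loop[OF W N off(2)] by simp
      then have "complex_of_real (wdiff d c w) = complex_of_real (wdiff d c z - 1)" by simp
      then have "wdiff d c w = wdiff d c z - 1" unfolding of_real_eq_iff .
      then show ?thesis using zero[OF w] wdiff_sym[of c d z] by simp
    qed
    then show ?thesis using A by blast
  qed
  then show "set c \<union> set d \<subseteq> arcs H" "z \<notin> supp \<Longrightarrow> wdiff c d z \<le> 0" by auto
qed

lemma witnessD:
  assumes "witness E G \<gamma> p q"
  shows "le p q" "(set p - set q) \<union> (set q - set p) \<subseteq> arcs \<gamma>"
proof -
  obtain a b c d where g: "subgraph \<gamma> G" "dom_cod E \<gamma> c d" "p = a @ c @ b" "q = a @ d @ b"
    and pq: "p \<in> st_paths G" "q \<in> st_paths G" using assms unfolding witness_def by blast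
  show "(set p - set q) \<union> (set q - set p) \<subseteq> arcs \<gamma>" using dom_cod_wdiff(1)[OF g(1,2)] g(3,4) by auto
  have "wdiff p q z \<le> 0" if "z \<notin> supp" for z
    unfolding g(3,4) wdiff_replace by (rule dom_cod_wdiff(2)[OF g(1,2) that])
  then show "le p q" unfolding le_def using pq st_paths_eq by simp
qed

lemma path_le_le: "path_le E G p q \<Longrightarrow> le p q"
  unfolding path_le_def using witnessD(1) by blast

lemma rel_witness:
  assumes "rel p q"
  shows "witness E G (path_union src p q) p q"
proof -
  note l = rel_le[OF assms]
  note pq = leD(1,2)[OF l]
  obtain A where "A \<in> S" "(set p - set q) \<union> (set q - set p) \<subseteq> arcs A" using assms unfolding rel_def by blast
  then have "path_union src p q \<in> S" by (rule parallel_in_S[OF pq])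
  note U = in_S[OF this]
  note gl = path_union_glob[OF pq leD(3)[OF l] U(2)]
  note st = path_union_source_of[OF pq]
  have "apath src [] src" "apath tgt [] tgt" using s_vert t_vert by (simp_all add: apath_Nil_iff)
  moreover have "p \<in> st_paths G" "q \<in> st_paths G" using le_paths[OF l] st_paths_eq by simp_all
  ultimately show ?thesis
    unfolding witness_def st using gl U(1)
    by (intro conjI exI[of _ "[]"] exI[of _ p] exI[of _ q]) simp_all
qed

lemma convex_rel: "paths.convex_rel rel"
  unfolding paths.convex_rel_def using rel_subinterval by blast

text \<open>
  For a simplex with witnesses in \<open>A\<close>, an arc in which the first and the last path differ
  belongs to one of the witnesses. Conversely, a graph that contains everything between the
  first and the last path contains the unions of consecutive paths, which are witnesses.
\<close>

lemma diagram_simplices: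
  assumes len: "length xs = Suc n"
  shows "set xs \<subseteq> st_paths G \<and> sorted_wrt (path_le E G) xs \<and>
      (\<exists>A\<in>S. \<forall>i<n. \<exists>\<gamma>. witness E G \<gamma> (xs ! i) (xs ! Suc i) \<and> subgraph \<gamma> A) \<longleftrightarrow>
    sorted_wrt le xs \<and> set xs \<in> paths.spanned rel" (is "?L \<longleftrightarrow> ?R")
proof
  have ne: "xs \<noteq> []" using len by auto
  have hl: "hd xs = xs ! 0" "last xs = xs ! n" using len ne by (simp_all add: hd_conv_nth last_conv_nth)
  have spanned: "sorted_wrt le xs \<Longrightarrow> set xs \<in> paths.spanned rel \<longleftrightarrow> set xs \<subseteq> paths \<and> rel (xs ! 0) (xs ! n)"
    using paths.set_in_spanned[OF _ ne] hl by simp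
  {
    assume L: ?L
    then obtain A where A: "A \<in> S"
      "\<And>i. i < n \<Longrightarrow> \<exists>\<gamma>. witness E G \<gamma> (xs ! i) (xs ! Suc i) \<and> subgraph \<gamma> A" by blast
    have P: "set xs \<subseteq> paths" using L st_paths_eq by simp
    have "sorted_wrt (path_le E G) xs" using L by blast
    then have so: "sorted_wrt le xs" by (rule sorted_wrt_mono_rel[rotated]) (rule path_le_le)
    have "le (xs ! 0) (xs ! i) \<and> (set (xs ! 0) - set (xs ! i)) \<union> (set (xs ! i) - set (xs ! 0)) \<subseteq> arcs A" if "i \<le> n" for i
      using that
    proof (induction i)
      case 0
      have "xs ! 0 \<in> paths" using P len nth_mem[of 0 xs] by auto
      then show ?case using le_refl by simp
    next
      case (Suc i)
      then obtain \<gamma> where g: "witness E G \<gamma> (xs ! i) (xs ! Suc i)" "subgraph \<gamma> A" using A(2)[of i] by auto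
      have "arcs \<gamma> \<subseteq> arcs A" using g(2) by (simp add: subgraph_def)
      then have "(set (xs ! i) - set (xs ! Suc i)) \<union> (set (xs ! Suc i) - set (xs ! i)) \<subseteq> arcs A"
        using witnessD(2)[OF g(1)] by blast
      moreover have IH: "le (xs ! 0) (xs ! i)"
        "(set (xs ! 0) - set (xs ! i)) \<union> (set (xs ! i) - set (xs ! 0)) \<subseteq> arcs A"
        using Suc by simp_all
      ultimately have "(set (xs ! 0) - set (xs ! Suc i)) \<union> (set (xs ! Suc i) - set (xs ! 0)) \<subseteq> arcs A"
        by blast
      then show ?case using le_trans[OF IH(1) witnessD(1)[OF g(1)]] by simp
    qed
    from this[of n] have "rel (xs ! 0) (xs ! n)" unfolding rel_def using A(1) by blast
    then show ?R using spanned[OF so] so P by blast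
  }
  {
    assume R: ?R
    then have so: "sorted_wrt le xs" and P: "set xs \<subseteq> paths" and r: "rel (xs ! 0) (xs ! n)"
      using spanned by blast+
    have inP: "xs ! i \<in> paths" if "i \<le> n" for i using P len nth_mem[of i xs] that by auto
    have mono: "le (xs ! i) (xs ! k)" if "i \<le> k" "k \<le> n" for i k
      using sorted_wrt_nth_less[OF so, of i k] le_refl[OF inP[of k]] that len by (cases "i = k") simp_all
    have rels: "rel (xs ! i) (xs ! k)" if "i \<le> k" "k \<le> n" for i k
      by (rule rel_subinterval[OF r]) (use mono that in simp_all)
    note pq = leD(1,2)[OF rel_le[OF r]]
    obtain A where A: "A \<in> S" "(set (xs ! 0) - set (xs ! n)) \<union> (set (xs ! n) - set (xs ! 0)) \<subseteq> arcs A"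
      using r unfolding rel_def by blast
    obtain B where B: "B \<in> S" "is_source B src" "set (xs ! 0) \<union> set (xs ! n) \<subseteq> arcs B"
      "\<And>f. f \<in> arcs G \<Longrightarrow> open_arc E f \<inter> inside (support E (path_union src (xs ! 0) (xs ! n))) \<noteq> {} \<Longrightarrow> f \<in> arcs B"
      by (rule parallel_filling_in_S[OF pq A]) blast
    have inB: "set (xs ! i) \<subseteq> arcs B" if "i \<le> n" for i
      by (rule between_in_filling[OF pq B(3,4)]) (use mono that in simp_all)
    note BG = in_S(1)[OF B(1)]
    have "witness E G (path_union src (xs ! i) (xs ! Suc i)) (xs ! i) (xs ! Suc i) \<and>
        subgraph (path_union src (xs ! i) (xs ! Suc i)) B" if i: "i < n" for i
    proof
      show "witness E G (path_union src (xs ! i) (xs ! Suc i)) (xs ! i) (xs ! Suc i)"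
        by (rule rel_witness[OF rels]) (use i in simp_all)
      have le: "le (xs ! i) (xs ! Suc i)" using mono i by simp
      note w = leD(1,2)[OF le]
      have arcsB: "set (xs ! i) \<union> set (xs ! Suc i) \<subseteq> arcs B" using inB[of i] inB[of "Suc i"] i by simp
      have sB: "src \<in> verts B" using B(2) unfolding is_source_def by blast
      have endB: "set (awalk_verts src r) \<subseteq> verts B" if "awalk src r tgt" "set r \<subseteq> arcs B" for r
        using set_awalk_verts[OF that(1)] that(2) sB sub_arc_verts(1,2)[OF BG] by auto
      show "subgraph (path_union src (xs ! i) (xs ! Suc i)) B"
      proof (rule sub_sub[OF path_union_sub[OF w] BG])
        show "verts (path_union src (xs ! i) (xs ! Suc i)) \<subseteq> verts B"
          unfolding path_union_sel using endB[OF w(1)] endB[OF w(2)] arcsB by blast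
        show "arcs (path_union src (xs ! i) (xs ! Suc i)) \<subseteq> arcs B" unfolding path_union_sel by (rule arcsB)
      qed
    qed
    then have wit: "\<exists>A\<in>S. \<forall>i<n. \<exists>\<gamma>. witness E G \<gamma> (xs ! i) (xs ! Suc i) \<and> subgraph \<gamma> A" using B(1) by blast
    have "sorted_wrt (path_le E G) xs"
      unfolding sorted_wrt_iff_nth_less path_le_def
    proof (intro allI impI)
      fix i k assume "i < k" "k < length xs"
      then have "rel (xs ! i) (xs ! k)" using rels len by simp
      then show "\<exists>\<gamma>. witness E G \<gamma> (xs ! i) (xs ! k)" using rel_witness by blast
    qed
    then show ?L using P st_paths_eq wit by simp
  }
qed

lemma diagram_nerve_eq: "diagram_nerve E G S = chain_nerve le (paths.spanned rel)"
proof -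
  have "{xs. (length xs = Suc n \<and> set xs \<subseteq> st_paths G \<and> sorted_wrt (path_le E G) xs) \<and>
      (\<exists>A\<in>S. \<forall>i<n. \<exists>\<gamma>. witness E G \<gamma> (xs ! i) (xs ! Suc i) \<and> subgraph \<gamma> A)} =
    {xs. length xs = Suc n \<and> sorted_wrt le xs \<and> set xs \<in> paths.spanned rel}" for n
    using diagram_simplices[of _ n] by (intro Collect_cong) blast
  then show ?thesis by (simp add: diagram_nerve_def graph_nerve_def nerve_def chain_nerve_def)
qed

end

lemma globular_digraph_if_globular:
  assumes "globular E G"
  shows "globular_digraph G E (source_of G) (target_of G)"
proof -
  have plane: "plane_graph E G" using assms unfolding globular_def by blast
  then have "fin_digraph G" unfolding plane_graph_def by blast
  then interpret plane_digraph G E using plane by (simp add: plane_digraph_def plane_digraph_axioms_def)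
  have wf: "wf_digraph G" by unfold_locales
  have src: "is_source G (source_of G)" and tgt: "is_target G (target_of G)"
    and ext: "pt (source_of G) \<in> closure (outside supp)" "pt (target_of G) \<in> closure (outside supp)"
  proof -
    have "is_source G (source_of G) \<and> is_target G (target_of G) \<and>
        pt (source_of G) \<in> closure (outside supp) \<and> pt (target_of G) \<in> closure (outside supp)"
    proof (cases "trivial_graph G")
      case True
      then obtain v where v: "verts G = {v}" "arcs G = {}" unfolding trivial_graph_def by blast
      have ap: "apath v [] v" using v by (simp add: apath_Nil_iff)
      have s: "is_source G w \<longleftrightarrow> w = v" for w unfolding is_source_def v using ap by blast
      have "pre_digraph.apath (opposite G) v [] v" unfolding opposite_apath[OF wf] using ap by simp
      then have t: "is_target G w \<longleftrightarrow> w = v" for w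
        unfolding is_target_def is_source_def by (auto simp: opposite_sel v)
      have "source_of G = v" "target_of G = v" unfolding source_of_def target_of_def s t by simp_all
      moreover have "supp = {pt v}" by (simp add: support_def v)
      moreover have "outside {pt v} = - {pt v}" using inside_convex[of "{pt v}"] inside_Un_outside[of "{pt v}"] by simp
      ultimately show ?thesis using s t by (simp add: closure_complement)
    next
      case False
      then have "st_graph E G" using assms unfolding globular_def by blast
      then have st: "\<exists>!s. is_source G s" "\<exists>!t. is_target G t"
        and vi: "vertex_incident E G (source_of G) (exterior_face E G)"
          "vertex_incident E G (target_of G) (exterior_face E G)" unfolding st_graph_def by blast+
      have "is_source G (source_of G)" "is_target G (target_of G)"
        unfolding source_of_def target_of_def using theI'[OF st(1)] theI'[OF st(2)] by blast+
      then show ?thesis using vi unfolding vertex_incident_def exterior_face_def frontier_def by blast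
    qed
    then show "is_source G (source_of G)" "is_target G (target_of G)"
      "pt (source_of G) \<in> closure (outside supp)" "pt (target_of G) \<in> closure (outside supp)" by blast+
  qed
  have s: "source_of G \<in> verts G" "\<And>v. v \<in> verts G \<Longrightarrow> \<exists>p. awalk (source_of G) p v"
    using src unfolding is_source_def apath_def by blast+
  have t: "target_of G \<in> verts G" "\<And>v. v \<in> verts G \<Longrightarrow> \<exists>p. awalk v p (target_of G)"
    using tgt unfolding is_target_def is_source_def opposite_apath[OF wf] opposite_sel apath_def by blast+
  show ?thesis
  proof unfold_locales
    show "globular_face E G \<phi>" if "arcs G \<noteq> {}" "\<phi> \<in> faces E G" for \<phi>
      using assms that unfolding globular_def trivial_graph_def by blast
  qed (use s t ext in blast)+
qed

theorem theoremC:
  fixes E :: "('v, 'e) drawing" and G :: "('v, 'e) pre_digraph"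
    and S T :: "('v, 'e) pre_digraph set"
  assumes "complete_pasting_diagram E G S"
    and "complete_pasting_diagram E G T"
    and "S \<subseteq> T"
    and "contains_interior_faces E G S" and "contains_interior_faces E G T"
    and "closed_under_subdivisions E G S" and "closed_under_subdivisions E G T"
  shows "mid_anodyne TYPE('x) TYPE('y) (diagram_nerve E G S) (diagram_nerve E G T) (\<lambda>n x. x)"
proof -
  have "globular E G" using assms(1) unfolding complete_pasting_diagram_def pasting_diagram_def by blast
  then interpret globular_digraph G E "source_of G" "target_of G" by (rule globular_digraph_if_globular)
  interpret A: pasting_nerve G E S by unfold_locales (use assms in blast)+
  interpret B: pasting_nerve G E T by unfold_locales (use assms in blast)+
  have sub: "B.rel p q" if "A.rel p q" for p q
    using that assms(3) unfolding A.rel_def B.rel_def by blast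
  then have spanned: "paths.spanned A.rel \<subseteq> paths.spanned B.rel" unfolding paths.spanned_def by blast
  have setA: "simplicial_set (chain_nerve le (paths.spanned A.rel))"
    and setB: "simplicial_set (chain_nerve le (paths.spanned B.rel))"
    by (rule paths.simplicial_set_spanned[OF A.convex_rel], rule paths.simplicial_set_spanned[OF B.convex_rel])
  have "simplicial_map (chain_nerve le (paths.spanned A.rel)) (chain_nerve le (paths.spanned B.rel)) (\<lambda>n x. x)"
    unfolding simplicial_map_def chain_nerve_sel(2)
    using setA setB spanned by (auto simp: chain_nerve_sel)
  note map = this
  have lift: "lifts_inclusion le (paths.spanned A.rel) (paths.spanned B.rel) X Y f"
    if fib: "mid_fibration X Y f" for X :: "'x sset" and Y :: "'y sset" and f
  proof (rule paths.lifts_spanned[OF fib A.convex_rel B.convex_rel sub B.rel_le])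
    fix p q assume "B.rel p q" "\<not> A.rel p q"
    then show "\<exists>a. le p a \<and> p \<noteq> a \<and> le a q \<and>
      (\<forall>x. le p x \<longrightarrow> le x q \<longrightarrow> (\<exists>j. le x j \<and> le a j \<and> le j q \<and>
         (\<forall>y. le x y \<longrightarrow> le a y \<longrightarrow> le j y) \<and> (x \<noteq> q \<longrightarrow> j \<noteq> q)))"
      using A.exists_contracting_path[OF B.rel_le] by blast
  qed
  show ?thesis
    unfolding mid_anodyne_def A.diagram_nerve_eq B.diagram_nerve_eq
    by (intro conjI allI impI map lift)
qed

end
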